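(* Let $k$ be an algebraically closed field and let $Q_2$ be the quiver with vertices $b,+,-,e$ and arrows $b\to +$, $+\to e$, $b\to -$, $-\to e$. The exceptional objects of $Rep_k(Q_2)$, up to isomorphism, are the following representations ($m=0,1,2,\dots$), where a representation is given by its spaces $(V_b,V_-,V_+,V_e)$ and its maps $(V_b\to V_+,\ V_+\to V_e,\ V_b\to V_-,\ V_-\to V_e)$: $E_1^m$: spaces $(k^{m+1},k^m,k^m,k^m)$, maps $(\pi_+^m,\mathrm{Id},\pi_-^m,\mathrm{Id})$; $E_2^m$: spaces $(k^{m},k^{m+1},k^{m+1},k^{m+1})$, maps $(j_+^m,\mathrm{Id},j_-^m,\mathrm{Id})$; $E_3^m$: spaces $(k^{m},k^{m},k^{m},k^{m+1})$, maps $(\mathrm{Id},j_+^m,\mathrm{Id},j_-^m)$; $E_4^m$: spaces $(k^{m+1},k^{m+1},k^{m+1},k^{m})$, maps $(\mathrm{Id},\pi_+^m,\mathrm{Id},\pi_-^m)$; $E_5^m$: spaces $(k^{m},k^{m+1},k^{m},k^{m+1})$, maps $(\mathrm{Id},j_+^m,j_-^m,\mathrm{Id})$; $E_6^m$: spaces $(k^{m+1},k^{m},k^{m+1},k^{m})$, maps $(\mathrm{Id},\pi_+^m,\pi_-^m,\mathrm{Id})$; $E_7^m$: spaces $(k^{m+1},k^{m+1},k^{m},k^{m})$, maps $(\pi_+^m,\mathrm{Id},\mathrm{Id},\pi_-^m)$; $E_8^m$: spaces $(k^{m},k^{m},k^{m+1},k^{m+1})$, maps $(j_+^m,\mathrm{Id},\mathrm{Id},j_-^m)$;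 $F_+$: spaces $(0,0,k,0)$, all maps zero; $F_-$: spaces $(0,k,0,0)$, all maps zero; $G_+$: spaces $(k,0,k,k)$, maps $(\mathrm{Id},\mathrm{Id},0,0)$; $G_-$: spaces $(k,k,0,k)$, maps $(0,0,\mathrm{Id},\mathrm{Id})$.
   Context: $Rep_k(Q)$ is the category of finite-dimensional $k$-representations of $Q$ (no relations imposed). An object $X$ of $Rep_k(Q)$ is exceptional if $\mathrm{Hom}(X,X)=k$ and $\mathrm{Ext}^i(X,X)=0$ for $i\neq0$. For $m\ge 1$ the maps $\pi_\pm^m:k^{m+1}\to k^m$ and $j_\pm^m:k^m\to k^{m+1}$ are $\pi_+^m(a_1,\dots,a_{m+1})=(a_1,\dots,a_m)$, $\pi_-^m(a_1,\dots,a_{m+1})=(a_2,\dots,a_{m+1})$, $j_+^m(a_1,\dots,a_m)=(a_1,\dots,a_m,0)$, $j_-^m(a_1,\dots,a_m)=(0,a_1,\dots,a_m)$; for $m=0$ they are the zero maps ($k^0=0$). *)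

theory Defs
  imports
    "HOL-Library.Function_Algebras"
    "HOL-Computational_Algebra.Polynomial"
begin

section \<open>The quiver and its finite-dimensional representations\<close>

datatype vertex = Vb | Vminus | Vplus | Ve

datatype arrow = b_plus | plus_e | b_minus | minus_e

fun src :: "arrow \<Rightarrow> vertex" where
  "src b_plus = Vb"
| "src plus_e = Vplus"
| "src b_minus = Vb"
| "src minus_e = Vminus"

fun tgt :: "arrow \<Rightarrow> vertex" where
  "tgt b_plus = Vplus"
| "tgt plus_e = Ve"
| "tgt b_minus = Vminus"
| "tgt minus_e = Ve"

text \<open>The spaces of a representation are finite-dimensional subspaces of one ambient vector space
  of arbitrary dimension (type \<open>'v\<close> with scalar multiplication \<open>rep_scale\<close>). This is no
  restriction, since four vector spaces always embed in their direct sum. The maps are total HOL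
  functions of which only the values on the relevant subspaces matter.\<close>

record ('k, 'v) rep =
  rep_scale :: "'k \<Rightarrow> 'v \<Rightarrow> 'v"
  rep_space :: "vertex \<Rightarrow> 'v set"
  rep_map :: "arrow \<Rightarrow> 'v \<Rightarrow> 'v"

definition linear_between ::
  "('k \<Rightarrow> 'v \<Rightarrow> 'v) \<Rightarrow> 'v set \<Rightarrow> ('k \<Rightarrow> 'w \<Rightarrow> 'w) \<Rightarrow> 'w set \<Rightarrow>
   ('v::ab_group_add \<Rightarrow> 'w::ab_group_add) \<Rightarrow> bool" where
  "linear_between s V t W f \<longleftrightarrow>
     (\<forall>x\<in>V. f x \<in> W) \<and>
     (\<forall>x\<in>V. \<forall>y\<in>V. f (x + y) = f x + f y) \<and>
     (\<forall>c. \<forall>x\<in>V. f (s c x) = t c (f x))"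

definition fd_rep :: "('k::field, 'v::ab_group_add) rep \<Rightarrow> bool" where
  "fd_rep X \<longleftrightarrow>
     vector_space (rep_scale X) \<and>
     (\<forall>v. module.subspace (rep_scale X) (rep_space X v) \<and>
          (\<exists>S. finite S \<and> module.span (rep_scale X) S = rep_space X v)) \<and>
     (\<forall>a. linear_between (rep_scale X) (rep_space X (src a))
                         (rep_scale X) (rep_space X (tgt a)) (rep_map X a))"

text \<open>As for the maps of a representation, two elements of \<open>hom X Y\<close> represent the same morphism
  iff they agree on the spaces of \<open>X\<close>.\<close>

definition hom ::
  "('k::field, 'v::ab_group_add) rep \<Rightarrow> ('k, 'w::ab_group_add) rep \<Rightarrow> (vertex \<Rightarrow> 'v \<Rightarrow> 'w) set" where
  "hom X Y = {f.
     (\<forall>v. linear_between (rep_scale X) (rep_space X v) (rep_scale Y) (rep_space Y v) (f v)) \<and>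
     (\<forall>a. \<forall>x\<in>rep_space X (src a). f (tgt a) (rep_map X a x) = rep_map Y a (f (src a) x))}"

definition rep_iso :: "('k::field, 'v::ab_group_add) rep \<Rightarrow> ('k, 'w::ab_group_add) rep \<Rightarrow> bool" where
  "rep_iso X Y \<longleftrightarrow> (\<exists>f\<in>hom X Y. \<forall>v. bij_betw (f v) (rep_space X v) (rep_space Y v))"

definition surj_hom ::
  "('k::field, 'v::ab_group_add) rep \<Rightarrow> ('k, 'w::ab_group_add) rep \<Rightarrow> (vertex \<Rightarrow> 'v \<Rightarrow> 'w) \<Rightarrow> bool" where
  "surj_hom X Y f \<longleftrightarrow> f \<in> hom X Y \<and> (\<forall>v. f v ` rep_space X v = rep_space Y v)"

section \<open>Ext groups and exceptional objects\<close>

text \<open>Every finite-dimensional representation is isomorphic to one whose spaces lie in the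
  infinite-dimensional space \<open>nat \<Rightarrow> 'k\<close>, so representations on this carrier type form a category
  equivalent to that of all finite-dimensional representations. Projectivity is tested, and
  resolutions are formed, there.\<close>

type_synonym 'k seq_rep = "('k, nat \<Rightarrow> 'k) rep"

definition projective :: "'k::field seq_rep \<Rightarrow> bool" where
  "projective P \<longleftrightarrow> fd_rep P \<and>
     (\<forall>(A::'k seq_rep) (B::'k seq_rep) g f.
        fd_rep A \<and> fd_rep B \<and> surj_hom A B g \<and> f \<in> hom P B \<longrightarrow>
        (\<exists>h\<in>hom P A. \<forall>v. \<forall>x\<in>rep_space P v. g v (h v x) = f v x))"

text \<open>\<open>\<dots> \<rightarrow> P 2 \<rightarrow> P 1 \<rightarrow> P 0 \<rightarrow> X \<rightarrow> 0\<close> with \<open>d n : P (Suc n) \<rightarrow> P n\<close> and augmentation \<open>p\<close>.\<close>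

definition projective_resolution ::
  "('k::field, 'v::ab_group_add) rep \<Rightarrow> (nat \<Rightarrow> 'k seq_rep) \<Rightarrow>
   (nat \<Rightarrow> vertex \<Rightarrow> (nat \<Rightarrow> 'k) \<Rightarrow> (nat \<Rightarrow> 'k)) \<Rightarrow> (vertex \<Rightarrow> (nat \<Rightarrow> 'k) \<Rightarrow> 'v) \<Rightarrow> bool" where
  "projective_resolution X P d p \<longleftrightarrow>
     (\<forall>n. projective (P n)) \<and>
     (\<forall>n. d n \<in> hom (P (Suc n)) (P n)) \<and>
     surj_hom (P 0) X p \<and>
     (\<forall>v. d 0 v ` rep_space (P 1) v = {x \<in> rep_space (P 0) v. p v x = 0}) \<and>
     (\<forall>n v. d (Suc n) v ` rep_space (P (Suc (Suc n))) v =
            {x \<in> rep_space (P (Suc n)) v. d n v x = 0})"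

definition cocycle ::
  "(nat \<Rightarrow> 'k::field seq_rep) \<Rightarrow> (nat \<Rightarrow> vertex \<Rightarrow> (nat \<Rightarrow> 'k) \<Rightarrow> (nat \<Rightarrow> 'k)) \<Rightarrow>
   ('k, 'w::ab_group_add) rep \<Rightarrow> nat \<Rightarrow> (vertex \<Rightarrow> (nat \<Rightarrow> 'k) \<Rightarrow> 'w) \<Rightarrow> bool" where
  "cocycle P d Y i f \<longleftrightarrow>
     f \<in> hom (P i) Y \<and> (\<forall>v. \<forall>x\<in>rep_space (P (Suc i)) v. f v (d i v x) = 0)"

fun coboundary ::
  "(nat \<Rightarrow> 'k::field seq_rep) \<Rightarrow> (nat \<Rightarrow> vertex \<Rightarrow> (nat \<Rightarrow> 'k) \<Rightarrow> (nat \<Rightarrow> 'k)) \<Rightarrow>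
   ('k, 'w::ab_group_add) rep \<Rightarrow> nat \<Rightarrow> (vertex \<Rightarrow> (nat \<Rightarrow> 'k) \<Rightarrow> 'w) \<Rightarrow> bool" where
  "coboundary P d Y 0 f \<longleftrightarrow> (\<forall>v. \<forall>x\<in>rep_space (P 0) v. f v x = 0)"
| "coboundary P d Y (Suc i) f \<longleftrightarrow>
     (\<exists>g\<in>hom (P i) Y. \<forall>v. \<forall>x\<in>rep_space (P (Suc i)) v. f v x = g v (d i v x))"

text \<open>\<open>Ext\<^sup>i(X, Y)\<close> is the \<open>i\<close>-th cohomology of \<open>Hom(P, Y)\<close> for a projective resolution \<open>P\<close>
  of \<open>X\<close>; by the comparison theorem the choice of the resolution is immaterial.\<close>

definition Ext_zero :: "nat \<Rightarrow> ('k::field, 'v::ab_group_add) rep \<Rightarrow> ('k, 'w::ab_group_add) rep \<Rightarrow> bool" where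
  "Ext_zero i X Y \<longleftrightarrow>
     (\<exists>P d p. projective_resolution X P d p \<and> (\<forall>f. cocycle P d Y i f \<longrightarrow> coboundary P d Y i f))"

text \<open>\<open>Hom(X, X) = k\<close> says that sending a scalar to the corresponding multiple of the identity is a
  bijection from \<open>k\<close> to \<open>Hom(X, X)\<close>; uniqueness of the scalar excludes \<open>X = 0\<close>.\<close>

definition exceptional :: "('k::field, 'v::ab_group_add) rep \<Rightarrow> bool" where
  "exceptional X \<longleftrightarrow> fd_rep X \<and>
     (\<forall>f\<in>hom X X. \<exists>!c. \<forall>v. \<forall>x\<in>rep_space X v. f v x = rep_scale X c x) \<and>
     (\<forall>i. i \<noteq> 0 \<longrightarrow> Ext_zero i X X)"

section \<open>The representations in the classification\<close>

text \<open>\<open>k\<^sup>m\<close> is realised as the sequences supported on the first \<open>m\<close> indices, so that the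
  coordinate \<open>a\<^sub>i\<close> is the value at \<open>i - 1\<close>.\<close>

definition kpow :: "nat \<Rightarrow> (nat \<Rightarrow> 'k::zero) set" where
  "kpow m = {a. \<forall>i\<ge>m. a i = 0}"

definition pi_plus :: "nat \<Rightarrow> (nat \<Rightarrow> 'k::zero) \<Rightarrow> nat \<Rightarrow> 'k" where
  "pi_plus m a = (\<lambda>i. if i < m then a i else 0)"

definition pi_minus :: "nat \<Rightarrow> (nat \<Rightarrow> 'k::zero) \<Rightarrow> nat \<Rightarrow> 'k" where
  "pi_minus m a = (\<lambda>i. if i < m then a (Suc i) else 0)"

definition j_plus :: "nat \<Rightarrow> (nat \<Rightarrow> 'k::zero) \<Rightarrow> nat \<Rightarrow> 'k" where
  "j_plus m a = (\<lambda>i. if i < m then a i else 0)"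

definition j_minus :: "nat \<Rightarrow> (nat \<Rightarrow> 'k::zero) \<Rightarrow> nat \<Rightarrow> 'k" where
  "j_minus m a = (\<lambda>i. if 1 \<le> i \<and> i \<le> m then a (i - 1) else 0)"

text \<open>Arguments: the dimensions of \<open>(V\<^sub>b, V\<^sub>-, V\<^sub>+, V\<^sub>e)\<close> and the maps
  \<open>(V\<^sub>b \<rightarrow> V\<^sub>+, V\<^sub>+ \<rightarrow> V\<^sub>e, V\<^sub>b \<rightarrow> V\<^sub>-, V\<^sub>- \<rightarrow> V\<^sub>e)\<close>.\<close>

fun mk_rep ::
  "nat \<times> nat \<times> nat \<times> nat \<Rightarrow>
   ((nat \<Rightarrow> 'k) \<Rightarrow> (nat \<Rightarrow> 'k)) \<times> ((nat \<Rightarrow> 'k) \<Rightarrow> (nat \<Rightarrow> 'k)) \<times>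
   ((nat \<Rightarrow> 'k) \<Rightarrow> (nat \<Rightarrow> 'k)) \<times> ((nat \<Rightarrow> 'k) \<Rightarrow> (nat \<Rightarrow> 'k)) \<Rightarrow> 'k::field seq_rep" where
  "mk_rep (nb, nm, np, ne) (f_bp, f_pe, f_bm, f_me) =
     \<lparr>rep_scale = (\<lambda>c a i. c * a i),
      rep_space = (\<lambda>v. kpow (case v of Vb \<Rightarrow> nb | Vminus \<Rightarrow> nm | Vplus \<Rightarrow> np | Ve \<Rightarrow> ne)),
      rep_map = (\<lambda>r. case r of b_plus \<Rightarrow> f_bp | plus_e \<Rightarrow> f_pe | b_minus \<Rightarrow> f_bm | minus_e \<Rightarrow> f_me)\<rparr>"

datatype label =
  E1 nat | E2 nat | E3 nat | E4 nat | E5 nat | E6 nat | E7 nat | E8 nat |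
  F_plus | F_minus | G_plus | G_minus

fun listed :: "label \<Rightarrow> 'k::field seq_rep" where
  "listed (E1 m) = mk_rep (m+1, m, m, m) (pi_plus m, id, pi_minus m, id)"
| "listed (E2 m) = mk_rep (m, m+1, m+1, m+1) (j_plus m, id, j_minus m, id)"
| "listed (E3 m) = mk_rep (m, m, m, m+1) (id, j_plus m, id, j_minus m)"
| "listed (E4 m) = mk_rep (m+1, m+1, m+1, m) (id, pi_plus m, id, pi_minus m)"
| "listed (E5 m) = mk_rep (m, m+1, m, m+1) (id, j_plus m, j_minus m, id)"
| "listed (E6 m) = mk_rep (m+1, m, m+1, m) (id, pi_plus m, pi_minus m, id)"
| "listed (E7 m) = mk_rep (m+1, m+1, m, m) (pi_plus m, id, id, pi_minus m)"
| "listed (E8 m) = mk_rep (m, m, m+1, m+1) (j_plus m, id, id, j_minus m)"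
| "listed F_plus = mk_rep (0, 0, 1, 0) (0, 0, 0, 0)"
| "listed F_minus = mk_rep (0, 1, 0, 0) (0, 0, 0, 0)"
| "listed G_plus = mk_rep (1, 0, 1, 1) (id, id, 0, 0)"
| "listed G_minus = mk_rep (1, 1, 0, 1) (0, 0, id, id)"

end

(*
  For an exceptional X, rigidity means that (F_v) |-> (F_t X_a - X_a F_s) is surjective and
  End(X) = k that its kernel is a line. Comparing dimensions gives the Euler form equation, which on
  this quiver says that the squared differences of the dimensions along the four arrows sum to 2.
  Rigidity also forces every X_a to have maximal rank, so arrows between equal dimensions are
  isomorphisms. Either both nonzero differences lie on one branch; then composing around the cycle
  yields an endomorphism that is both a scalar and singular, hence 0, which leaves F and G. Or each
  branch contains one isomorphism, and X amounts to a pair of matrices k^(n+1) -> k^n (or its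
  transpose) with scalar endomorphisms. A kernel chain embeds a standard pair into it, the Euler form
  gives a nonzero morphism back, and the composite is an invertible scalar.
  Conversely the listed representations have End = k, and the Euler form then gives rigidity. The
  translation between rigidity and Ext uses a two-term resolution: subrepresentations of standard
  projectives are again projective.
*)
theory Submission
  imports "Jordan_Normal_Form.Determinant" Defs
begin

text \<open>\<open>Ext_zero\<close> asks for one resolution on which cocycles are coboundaries, and
  this makes the two translations asymmetric. Starting from rigidity the resolution may be chosen,
  so an explicit one is built whose first differential is an inclusion. Towards rigidity an unknown
  resolution is handed over, of which only exactness and the lifting property of its degree-0 term
  can be exploited. Maps and morphisms are total functions whose values count only on subspaces, so
  equality of functions is the wrong notion for them. Everything is therefore moved to
  representations by matrices on \<open>kpow\<close>, where a morphism is a tuple of matrices and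
  equality is literal. The 2 in the sum of squares: every vertex of the quiver meets exactly two
  arrows, so twice the Euler form d_b^2 + ... - (sum over arrows of d_s d_t) collects each arrow's
  (d_s - d_t)^2 once, and an endomorphism ring k together with vanishing \<open>Ext\<close> makes
  the form equal to 1.\<close>

section \<open>Linear maps defined on subspaces: extension, sections, factorisation, lifting\<close>

lemma linear_betweenI:
  assumes "\<And>x. x \<in> V \<Longrightarrow> f x \<in> W"
    and "\<And>x y. x \<in> V \<Longrightarrow> y \<in> V \<Longrightarrow> f (x + y) = f x + f y"
    and "\<And>c x. x \<in> V \<Longrightarrow> f (s c x) = t c (f x)"
  shows "linear_between s V t W f"
  using assms by (auto simp: linear_between_def)

lemma linear_betweenD:
  assumes "linear_between s V t W f"
  shows "\<And>x. x \<in> V \<Longrightarrow> f x \<in> W"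
    and "\<And>x y. x \<in> V \<Longrightarrow> y \<in> V \<Longrightarrow> f (x + y) = f x + f y"
    and "\<And>c x. x \<in> V \<Longrightarrow> f (s c x) = t c (f x)"
  using assms by (auto simp: linear_between_def)

locale subspace_pair = vector_space_pair s t
  for s :: "'k::field \<Rightarrow> 'v::ab_group_add \<Rightarrow> 'v" and t :: "'k \<Rightarrow> 'w::ab_group_add \<Rightarrow> 'w" +
  fixes V W
  assumes sub1: "vs1.subspace V" and sub2: "vs2.subspace W"
begin

lemma between_zero:
  assumes "linear_between s V t W f" shows "f 0 = 0"
proof -
  have "f (0 + 0) = f 0 + f 0"
    using linear_betweenD(2)[OF assms] vs1.subspace_0[OF sub1] by blast
  then show ?thesis by simp
qed

lemma between_diff:
  assumes "linear_between s V t W f" "x \<in> V" "y \<in> V"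
  shows "f (x - y) = f x - f y"
  using linear_betweenD(2)[OF assms(1), of "x - y" y] vs1.subspace_diff[OF sub1] assms(2,3)
  by (simp add: algebra_simps)

lemma between_sum:
  assumes f: "linear_between s V t W f" and x: "\<And>i. i \<in> I \<Longrightarrow> x i \<in> V"
  shows "f (\<Sum>i\<in>I. x i) = (\<Sum>i\<in>I. f (x i))"
  using x
proof (induction I rule: infinite_finite_induct)
  case (insert i I)
  have "(\<Sum>i\<in>I. x i) \<in> V" using insert by (intro vs1.subspace_sum[OF sub1]) auto
  then show ?case using insert linear_betweenD(2)[OF f] by simp
qed (auto simp: between_zero[OF f])

text \<open>This is the bridge from maps on a subspace to globally linear ones. The extension is
  chosen with range in the span of the images of a basis, so that it still takes values in
  \<open>W\<close>; lifts built from it then stay inside the spaces of a representation.\<close>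

lemma between_extend:
  assumes f: "linear_between s V t W f"
  obtains g where "Vector_Spaces.linear s t g" "\<And>x. x \<in> V \<Longrightarrow> g x = f x" "\<And>x. g x \<in> W"
proof -
  obtain B where B: "B \<subseteq> V" "vs1.independent B" "vs1.span B = V"
    using vs1.maximal_independent_subset[of V] vs1.span_minimal[OF _ sub1] by (metis antisym_conv)
  obtain g where g: "Vector_Spaces.linear s t g" "\<forall>x\<in>B. g x = f x" "range g = vs2.span (f ` B)"
    using linear_independent_extend_subspace[OF B(2), of f] by blast
  interpret g: Vector_Spaces.linear s t g by fact
  have "g x = f x \<and> x \<in> V" if "x \<in> vs1.span B" for x
    using that
  proof (induction rule: vs1.span_induct_alt)
    case base
    show ?case using between_zero[OF f] g.zero vs1.subspace_0[OF sub1] by simp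
  next
    case (step c x y)
    then have "x \<in> V" "y \<in> V" using B by auto
    moreover have "s c x \<in> V" using vs1.subspace_scale[OF sub1] \<open>x \<in> V\<close> .
    ultimately show ?case
      using step g(2) linear_betweenD[OF f] vs1.subspace_add[OF sub1]
      by (simp add: g.add g.scale)
  qed
  moreover have "g x \<in> W" for x
  proof -
    have "vs2.span (f ` B) \<subseteq> W"
      using vs2.span_minimal[OF _ sub2] linear_betweenD(1)[OF f] B(1) by blast
    then show ?thesis using g(3) by blast
  qed
  ultimately show thesis using that g(1) B(3) by blast
qed

text \<open>A section is available for globally linear maps, so \<open>f\<close> is extended first;
  on \<open>V\<close> the extension agrees with \<open>f\<close>, and the section takes values in
  \<open>V\<close>.\<close>

lemma between_right_inverse:
  assumes f: "linear_between s V t W f" and surj: "f ` V = W"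
  obtains r where "linear_between t W s V r" "\<And>w. w \<in> W \<Longrightarrow> f (r w) = w"
proof -
  obtain g where g: "Vector_Spaces.linear s t g" "\<And>x. x \<in> V \<Longrightarrow> g x = f x" "\<And>x. g x \<in> W"
    using between_extend[OF f] by metis
  obtain r where r: "r ` UNIV \<subseteq> V" "Vector_Spaces.linear t s r" "\<forall>v\<in>g ` V. g (r v) = v"
    using linear_exists_right_inverse_on[OF g(1) sub1] by blast
  interpret r: Vector_Spaces.linear t s r by fact
  have "g ` V = W" using g(2) surj by auto
  show thesis
  proof (rule that)
    show "linear_between t W s V r"
      using r(1) by (intro linear_betweenI) (auto simp: r.add r.scale)
    show "f (r w) = w" if "w \<in> W" for w
      using that r(1,3) g(2) \<open>g ` V = W\<close> by (metis rangeI subsetD)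
  qed
qed

end

text \<open>Compose \<open>u\<close> with a section \<open>r\<close> of \<open>p\<close>: the
  element \<open>r (p x) - x\<close> lies in the kernel of \<open>p\<close>, where \<open>u\<close>
  vanishes. This turns maps that kill the kernel of an augmentation into maps on the represented
  spaces.\<close>

lemma between_factor:
  fixes s :: "'k::field \<Rightarrow> 'v::ab_group_add \<Rightarrow> 'v" and t :: "'k \<Rightarrow> 'w::ab_group_add \<Rightarrow> 'w"
    and t' :: "'k \<Rightarrow> 'z::ab_group_add \<Rightarrow> 'z"
  assumes PY: "subspace_pair s t P Y" and PZ: "subspace_pair s t' P Z"
    and p: "linear_between s P t Y p" "p ` P = Y" and u: "linear_between s P t' Z u"
    and ker: "\<And>x. x \<in> P \<Longrightarrow> p x = 0 \<Longrightarrow> u x = 0"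
  obtains g where "linear_between t Y t' Z g" "\<And>x. x \<in> P \<Longrightarrow> g (p x) = u x"
proof -
  interpret PY: subspace_pair s t P Y by fact
  interpret PZ: subspace_pair s t' P Z by fact
  obtain r where r: "linear_between t Y s P r" "\<And>w. w \<in> Y \<Longrightarrow> p (r w) = w"
    using PY.between_right_inverse[OF p] by metis
  show thesis
  proof (rule that)
    show "linear_between t Y t' Z (\<lambda>y. u (r y))"
      using linear_betweenD[OF r(1)] linear_betweenD[OF u] by (intro linear_betweenI) auto
  next
    fix x assume x: "x \<in> P"
    then have px: "p x \<in> Y" and rp: "r (p x) \<in> P"
      using p linear_betweenD(1)[OF r(1)] by auto
    have "u (r (p x) - x) = 0"
      using ker[of "r (p x) - x"] PY.vs1.subspace_diff[OF PY.sub1 rp x]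
        PY.between_diff[OF p(1) rp x] r(2)[OF px] by simp
    then show "u (r (p x)) = u x"
      using PZ.between_diff[OF u rp x] by simp
  qed
qed

text \<open>Any linear extension \<open>H\<close> of \<open>h\<close> can be corrected by a section of \<open>g\<close> applied to the
  error \<open>f - g H\<close>, which vanishes on \<open>U\<close>.\<close>

lemma between_lift:
  fixes s :: "'k::field \<Rightarrow> 'v::ab_group_add \<Rightarrow> 'v" and t :: "'k \<Rightarrow> 'w::ab_group_add \<Rightarrow> 'w"
    and t' :: "'k \<Rightarrow> 'z::ab_group_add \<Rightarrow> 'z"
  assumes PA: "subspace_pair s t P A" and PB: "subspace_pair s t' P B"
    and U: "module.subspace s U" "U \<subseteq> P" and h: "linear_between s U t A h"
    and f: "linear_between s P t' B f" and g: "linear_between t A t' B g" "g ` A = B"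
    and comm: "\<And>x. x \<in> U \<Longrightarrow> g (h x) = f x"
  obtains h' where "linear_between s P t A h'" "\<And>x. x \<in> U \<Longrightarrow> h' x = h x"
    "\<And>x. x \<in> P \<Longrightarrow> g (h' x) = f x"
proof -
  interpret PA: subspace_pair s t P A by fact
  interpret PB: subspace_pair s t' P B by fact
  interpret AB: subspace_pair t t' A B
    by unfold_locales (fact PA.sub2, fact PB.sub2)
  interpret UA: subspace_pair s t U A
    by unfold_locales (fact U(1), fact PA.sub2)
  obtain H where H: "Vector_Spaces.linear s t H" "\<And>x. x \<in> U \<Longrightarrow> H x = h x" "\<And>x. H x \<in> A"
    using UA.between_extend[OF h] by metis
  interpret H: Vector_Spaces.linear s t H by fact
  obtain r where r: "linear_between t' B t A r" "\<And>w. w \<in> B \<Longrightarrow> g (r w) = w"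
    using AB.between_right_inverse[OF g] by metis
  interpret BA: subspace_pair t' t B A
    by unfold_locales (fact PB.sub2, fact PA.sub2)
  define e where "e x = f x - g (H x)" for x
  have e: "linear_between s P t' B e"
    using linear_betweenD[OF f] linear_betweenD[OF g(1)] H(3) PB.vs2.subspace_diff[OF PB.sub2]
    by (intro linear_betweenI) (auto simp: e_def H.add H.scale PB.vs2.scale_right_diff_distrib)
  show thesis
  proof (rule that[of "\<lambda>x. H x + r (e x)"])
    show "linear_between s P t A (\<lambda>x. H x + r (e x))"
      using linear_betweenD[OF e] linear_betweenD[OF r(1)] H(3) PA.vs2.subspace_add[OF PA.sub2]
      by (intro linear_betweenI)
        (auto simp: H.add H.scale PA.vs2.scale_right_distrib algebra_simps)
    show "H x + r (e x) = h x" if "x \<in> U" for x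
      using that H(2) comm BA.between_zero[OF r(1)] by (simp add: e_def)
    show "g (H x + r (e x)) = f x" if "x \<in> P" for x
    proof -
      have ex: "e x \<in> B" using linear_betweenD(1)[OF e that] .
      then have "r (e x) \<in> A" using linear_betweenD(1)[OF r(1)] by blast
      then show ?thesis
        using linear_betweenD(2)[OF g(1) H(3)] r(2)[OF ex] by (simp add: e_def)
    qed
  qed
qed

section \<open>Coordinate spaces\<close>

text \<open>The index type is kept general: sequences are indexed by \<open>nat\<close>, while
  tuples of matrices are later flattened to functions on triples when dimensions are
  counted.\<close>

definition fscale :: "'k::field \<Rightarrow> ('i \<Rightarrow> 'k) \<Rightarrow> 'i \<Rightarrow> 'k" where
  "fscale c a = (\<lambda>i. c * a i)"

lemma fscale_apply [simp]: "fscale c a i = c * a i"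
  by (simp add: fscale_def)

global_interpretation fs: vector_space fscale
  by unfold_locales (auto simp: fun_eq_iff algebra_simps)

definition supported :: "'i set \<Rightarrow> ('i \<Rightarrow> 'k::zero) set" where
  "supported I = {a. \<forall>i. i \<notin> I \<longrightarrow> a i = 0}"

definition unit_at :: "'i \<Rightarrow> 'i \<Rightarrow> 'k::zero_neq_one" where
  "unit_at i = (\<lambda>j. if j = i then 1 else 0)"

lemma kpow_eq_supported: "kpow n = supported {..<n}"
  by (auto simp: kpow_def supported_def not_less)

lemma subspace_supported: "fs.subspace (supported I)"
  by (auto simp: fs.subspace_def supported_def)

lemma subspace_kpow: "fs.subspace (kpow n)"
  by (simp add: kpow_eq_supported subspace_supported)

lemma sum_fun_apply: "(\<Sum>i\<in>I. f i) x = (\<Sum>i\<in>I. f i x)"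
  by (induction I rule: infinite_finite_induct) auto

lemma sum_unit_at:
  assumes "finite I"
  shows "(\<Sum>i\<in>I. fscale (a i) (unit_at i)) = (\<lambda>j. if j \<in> I then a j else 0)"
  using assms by (auto simp: fun_eq_iff sum_fun_apply unit_at_def if_distrib cong: if_cong)

lemma independent_unit_at: "fs.independent (unit_at ` I :: ('i \<Rightarrow> 'k::field) set)"
  and inj_unit_at: "inj (unit_at :: 'i \<Rightarrow> 'i \<Rightarrow> 'k::field)"
  and span_unit_at: "finite I \<Longrightarrow> fs.span (unit_at ` I :: ('i \<Rightarrow> 'k::field) set) = supported I"
proof -
  show inj: "inj (unit_at :: 'i \<Rightarrow> 'i \<Rightarrow> 'k::field)"
    by (auto simp: inj_def unit_at_def fun_eq_iff split: if_splits)
  show "fs.independent (unit_at ` I :: ('i \<Rightarrow> 'k::field) set)"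
    unfolding fs.independent_explicit_module
  proof (intro allI impI)
    fix T :: "('i \<Rightarrow> 'k) set" and u v
    assume T: "finite T" "T \<subseteq> unit_at ` I" and 0: "(\<Sum>v\<in>T. fscale (u v) v) = 0" and v: "v \<in> T"
    obtain J where J: "T = unit_at ` J" "J \<subseteq> I" using T(2) by (meson subset_imageE)
    have fin: "finite J" using T(1) J(1) inj finite_imageD inj_on_subset by blast
    have "(\<Sum>j\<in>J. fscale (u (unit_at j)) (unit_at j)) = 0"
      using 0 J(1) inj by (simp add: sum.reindex inj_on_subset)
    then have z: "(\<lambda>j. if j \<in> J then u (unit_at j) else 0) = 0"
      by (simp add: sum_unit_at[OF fin])
    obtain j where "j \<in> J" "v = unit_at j" using v J by blast
    then show "u v = 0" using fun_cong[OF z, of j] by simp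
  qed
  assume fin: "finite I"
  show "fs.span (unit_at ` I :: ('i \<Rightarrow> 'k::field) set) = supported I"
  proof
    show "fs.span (unit_at ` I) \<subseteq> (supported I :: ('i \<Rightarrow> 'k) set)"
      by (rule fs.span_minimal[OF _ subspace_supported]) (auto simp: supported_def unit_at_def)
    show "supported I \<subseteq> fs.span (unit_at ` I :: ('i \<Rightarrow> 'k) set)"
    proof
      fix a :: "'i \<Rightarrow> 'k" assume "a \<in> supported I"
      then have "a = (\<Sum>i\<in>I. fscale (a i) (unit_at i))"
        by (auto simp: sum_unit_at[OF fin] supported_def fun_eq_iff)
      also have "\<dots> \<in> fs.span (unit_at ` I)"
        by (intro fs.span_sum fs.span_scale fs.span_base) auto
      finally show "a \<in> fs.span (unit_at ` I)" .
    qed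
  qed
qed

lemma dim_supported:
  assumes "finite I" shows "fs.dim (supported I :: ('i \<Rightarrow> 'k::field) set) = card I"
  by (metis (no_types) assms card_image fs.dim_span_eq_card_independent independent_unit_at
      inj_on_subset inj_unit_at span_unit_at subset_UNIV)

text \<open>\<open>fd_rep\<close> demands a finite spanning set, and kernels such as the syzygy come
  only as subspaces. An independent set inside the span of finitely many unit vectors is
  finite.\<close>

lemma fd_subspace:
  fixes U :: "('i \<Rightarrow> 'k::field) set"
  assumes U: "fs.subspace U" "U \<subseteq> supported I" and fin: "finite I"
  obtains B where "finite B" "fs.independent B" "B \<subseteq> U" "fs.span B = U" "card B = fs.dim U"
proof -
  obtain B where B: "B \<subseteq> U" "fs.independent B" "U \<subseteq> fs.span B" "card B = fs.dim U"
    using fs.basis_exists by blast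
  have "finite B"
    using fs.independent_span_bound[of "unit_at ` I" B] B U(2) fin
    by (metis finite_imageI order_trans span_unit_at)
  moreover have "fs.span B = U" using B(1,3) fs.span_minimal[OF _ U(1)] by blast
  ultimately show thesis using that B by blast
qed

section \<open>Matrices as linear maps\<close>

text \<open>Entries beyond the rows are cut to 0 and entries of the argument beyond the columns are
  ignored. Hence the value lies in \<open>kpow\<close> for every argument, and sums and products of
  matrices behave well on all sequences; the identity matrix acts as the identity only on
  \<open>kpow\<close>.\<close>

definition mat_fun :: "'k::field mat \<Rightarrow> (nat \<Rightarrow> 'k) \<Rightarrow> nat \<Rightarrow> 'k" where
  "mat_fun A a = (\<lambda>i. if i < dim_row A then (\<Sum>j<dim_col A. A $$ (i, j) * a j) else 0)"

lemma mat_fun_in_kpow: "A \<in> carrier_mat m n \<Longrightarrow> mat_fun A a \<in> kpow m"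
  by (auto simp: mat_fun_def kpow_def)

lemma mat_fun_plus: "mat_fun A (a + b) = mat_fun A a + mat_fun A b"
  by (auto simp: mat_fun_def fun_eq_iff algebra_simps sum.distrib)

lemma mat_fun_minus: "mat_fun A (x - y) = mat_fun A x - mat_fun A y"
  using mat_fun_plus[of A "x - y" y] by (simp add: algebra_simps)

lemma mat_fun_scale: "mat_fun A (fscale c a) = fscale c (mat_fun A a)"
  by (auto simp: mat_fun_def fun_eq_iff sum_distrib_left algebra_simps)

lemma mat_fun_0 [simp]: "mat_fun A 0 = 0"
  by (auto simp: mat_fun_def fun_eq_iff)

lemma mat_fun_between:
  "A \<in> carrier_mat m n \<Longrightarrow> linear_between fscale V fscale (kpow m) (mat_fun A)"
  by (intro linear_betweenI) (auto simp: mat_fun_in_kpow mat_fun_plus mat_fun_scale)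

lemma mat_fun_mult:
  assumes "A \<in> carrier_mat m n" "B \<in> carrier_mat n l"
  shows "mat_fun (A * B) a = mat_fun A (mat_fun B a)"
proof
  fix i
  have "(\<Sum>k<l. (\<Sum>j<n. A $$ (i, j) * B $$ (j, k)) * a k)
      = (\<Sum>j<n. A $$ (i, j) * (\<Sum>k<l. B $$ (j, k) * a k))"
    by (simp add: sum_distrib_left sum_distrib_right mult.assoc sum.swap[of _ "{..<l}"])
  then show "mat_fun (A * B) a i = mat_fun A (mat_fun B a) i"
    using assms by (auto simp: mat_fun_def scalar_prod_def atLeast0LessThan)
qed

lemma mat_fun_one: "a \<in> kpow n \<Longrightarrow> mat_fun (1\<^sub>m n) a = a"
  by (auto simp: mat_fun_def kpow_def fun_eq_iff if_distribR if_distrib[of "\<lambda>x. x * _"] cong: if_cong)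

lemma mat_fun_add:
  "A \<in> carrier_mat m n \<Longrightarrow> B \<in> carrier_mat m n \<Longrightarrow> mat_fun (A + B) a = mat_fun A a + mat_fun B a"
  by (auto simp: mat_fun_def fun_eq_iff algebra_simps sum.distrib)

lemma mat_fun_smult: "mat_fun (c \<cdot>\<^sub>m A) a = fscale c (mat_fun A a)"
  by (auto simp: mat_fun_def fun_eq_iff sum_distrib_left algebra_simps)

lemma unit_at_in_kpow: "j < n \<Longrightarrow> unit_at j \<in> kpow n"
  by (auto simp: kpow_def unit_at_def)

lemma mat_fun_unit_at:
  "A \<in> carrier_mat m n \<Longrightarrow> i < m \<Longrightarrow> j < n \<Longrightarrow> mat_fun A (unit_at j) i = A $$ (i, j)"
  by (auto simp: mat_fun_def unit_at_def if_distrib cong: if_cong)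

lemma mat_fun_eqI:
  assumes "A \<in> carrier_mat m n" "B \<in> carrier_mat m n"
    and "\<And>x. x \<in> kpow n \<Longrightarrow> mat_fun A x = mat_fun B x"
  shows "A = B"
proof (rule eq_matI)
  fix i j assume "i < dim_row B" "j < dim_col B"
  then show "A $$ (i, j) = B $$ (i, j)"
    using assms mat_fun_unit_at[of A m n i j] mat_fun_unit_at[of B m n i j] unit_at_in_kpow[of j n]
    by (metis carrier_matD)
qed (use assms in auto)

lemma kpow_eq_sum:
  assumes "a \<in> kpow n"
  shows "a = (\<Sum>i<n. fscale (a i) (unit_at i))"
  using assms by (auto simp: sum_unit_at kpow_def fun_eq_iff)

lemma between_kpow_mat:
  fixes f :: "(nat \<Rightarrow> 'k::field) \<Rightarrow> nat \<Rightarrow> 'k"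
  assumes f: "linear_between fscale (kpow n) fscale (kpow m) f"
  obtains A where "A \<in> carrier_mat m n" "\<And>x. x \<in> kpow n \<Longrightarrow> f x = mat_fun A x"
proof -
  interpret subspace_pair fscale fscale "kpow n :: (nat \<Rightarrow> 'k) set" "kpow m :: (nat \<Rightarrow> 'k) set"
    by unfold_locales (auto simp: subspace_kpow)
  define A where "A = mat m n (\<lambda>(i, j). f (unit_at j) i)"
  show thesis
  proof (rule that)
    show A: "A \<in> carrier_mat m n" by (simp add: A_def)
    fix x :: "nat \<Rightarrow> 'k" assume x: "x \<in> kpow n"
    have "f x = f (\<Sum>j<n. fscale (x j) (unit_at j))" using kpow_eq_sum[OF x] by simp
    also have "\<dots> = (\<Sum>j<n. f (fscale (x j) (unit_at j)))"
      by (rule between_sum[OF f]) (auto intro!: fs.subspace_scale[OF sub1] unit_at_in_kpow)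
    also have "\<dots> = (\<Sum>j<n. fscale (x j) (f (unit_at j)))"
      by (intro sum.cong refl) (auto simp: linear_betweenD(3)[OF f] unit_at_in_kpow)
    finally have fx: "f x = (\<Sum>j<n. fscale (x j) (f (unit_at j)))" .
    show "f x = mat_fun A x"
    proof
      fix i
      show "f x i = mat_fun A x i"
      proof (cases "i < m")
        case True
        then show ?thesis by (simp add: fx sum_fun_apply mat_fun_def A_def mult.commute)
      next
        case False
        moreover have "f x \<in> kpow m" using linear_betweenD(1)[OF f x] .
        ultimately show ?thesis using A by (auto simp: kpow_def mat_fun_def)
      qed
    qed
  qed
qed

section \<open>Morphisms and isomorphisms\<close>

lemma hom_betweenD: "f \<in> hom X Y \<Longrightarrow> linear_between (rep_scale X) (rep_space X v) (rep_scale Y) (rep_space Y v) (f v)"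
  and hom_commD: "f \<in> hom X Y \<Longrightarrow> x \<in> rep_space X (src a) \<Longrightarrow>
    f (tgt a) (rep_map X a x) = rep_map Y a (f (src a) x)"
  by (auto simp: hom_def)

lemma hom_memD: "f \<in> hom X Y \<Longrightarrow> x \<in> rep_space X v \<Longrightarrow> f v x \<in> rep_space Y v"
  using hom_betweenD linear_betweenD(1) by metis

lemma fd_rep_subspace: "fd_rep X \<Longrightarrow> module.subspace (rep_scale X) (rep_space X v)"
  and fd_rep_vector_space: "fd_rep X \<Longrightarrow> vector_space (rep_scale X)"
  and fd_rep_map: "fd_rep X \<Longrightarrow>
    linear_between (rep_scale X) (rep_space X (src a)) (rep_scale X) (rep_space X (tgt a)) (rep_map X a)"
  by (auto simp: fd_rep_def)

lemma fd_rep_map_mem: "fd_rep X \<Longrightarrow> x \<in> rep_space X (src a) \<Longrightarrow> rep_map X a x \<in> rep_space X (tgt a)"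
  using fd_rep_map linear_betweenD(1) by metis

lemma between_comp:
  "linear_between s V t W f \<Longrightarrow> linear_between t W r Z g \<Longrightarrow> linear_between s V r Z (\<lambda>x. g (f x))"
  by (auto simp: linear_between_def)

lemma hom_comp:
  assumes "f \<in> hom X Y" "g \<in> hom Y Z" shows "(\<lambda>v x. g v (f v x)) \<in> hom X Z"
  unfolding hom_def
proof (intro CollectI conjI allI ballI)
  fix v
  show "linear_between (rep_scale X) (rep_space X v) (rep_scale Z) (rep_space Z v) (\<lambda>x. g v (f v x))"
    by (rule between_comp[OF hom_betweenD hom_betweenD]) (rule assms)+
next
  fix a x assume "x \<in> rep_space X (src a)"
  then show "g (tgt a) (f (tgt a) (rep_map X a x)) = rep_map Z a (g (src a) (f (src a) x))"
    using assms by (simp add: hom_commD hom_memD)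
qed

text \<open>\<open>fd_rep X\<close> enters through closure: \<open>g v x + g v y\<close>, scalar
  multiples and images under \<open>rep_map X\<close> have to stay where \<open>g\<close> undoes
  \<open>f\<close>, and there the equations for \<open>g\<close> follow from those for
  \<open>f\<close>.\<close>

lemma rep_iso_inverse:
  assumes fd: "fd_rep X" and iso: "rep_iso X Y"
  obtains f g where "f \<in> hom X Y" "g \<in> hom Y X"
    "\<And>v x. x \<in> rep_space X v \<Longrightarrow> g v (f v x) = x"
    "\<And>v y. y \<in> rep_space Y v \<Longrightarrow> f v (g v y) = y"
proof -
  obtain f where f: "f \<in> hom X Y" "\<And>v. bij_betw (f v) (rep_space X v) (rep_space Y v)"
    using iso by (auto simp: rep_iso_def)
  define g where "g v = the_inv_into (rep_space X v) (f v)" for v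
  have gf: "g v (f v x) = x" if "x \<in> rep_space X v" for v x
    using that f(2) by (auto simp: g_def bij_betw_def the_inv_into_f_f)
  have fg: "f v (g v y) = y" and gX: "g v y \<in> rep_space X v" if "y \<in> rep_space Y v" for v y
    using that f(2) by (auto simp: g_def bij_betw_def f_the_inv_into_f the_inv_into_into)
  interpret vector_space "rep_scale X" using fd fd_rep_vector_space by blast
  note sub = fd_rep_subspace[OF fd]
  have "g \<in> hom Y X"
    unfolding hom_def
  proof (intro CollectI conjI allI ballI)
    fix v
    note fl = linear_betweenD[OF hom_betweenD[OF f(1), of v]]
    show "linear_between (rep_scale Y) (rep_space Y v) (rep_scale X) (rep_space X v) (g v)"
    proof (rule linear_betweenI)
      fix x y assume xy: "x \<in> rep_space Y v" "y \<in> rep_space Y v"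
      then have "g v (f v (g v x + g v y)) = g v x + g v y"
        by (intro gf subspace_add[OF sub] gX)
      then show "g v (x + y) = g v x + g v y" using xy fl(2) fg gX by simp
    next
      fix c x assume x: "x \<in> rep_space Y v"
      then have "g v (f v (rep_scale X c (g v x))) = rep_scale X c (g v x)"
        by (intro gf subspace_scale[OF sub] gX)
      then show "g v (rep_scale Y c x) = rep_scale X c (g v x)" using x fl(3) fg gX by simp
    qed (rule gX)
  next
    fix a y assume y: "y \<in> rep_space Y (src a)"
    have "g (tgt a) (f (tgt a) (rep_map X a (g (src a) y))) = rep_map X a (g (src a) y)"
      using gf fd_rep_map_mem[OF fd gX[OF y]] by blast
    then show "g (tgt a) (rep_map Y a y) = rep_map X a (g (src a) y)"
      using hom_commD[OF f(1) gX[OF y]] fg[OF y] by simp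
  qed
  then show thesis using that f(1) gf fg by blast
qed

lemma rep_iso_inverseI:
  assumes "f \<in> hom X Y" "g \<in> hom Y X"
    and "\<And>v x. x \<in> rep_space X v \<Longrightarrow> g v (f v x) = x"
    and "\<And>v y. y \<in> rep_space Y v \<Longrightarrow> f v (g v y) = y"
  shows "rep_iso X Y"
proof -
  have "bij_betw (f v) (rep_space X v) (rep_space Y v)" for v
    by (rule bij_betwI[of _ _ _ "g v"])
      (use assms hom_memD[OF assms(1)] hom_memD[OF assms(2)] in auto)
  then show ?thesis using assms(1) by (auto simp: rep_iso_def)
qed

lemma rep_iso_sym: "fd_rep X \<Longrightarrow> rep_iso X Y \<Longrightarrow> rep_iso Y X"
  by (metis rep_iso_inverse rep_iso_inverseI)

lemma rep_iso_trans:
  assumes "rep_iso X Y" "rep_iso Y Z" shows "rep_iso X Z"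
proof -
  obtain f g where "f \<in> hom X Y" "\<And>v. bij_betw (f v) (rep_space X v) (rep_space Y v)"
    "g \<in> hom Y Z" "\<And>v. bij_betw (g v) (rep_space Y v) (rep_space Z v)"
    using assms by (auto simp: rep_iso_def)
  then show ?thesis
    using hom_comp[of f X Y g Z] bij_betw_trans[of "f v" _ _ "g v" for v, unfolded comp_def]
    unfolding rep_iso_def by (intro bexI[of _ "\<lambda>v x. g v (f v x)"]) blast+
qed

lemma surj_hom_comp:
  assumes "surj_hom X Y f" "surj_hom Y Z g"
  shows "surj_hom X Z (\<lambda>v x. g v (f v x))"
  using assms hom_comp[of f X Y g Z] by (auto simp: surj_hom_def image_image[symmetric])

section \<open>Invariance of exceptionality under isomorphism\<close>

text \<open>The terms of a resolution do not involve the carrier type of \<open>X\<close>, so the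
  same \<open>P\<close> resolves \<open>Y\<close> once \<open>f\<close> is appended to the
  augmentation. A cocycle into \<open>Y\<close> is carried to \<open>X\<close> by \<open>g\<close>,
  bounded there, and the bounding morphism is carried back by \<open>f\<close>.\<close>

lemma Ext_zero_iso:
  assumes fdX: "fd_rep X" and iso: "rep_iso X Y" and ext: "Ext_zero (Suc i) X X"
  shows "Ext_zero (Suc i) Y Y"
proof -
  obtain f g where fg: "f \<in> hom X Y" "g \<in> hom Y X"
    "\<And>v x. x \<in> rep_space X v \<Longrightarrow> g v (f v x) = x"
    "\<And>v y. y \<in> rep_space Y v \<Longrightarrow> f v (g v y) = y"
    using rep_iso_inverse[OF fdX iso] by metis
  interpret X: vector_space "rep_scale X" using fdX fd_rep_vector_space by blast
  have f0: "f v 0 = 0" and g0: "g v 0 = 0" for v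
  proof -
    have 0: "0 \<in> rep_space X v" using X.subspace_0[OF fd_rep_subspace[OF fdX]] .
    have "f v (0 + 0) = f v 0 + f v 0"
      using linear_betweenD(2)[OF hom_betweenD[OF fg(1)] 0 0] .
    then show "f v 0 = 0" by simp
    then show "g v 0 = 0" using fg(3)[OF 0] by simp
  qed
  obtain P d p where P: "projective_resolution X P d p"
    and ex: "\<And>\<phi>. cocycle P d X (Suc i) \<phi> \<Longrightarrow> coboundary P d X (Suc i) \<phi>"
    using ext by (auto simp: Ext_zero_def)
  have p: "surj_hom (P 0) X p" using P by (simp add: projective_resolution_def)
  have "f v ` rep_space X v = rep_space Y v" for v
    using hom_memD[OF fg(1)] hom_memD[OF fg(2)] fg(4) by (metis imageI image_subsetI subsetI subset_antisym)
  then have "surj_hom X Y f" using fg(1) by (simp add: surj_hom_def)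
  then have "surj_hom (P 0) Y (\<lambda>v x. f v (p v x))" using surj_hom_comp[OF p] by blast
  moreover have "{x \<in> rep_space (P 0) v. f v (p v x) = 0} = {x \<in> rep_space (P 0) v. p v x = 0}" for v
    using fg(3) f0 g0 hom_memD[of p "P 0" X] p unfolding surj_hom_def
    by (intro Collect_cong conj_cong refl) metis
  ultimately have "projective_resolution Y P d (\<lambda>v x. f v (p v x))"
    using P by (simp add: projective_resolution_def)
  moreover have "coboundary P d Y (Suc i) \<phi>" if \<phi>: "cocycle P d Y (Suc i) \<phi>" for \<phi>
  proof -
    have hom\<phi>: "\<phi> \<in> hom (P (Suc i)) Y" using \<phi> by (simp add: cocycle_def)
    have "cocycle P d X (Suc i) (\<lambda>v x. g v (\<phi> v x))"
      using \<phi> hom_comp[OF hom\<phi> fg(2)] g0 by (auto simp: cocycle_def)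
    from ex[OF this] obtain h where h: "h \<in> hom (P i) X"
      "\<And>v x. x \<in> rep_space (P (Suc i)) v \<Longrightarrow> g v (\<phi> v x) = h v (d i v x)" by auto
    have "\<phi> v x = f v (h v (d i v x))" if "x \<in> rep_space (P (Suc i)) v" for v x
      using h(2)[OF that] fg(4)[OF hom_memD[OF hom\<phi> that]] by simp
    then show ?thesis
      using bexI[OF _ hom_comp[OF h(1) fg(1)]] by simp
  qed
  ultimately show ?thesis by (auto simp: Ext_zero_def)
qed

text \<open>Conjugation by \<open>f\<close> identifies the endomorphisms, and an endomorphism and
  its conjugate are given by the same scalars, so existence and uniqueness transfer
  together.\<close>

lemma exceptional_iso:
  assumes fdX: "fd_rep X" and fdY: "fd_rep Y" and iso: "rep_iso X Y" and ex: "exceptional X"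
  shows "exceptional Y"
proof -
  obtain f g where fg: "f \<in> hom X Y" "g \<in> hom Y X"
    "\<And>v x. x \<in> rep_space X v \<Longrightarrow> g v (f v x) = x"
    "\<And>v y. y \<in> rep_space Y v \<Longrightarrow> f v (g v y) = y"
    using rep_iso_inverse[OF fdX iso] by metis
  interpret X: vector_space "rep_scale X" using fdX fd_rep_vector_space by blast
  note mem = hom_memD[OF fg(1)] hom_memD[OF fg(2)]
  have scal: "f v (rep_scale X c x) = rep_scale Y c (f v x)" if "x \<in> rep_space X v" for v c x
    using linear_betweenD(3)[OF hom_betweenD[OF fg(1)] that] .
  have "\<exists>!c. \<forall>v. \<forall>x\<in>rep_space Y v. h v x = rep_scale Y c x" if h: "h \<in> hom Y Y" for h
  proof -
    let ?h = "\<lambda>v x. g v (h v (f v x))"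
    have "?h \<in> hom X X" using hom_comp[OF hom_comp[OF fg(1) h] fg(2)] .
    then have "\<exists>!c. \<forall>v. \<forall>x\<in>rep_space X v. ?h v x = rep_scale X c x"
      using ex by (simp add: exceptional_def)
    moreover have "(\<forall>v. \<forall>x\<in>rep_space X v. ?h v x = rep_scale X c x) \<longleftrightarrow>
      (\<forall>v. \<forall>x\<in>rep_space Y v. h v x = rep_scale Y c x)" for c
    proof safe
      fix v y assume *: "\<forall>v. \<forall>x\<in>rep_space X v. ?h v x = rep_scale X c x" and y: "y \<in> rep_space Y v"
      have "f v (?h v (g v y)) = f v (rep_scale X c (g v y))" using * y mem by auto
      then show "h v y = rep_scale Y c y"
        using fg(4) y mem(2)[OF y] hom_memD[OF h y] scal by simp
    next
      fix v x assume *: "\<forall>v. \<forall>x\<in>rep_space Y v. h v x = rep_scale Y c x" and x: "x \<in> rep_space X v"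
      have "rep_scale X c x \<in> rep_space X v"
        using X.subspace_scale[OF fd_rep_subspace[OF fdX] x] .
      then show "?h v x = rep_scale X c x" using * x mem scal fg(3) by (metis (no_types))
    qed
    ultimately show ?thesis by simp
  qed
  moreover have "Ext_zero i Y Y" if "i \<noteq> 0" for i
    using Ext_zero_iso[OF fdX iso] ex that by (metis exceptional_def not0_implies_Suc)
  ultimately show ?thesis using fdY by (simp add: exceptional_def)
qed

section \<open>Matrix representations\<close>

definition mrep :: "(vertex \<Rightarrow> nat) \<Rightarrow> (arrow \<Rightarrow> 'k::field mat) \<Rightarrow> 'k seq_rep" where
  "mrep d M = \<lparr>rep_scale = fscale, rep_space = (\<lambda>v. kpow (d v)), rep_map = (\<lambda>a. mat_fun (M a))\<rparr>"

lemma mrep_simps [simp]: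
  "rep_scale (mrep d M) = fscale" "rep_space (mrep d M) v = kpow (d v)"
  "rep_map (mrep d M) a = mat_fun (M a)"
  by (simp_all add: mrep_def)

definition mats :: "(vertex \<Rightarrow> nat) \<Rightarrow> (arrow \<Rightarrow> 'k mat) \<Rightarrow> bool" where
  "mats d M \<longleftrightarrow> (\<forall>a. M a \<in> carrier_mat (d (tgt a)) (d (src a)))"

lemma matsD: "mats d M \<Longrightarrow> M a \<in> carrier_mat (d (tgt a)) (d (src a))"
  by (simp add: mats_def)

definition mat_hom ::
  "(vertex \<Rightarrow> nat) \<Rightarrow> (arrow \<Rightarrow> 'k::field mat) \<Rightarrow> (vertex \<Rightarrow> nat) \<Rightarrow> (arrow \<Rightarrow> 'k mat) \<Rightarrow>
   (vertex \<Rightarrow> 'k mat) \<Rightarrow> bool" where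
  "mat_hom d M d' M' F \<longleftrightarrow>
     (\<forall>v. F v \<in> carrier_mat (d' v) (d v)) \<and> (\<forall>a. F (tgt a) * M a = M' a * F (src a))"

lemma fd_rep_supported:
  assumes "\<And>v. fs.subspace (U v)" "\<And>v. U v \<subseteq> supported (I v)" "\<And>v. finite (I v)"
    and "\<And>a. linear_between fscale (U (src a)) fscale (U (tgt a)) (M a)"
  shows "fd_rep \<lparr>rep_scale = fscale, rep_space = U, rep_map = M\<rparr>"
  using assms fd_subspace[OF assms(1,2,3)] unfolding fd_rep_def
  by (auto intro: fs.vector_space_axioms) metis

lemma fd_mrep: "mats d M \<Longrightarrow> fd_rep (mrep d M)"
  unfolding mrep_def
  by (rule fd_rep_supported[of _ "\<lambda>v. {..<d v}"])
    (auto simp: subspace_kpow kpow_eq_supported[symmetric] intro: mat_fun_between matsD)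

lemma hom_mrepI:
  assumes M: "mats d M" "mats d' M'" and F: "mat_hom d M d' M' F"
  shows "(\<lambda>v. mat_fun (F v)) \<in> hom (mrep d M) (mrep d' M')"
  unfolding hom_def
proof (intro CollectI conjI allI ballI)
  show "linear_between (rep_scale (mrep d M)) (rep_space (mrep d M) v) (rep_scale (mrep d' M'))
      (rep_space (mrep d' M') v) (mat_fun (F v))" for v
    using F by (auto simp: mat_hom_def intro: mat_fun_between)
next
  fix a x
  have "F (tgt a) \<in> carrier_mat (d' (tgt a)) (d (tgt a))"
    "F (src a) \<in> carrier_mat (d' (src a)) (d (src a))" "F (tgt a) * M a = M' a * F (src a)"
    using F by (auto simp: mat_hom_def)
  then show "mat_fun (F (tgt a)) (rep_map (mrep d M) a x) = rep_map (mrep d' M') a (mat_fun (F (src a)) x)"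
    using matsD[OF M(1), of a] matsD[OF M(2), of a] by (simp flip: mat_fun_mult)
qed

lemma hom_mrepE:
  assumes M: "mats d M" "mats d' M'" and f: "f \<in> hom (mrep d M) (mrep d' M')"
  obtains F where "mat_hom d M d' M' F" "\<And>v x. x \<in> kpow (d v) \<Longrightarrow> f v x = mat_fun (F v) x"
proof -
  have "\<exists>A\<in>carrier_mat (d' v) (d v). \<forall>x\<in>kpow (d v). f v x = mat_fun A x" for v
  proof -
    have "linear_between fscale (kpow (d v)) fscale (kpow (d' v)) (f v)"
      using hom_betweenD[OF f, of v] by simp
    then show ?thesis by (rule between_kpow_mat) blast
  qed
  then obtain F where F: "\<And>v. F v \<in> carrier_mat (d' v) (d v)"
    "\<And>v x. x \<in> kpow (d v) \<Longrightarrow> f v x = mat_fun (F v) x" by metis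
  have "F (tgt a) * M a = M' a * F (src a)" for a
  proof (rule mat_fun_eqI)
    show "F (tgt a) * M a \<in> carrier_mat (d' (tgt a)) (d (src a))"
      "M' a * F (src a) \<in> carrier_mat (d' (tgt a)) (d (src a))"
      using F(1) matsD[OF M(1), of a] matsD[OF M(2), of a] by (meson mult_carrier_mat)+
    fix x :: "nat \<Rightarrow> 'a" assume x: "x \<in> kpow (d (src a))"
    then have "mat_fun (F (tgt a)) (mat_fun (M a) x) = mat_fun (M' a) (mat_fun (F (src a)) x)"
      using hom_commD[OF f, of x a] F(2) mat_fun_in_kpow[OF matsD[OF M(1)]] by simp
    then show "mat_fun (F (tgt a) * M a) x = mat_fun (M' a * F (src a)) x"
      using mat_fun_mult[OF F(1) matsD[OF M(1)]] mat_fun_mult[OF matsD[OF M(2)] F(1)] by simp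
  qed
  then show thesis using that[of F] F by (simp add: mat_hom_def)
qed

section \<open>Coordinates, and exceptionality in terms of matrices\<close>

lemma (in vector_space) subspace_coordinates:
  assumes V: "subspace V" and S: "finite S" "span S = V"
  obtains n \<phi> where "linear_between fscale (kpow n) scale V \<phi>" "bij_betw \<phi> (kpow n) V"
proof -
  obtain B where B: "B \<subseteq> V" "independent B" "V \<subseteq> span B" using maximal_independent_subset by blast
  have fin: "finite B" using independent_span_bound[OF S(1) B(2)] B(1) S(2) by blast
  have span: "span B = V" using B(1,3) span_minimal[OF _ V] by blast
  obtain ix where ix: "bij_betw ix B {0..<card B}" using ex_bij_betw_finite_nat[OF fin] by blast
  define \<phi> where "\<phi> a = (\<Sum>w\<in>B. scale (a (ix w)) w)" for a
  have lin: "linear_between fscale (kpow (card B)) scale V \<phi>"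
  proof (rule linear_betweenI)
    show "\<phi> a \<in> V" for a
      using B(1) unfolding \<phi>_def by (intro subspace_sum[OF V] subspace_scale[OF V]) auto
  qed (auto simp: \<phi>_def scale_left_distrib sum.distrib scale_sum_right)
  moreover have "bij_betw \<phi> (kpow (card B)) V"
    unfolding bij_betw_def
  proof
    show "inj_on \<phi> (kpow (card B))"
    proof (rule inj_onI)
      fix x y assume xy: "x \<in> kpow (card B)" "y \<in> kpow (card B)" "\<phi> x = \<phi> y"
      then have "(\<Sum>w\<in>B. scale (x (ix w) - y (ix w)) w) = 0"
        by (simp add: \<phi>_def scale_left_diff_distrib sum_subtractf)
      then have eq: "x (ix w) = y (ix w)" if "w \<in> B" for w
        using independentD[OF B(2) fin subset_refl _ that, of "\<lambda>w. x (ix w) - y (ix w)"] by simp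
      show "x = y"
      proof
        fix i show "x i = y i"
        proof (cases "i < card B")
          case True
          then have "i \<in> ix ` B" using ix by (simp add: bij_betw_def)
          then obtain w where "w \<in> B" "ix w = i" by blast
          then show ?thesis using eq by blast
        next
          case False then show ?thesis using xy by (simp add: kpow_def)
        qed
      qed
    qed
    show "\<phi> ` kpow (card B) = V"
    proof
      show "V \<subseteq> \<phi> ` kpow (card B)"
      proof
        fix z assume "z \<in> V"
        then obtain u where u: "z = (\<Sum>w\<in>B. scale (u w) w)"
          using span span_finite[OF fin] by auto
        let ?a = "\<lambda>i. if i < card B then u (the_inv_into B ix i) else 0"
        have "?a \<in> kpow (card B)" by (simp add: kpow_def)
        moreover have "\<phi> ?a = z"
          unfolding \<phi>_def u using ix
          by (intro sum.cong refl) (auto simp: bij_betw_def the_inv_into_f_f)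
        ultimately show "z \<in> \<phi> ` kpow (card B)" by blast
      qed
    qed (use linear_betweenD(1)[OF lin] in auto)
  qed
  ultimately show thesis using that by blast
qed

text \<open>The matrix of an arrow is its map conjugated by the coordinate isomorphisms
  \<open>\<phi>\<close> and their sections \<open>r\<close>. This removes the carrier type of
  \<open>X\<close> from the rest of the argument.\<close>

lemma fd_rep_coordinates:
  fixes X :: "('k::field, 'v::ab_group_add) rep"
  assumes fd: "fd_rep X"
  obtains d M where "mats d M" "rep_iso (mrep d M) X"
proof -
  let ?s = "rep_scale X"
  interpret vector_space ?s using fd_rep_vector_space[OF fd] .
  have "\<exists>n \<phi>. linear_between fscale (kpow n) ?s (rep_space X v) \<phi> \<and>
      bij_betw \<phi> (kpow n) (rep_space X v)" for v
  proof -
    obtain S where "finite S" "span S = rep_space X v"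
      using fd unfolding fd_rep_def by metis
    then show ?thesis using subspace_coordinates[OF fd_rep_subspace[OF fd]] by metis
  qed
  then obtain d \<phi> where
    \<phi>: "\<And>v. linear_between fscale (kpow (d v)) ?s (rep_space X v) (\<phi> v)" and
    bij: "\<And>v. bij_betw (\<phi> v) (kpow (d v)) (rep_space X v)" by metis
  have "\<exists>r. linear_between ?s (rep_space X v) fscale (kpow (d v)) r \<and>
      (\<forall>w\<in>rep_space X v. \<phi> v (r w) = w)" for v
  proof -
    interpret subspace_pair fscale ?s "kpow (d v) :: (nat \<Rightarrow> 'k) set" "rep_space X v"
      by unfold_locales (auto simp: subspace_kpow fd_rep_subspace[OF fd])
    show ?thesis using between_right_inverse[OF \<phi>] bij by (metis bij_betw_def)
  qed
  then obtain r where
    r: "\<And>v. linear_between ?s (rep_space X v) fscale (kpow (d v)) (r v)" and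
    \<phi>r: "\<And>v w. w \<in> rep_space X v \<Longrightarrow> \<phi> v (r v w) = w" by metis
  have "\<exists>A\<in>carrier_mat (d (tgt a)) (d (src a)). \<forall>x\<in>kpow (d (src a)).
      r (tgt a) (rep_map X a (\<phi> (src a) x)) = mat_fun A x" for a
    using between_comp[OF between_comp[OF \<phi> fd_rep_map[OF fd]] r]
    by (rule between_kpow_mat) blast
  then obtain M where M: "\<And>a. M a \<in> carrier_mat (d (tgt a)) (d (src a))"
    "\<And>a x. x \<in> kpow (d (src a)) \<Longrightarrow> r (tgt a) (rep_map X a (\<phi> (src a) x)) = mat_fun (M a) x"
    by metis
  have "\<phi> \<in> hom (mrep d M) X"
    using \<phi> M(2)[symmetric] \<phi>r fd_rep_map_mem[OF fd] linear_betweenD(1)[OF \<phi>]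
    by (simp add: hom_def)
  then show thesis using that[of d M] bij M(1) by (auto simp: rep_iso_def mats_def)
qed

text \<open>A scalar describing an endomorphism is unique exactly when some space is nonzero; the
  first conjunct therefore stands for the uniqueness in \<open>exceptional\<close>.\<close>

definition brick :: "(vertex \<Rightarrow> nat) \<Rightarrow> (arrow \<Rightarrow> 'k::field mat) \<Rightarrow> bool" where
  "brick d M \<longleftrightarrow> (\<exists>v. d v > 0) \<and>
     (\<forall>F. mat_hom d M d M F \<longrightarrow> (\<exists>c. \<forall>v. F v = c \<cdot>\<^sub>m 1\<^sub>m (d v)))"

text \<open>Vanishing of \<open>Ext\<^sup>1(M, M)\<close>, computed as the cokernel of
  \<open>\<Oplus>\<^sub>v End(M\<^sub>v) \<rightarrow> \<Oplus>\<^sub>a Hom(M\<^sub>s\<^sub>(\<^sub>a\<^sub>), M\<^sub>t\<^sub>(\<^sub>a\<^sub>))\<close>.\<close>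

definition rigid :: "(vertex \<Rightarrow> nat) \<Rightarrow> (arrow \<Rightarrow> 'k::field mat) \<Rightarrow> bool" where
  "rigid d M \<longleftrightarrow> (\<forall>G. mats d G \<longrightarrow>
     (\<exists>H. (\<forall>v. H v \<in> carrier_mat (d v) (d v)) \<and>
          (\<forall>a. H (tgt a) * M a = M a * H (src a) + G a)))"

lemma endo_mrep_iff_brick:
  fixes M :: "arrow \<Rightarrow> 'k::field mat"
  assumes M: "mats d M"
  shows "(\<forall>f\<in>hom (mrep d M) (mrep d M). \<exists>!c. \<forall>v. \<forall>x\<in>rep_space (mrep d M) v.
      f v x = rep_scale (mrep d M) c x) \<longleftrightarrow> brick d M" (is "?E \<longleftrightarrow> _")
proof
  have scalar: "F = c \<cdot>\<^sub>m 1\<^sub>m n \<longleftrightarrow> (\<forall>x\<in>kpow n. mat_fun F x = fscale c x)"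
    if "F \<in> carrier_mat n n" for F :: "'k mat" and n c
  proof
    assume "\<forall>x\<in>kpow n. mat_fun F x = fscale c x"
    then show "F = c \<cdot>\<^sub>m 1\<^sub>m n"
      using that by (intro mat_fun_eqI[where n = n]) (auto simp: mat_fun_smult mat_fun_one)
  qed (auto simp: mat_fun_smult mat_fun_one)
  {
    assume E: ?E
    show "brick d M"
      unfolding brick_def
    proof (intro conjI allI impI)
      show "\<exists>v. 0 < d v"
      proof (rule ccontr)
        assume "\<not> (\<exists>v. 0 < d v)"
        then have d: "d v = 0" for v by simp
        have "(\<lambda>v. mat_fun (1\<^sub>m (d v))) \<in> hom (mrep d M) (mrep d M)"
          using left_mult_one_mat[OF matsD[OF M]] right_mult_one_mat[OF matsD[OF M]]
          by (intro hom_mrepI[OF M M]) (simp add: mat_hom_def)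
        with E have "\<exists>!c. \<forall>v. \<forall>x\<in>kpow (d v). mat_fun (1\<^sub>m (d v)) x = fscale c (x :: nat \<Rightarrow> 'k)"
          by auto
        \<comment> \<open>If all spaces are zero, every scalar describes the identity, so 0 and 1
          contradict uniqueness.\<close>
        moreover have "\<forall>v. \<forall>x\<in>kpow (d v). mat_fun (1\<^sub>m (d v)) x = fscale c (x :: nat \<Rightarrow> 'k)" for c
          by (auto simp: d kpow_def mat_fun_def fun_eq_iff)
        ultimately show False using zero_neq_one by (metis (lifting))
      qed
    next
      fix F assume F: "mat_hom d M d M F"
      then have "\<exists>c. \<forall>v. \<forall>x\<in>kpow (d v). mat_fun (F v) x = fscale c x"
        using E hom_mrepI[OF M M F] by fastforce
      moreover have "F v \<in> carrier_mat (d v) (d v)" for v using F by (simp add: mat_hom_def)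
      ultimately show "\<exists>c. \<forall>v. F v = c \<cdot>\<^sub>m 1\<^sub>m (d v)" using scalar by metis
    qed
  next
    assume B: "brick d M"
    show ?E
    proof
      fix f assume "f \<in> hom (mrep d M) (mrep d M)"
      then obtain F where F: "mat_hom d M d M F" "\<And>v x. x \<in> kpow (d v) \<Longrightarrow> f v x = mat_fun (F v) x"
        using hom_mrepE[OF M M] by metis
      obtain c where c: "\<And>v. F v = c \<cdot>\<^sub>m 1\<^sub>m (d v)" using B F(1) by (auto simp: brick_def)
      obtain v where v: "d v > 0" using B by (auto simp: brick_def)
      show "\<exists>!c. \<forall>v. \<forall>x\<in>rep_space (mrep d M) v. f v x = rep_scale (mrep d M) c x"
      proof
        show "\<forall>v. \<forall>x\<in>rep_space (mrep d M) v. f v x = rep_scale (mrep d M) c x"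
          using F(2) c by (simp add: mat_fun_smult mat_fun_one)
        fix c' assume "\<forall>v. \<forall>x\<in>rep_space (mrep d M) v. f v x = rep_scale (mrep d M) c' x"
        moreover have u: "(unit_at 0 :: nat \<Rightarrow> 'k) \<in> kpow (d v)" using unit_at_in_kpow[OF v] .
        ultimately have "f v (unit_at 0) = fscale c' (unit_at 0)" by simp
        then have "fscale c (unit_at 0) = fscale c' (unit_at 0 :: nat \<Rightarrow> 'k)"
          using F(2)[OF u] c u by (simp del: fs.scale_cancel_right add: mat_fun_smult mat_fun_one)
        then show "c' = c" by (auto simp: fun_eq_iff unit_at_def dest: spec[of _ 0])
      qed
    qed
  }
qed

section \<open>Projective representations\<close>

lemma image_subspace:
  assumes "vector_space s" "vector_space t" and V: "module.subspace s V"
    and f: "linear_between s V t W f"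
  shows "module.subspace t (f ` V)"
proof -
  interpret vs: vector_space_pair s t using assms(1,2) by (simp add: vector_space_pair_def)
  note fl = linear_betweenD[OF f]
  have 0: "0 \<in> V" using vs.vs1.subspace_0[OF V] .
  have "f (0 + 0) = f 0 + f 0" by (rule fl(2)[OF 0 0])
  then have f0: "f 0 = 0" by simp
  show ?thesis
    unfolding vs.vs2.subspace_def
  proof (intro conjI ballI allI)
    show "0 \<in> f ` V" using imageI[OF 0, of f] f0 by simp
    fix x y assume "x \<in> f ` V" "y \<in> f ` V"
    then obtain x' y' where "x' \<in> V" "x = f x'" "y' \<in> V" "y = f y'" by blast
    then show "x + y \<in> f ` V"
      using fl(2)[of x' y'] vs.vs1.subspace_add[OF V, of x' y'] by (metis imageI)
  next
    fix c x assume "x \<in> f ` V"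
    then obtain x' where "x' \<in> V" "x = f x'" by blast
    then show "t c x \<in> f ` V"
      using fl(3)[of x' c] vs.vs1.subspace_scale[OF V, of x' c] by (metis imageI)
  qed
qed

text \<open>Joint injectivity says that \<open>U\<close> is the direct sum of the two images;
  \<open>p\<close> and \<open>q\<close> recover the summands. At the vertex \<open>Ve\<close> two
  arrows meet, and a lift has to be prescribed on both images at once.\<close>

lemma between_joint_inverse:
  fixes f g :: "'v::ab_group_add \<Rightarrow> 'w::ab_group_add" and s :: "'k::field \<Rightarrow> 'v \<Rightarrow> 'v"
    and t :: "'k \<Rightarrow> 'w \<Rightarrow> 'w"
  assumes vs: "vector_space s" "vector_space t"
    and sub: "module.subspace s V" "module.subspace s W"
    and f: "linear_between s V t Z f" and g: "linear_between s W t Z g"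
    and inj: "\<And>x y. x \<in> V \<Longrightarrow> y \<in> W \<Longrightarrow> f x + g y = 0 \<Longrightarrow> x = 0 \<and> y = 0"
  obtains U p q where "U = {f x + g y | x y. x \<in> V \<and> y \<in> W}" "module.subspace t U"
    "linear_between t U s V p" "linear_between t U s W q"
    "\<And>x y. x \<in> V \<Longrightarrow> y \<in> W \<Longrightarrow> p (f x + g y) = x \<and> q (f x + g y) = y"
proof -
  interpret vs: vector_space_pair s t using vs by (simp add: vector_space_pair_def)
  define U where "U = {f x + g y | x y. x \<in> V \<and> y \<in> W}"
  note fl = linear_betweenD[OF f] and gl = linear_betweenD[OF g]
  have diff: "f (x - x') = f x - f x'" if "x \<in> V" "x' \<in> V" for x x'
    using fl(2)[of "x - x'" x'] vs.vs1.subspace_diff[OF sub(1)] that by (simp add: algebra_simps)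
  have diff': "g (x - x') = g x - g x'" if "x \<in> W" "x' \<in> W" for x x'
    using gl(2)[of "x - x'" x'] vs.vs1.subspace_diff[OF sub(2)] that by (simp add: algebra_simps)
  have uniq: "x = x' \<and> y = y'"
    if "x \<in> V" "x' \<in> V" "y \<in> W" "y' \<in> W" "f x + g y = f x' + g y'" for x x' y y'
  proof -
    have "f (x - x') + g (y - y') = 0" using that by (simp add: diff diff' algebra_simps)
    then show ?thesis
      using inj[of "x - x'" "y - y'"] that vs.vs1.subspace_diff sub by simp
  qed
  have "\<exists>x y. z \<in> U \<longrightarrow> x \<in> V \<and> y \<in> W \<and> z = f x + g y" for z by (auto simp: U_def)
  then obtain p q where pq: "\<And>z. z \<in> U \<Longrightarrow> p z \<in> V \<and> q z \<in> W \<and> z = f (p z) + g (q z)" by metis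
  have UI: "f x + g y \<in> U" if "x \<in> V" "y \<in> W" for x y using that by (auto simp: U_def)
  have inv: "p (f x + g y) = x \<and> q (f x + g y) = y" if "x \<in> V" "y \<in> W" for x y
    using uniq pq[OF UI[OF that]] that by metis
  have add: "z + z' = f (p z + p z') + g (q z + q z')" if "z \<in> U" "z' \<in> U" for z z'
    using pq[OF that(1)] pq[OF that(2)] fl(2)[of "p z" "p z'"] gl(2)[of "q z" "q z'"]
    by (simp add: algebra_simps)
  have scale: "t c z = f (s c (p z)) + g (s c (q z))" if "z \<in> U" for z c
    using pq[OF that] fl(3)[of "p z" c] gl(3)[of "q z" c]
    by (metis vs.vs2.scale_right_distrib)
  have mem: "p z + p z' \<in> V" "q z + q z' \<in> W" "s c (p z) \<in> V" "s c (q z) \<in> W"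
    if "z \<in> U" "z' \<in> U" for z z' c
    using pq that vs.vs1.subspace_add vs.vs1.subspace_scale sub by auto
  show thesis
  proof (rule that[OF U_def])
    have "0 \<in> U"
      using UI[of 0 0] vs.vs1.subspace_0 sub diff[of 0 0] diff'[of 0 0] by simp
    then show "vs.vs2.subspace U"
      using add scale UI mem by (metis vs.vs2.subspaceI)
    show "linear_between t U s V p" "linear_between t U s W q"
      using add scale inv mem pq by (auto intro!: linear_betweenI)
  qed (fact inv)
qed

lemma linear_between_zero: "linear_between s V t W f \<Longrightarrow> 0 \<in> V \<Longrightarrow> f 0 = 0"
  using linear_betweenD(2)[of s V t W f 0 0] by simp

text \<open>On \<open>U\<close> the lift is forced to be \<open>k\<close> after \<open>p\<close>
  plus \<open>l\<close> after \<open>q\<close>, and \<open>between_lift\<close> extends it to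
  \<open>P\<close>. Taking \<open>V\<close> or \<open>W\<close> to be \<open>{0}\<close> covers
  vertices that receive one arrow or none.\<close>

lemma between_lift_joint:
  fixes s :: "'k::field \<Rightarrow> 'v::ab_group_add \<Rightarrow> 'v" and t :: "'k \<Rightarrow> 'w::ab_group_add \<Rightarrow> 'w"
    and t' :: "'k \<Rightarrow> 'z::ab_group_add \<Rightarrow> 'z"
  assumes PA: "subspace_pair s t P A" and PB: "subspace_pair s t' P B"
    and f: "linear_between s P t' B f" and g: "linear_between t A t' B g" "g ` A = B"
    and V: "module.subspace s V" and W: "module.subspace s W"
    and i: "linear_between s V s P i" and j: "linear_between s W s P j"
    and inj: "\<And>x y. x \<in> V \<Longrightarrow> y \<in> W \<Longrightarrow> i x + j y = 0 \<Longrightarrow> x = 0 \<and> y = 0"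
    and k: "linear_between s V t A k" and l: "linear_between s W t A l"
    and comm: "\<And>x. x \<in> V \<Longrightarrow> g (k x) = f (i x)" "\<And>y. y \<in> W \<Longrightarrow> g (l y) = f (j y)"
  obtains h where "linear_between s P t A h" "\<And>x. x \<in> V \<Longrightarrow> h (i x) = k x"
    "\<And>y. y \<in> W \<Longrightarrow> h (j y) = l y" "\<And>x. x \<in> P \<Longrightarrow> g (h x) = f x"
proof -
  interpret PA: subspace_pair s t P A by fact
  note zero = linear_between_zero[OF _ PA.vs1.subspace_0]
  obtain U p q where U: "U = {i x + j y | x y. x \<in> V \<and> y \<in> W}" "PA.vs1.subspace U"
    and p: "linear_between s U s V p" and q: "linear_between s U s W q"
    and pq: "\<And>x y. x \<in> V \<Longrightarrow> y \<in> W \<Longrightarrow> p (i x + j y) = x \<and> q (i x + j y) = y"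
    by (rule between_joint_inverse[OF PA.vs1.vector_space_axioms PA.vs1.vector_space_axioms V W i j inj]) auto
  note il = linear_betweenD[OF i] and jl = linear_betweenD[OF j]
    and kp = between_comp[OF p k] and lq = between_comp[OF q l]
  have sub: "U \<subseteq> P" using U(1) il(1) jl(1) PA.vs1.subspace_add[OF PA.sub1] by auto
  have h0: "linear_between s U t A (\<lambda>z. k (p z) + l (q z))"
    using linear_betweenD[OF kp] linear_betweenD[OF lq] PA.vs2.subspace_add[OF PA.sub2]
    by (intro linear_betweenI) (simp_all add: PA.vs2.scale_right_distrib algebra_simps)
  have "g (k (p z) + l (q z)) = f z" if z: "z \<in> U" for z
  proof -
    obtain x y where xy: "x \<in> V" "y \<in> W" "z = i x + j y" using z U(1) by blast
    then have "g (k (p z) + l (q z)) = g (k x) + g (l y)"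
      using pq linear_betweenD(2)[OF g(1)] linear_betweenD(1)[OF k] linear_betweenD(1)[OF l] by simp
    also have "\<dots> = f z" using xy comm linear_betweenD(2)[OF f] il(1) jl(1) by simp
    finally show ?thesis .
  qed
  from between_lift[OF PA PB U(2) sub h0 f g this] obtain h where h: "linear_between s P t A h"
    "\<And>x. x \<in> U \<Longrightarrow> h x = k (p x) + l (q x)" "\<And>x. x \<in> P \<Longrightarrow> g (h x) = f x" by metis
  show thesis
  proof (rule that[OF h(1) _ _ h(3)])
    fix x assume x: "x \<in> V"
    have "h (i x + j 0) = k x + l 0"
      using h(2)[of "i x + j 0"] pq x PA.vs1.subspace_0[OF W] U(1) by auto
    then show "h (i x) = k x" using zero[OF j W] zero[OF l W] by simp
  next
    fix y assume y: "y \<in> W"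
    have "h (i 0 + j y) = k 0 + l y"
      using h(2)[of "i 0 + j y"] pq y PA.vs1.subspace_0[OF V] U(1) by auto
    then show "h (j y) = l y" using zero[OF i V] zero[OF k V] by simp
  qed
qed

text \<open>The lift is built from the source of the quiver to its sink: each incoming arrow
  prescribes it on the image of the preceding space, and independence of these images makes the
  prescription consistent. The conditions pass to subrepresentations, which is how syzygies become
  projective.\<close>

lemma projectiveI:
  fixes P :: "'k::field seq_rep"
  assumes fd: "fd_rep P"
    and inj: "\<And>x. x \<in> rep_space P Vb \<Longrightarrow> rep_map P b_plus x = 0 \<Longrightarrow> x = 0"
      "\<And>x. x \<in> rep_space P Vb \<Longrightarrow> rep_map P b_minus x = 0 \<Longrightarrow> x = 0"
      "\<And>x y. x \<in> rep_space P Vplus \<Longrightarrow> y \<in> rep_space P Vminus \<Longrightarrow>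
        rep_map P plus_e x + rep_map P minus_e y = 0 \<Longrightarrow> x = 0 \<and> y = 0"
  shows "projective P"
  unfolding projective_def
proof (intro conjI allI impI)
  fix A B :: "'k seq_rep" and g f
  assume "fd_rep A \<and> fd_rep B \<and> surj_hom A B g \<and> f \<in> hom P B"
  then have A: "fd_rep A" and B: "fd_rep B" and g: "g \<in> hom A B"
    "\<And>v. g v ` rep_space A v = rep_space B v" and f: "f \<in> hom P B"
    by (auto simp: surj_hom_def)
  let ?p = "rep_scale P" and ?a = "rep_scale A" and ?b = "rep_scale B"
  interpret pv: vector_space ?p by (fact fd_rep_vector_space[OF fd])
  have pair: "subspace_pair ?p (rep_scale Y) (rep_space P v) (rep_space Y v)" if "fd_rep Y" for v
    and Y :: "'k seq_rep"
    unfolding subspace_pair_def subspace_pair_axioms_def vector_space_pair_def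
    using fd that by (simp add: fd_rep_vector_space fd_rep_subspace)
  note lift = between_lift_joint[OF pair[OF A] pair[OF B] hom_betweenD[OF f] hom_betweenD[OF g(1)] g(2)]
  have null: "pv.subspace {0}" by simp
  have lin0: "linear_between ?p {0} (rep_scale Y) (rep_space Y v) (\<lambda>_. 0)" if "fd_rep Y" for v
    and Y :: "'k seq_rep"
  proof -
    interpret vector_space "rep_scale Y" by (fact fd_rep_vector_space[OF that])
    show ?thesis using subspace_0[OF fd_rep_subspace[OF that]] by (simp add: linear_between_def)
  qed
  have g0: "g v 0 = f v 0" for v
  proof -
    interpret vector_space ?a by (fact fd_rep_vector_space[OF A])
    have "g v 0 = 0"
      using linear_between_zero[OF hom_betweenD[OF g(1)] subspace_0[OF fd_rep_subspace[OF A]]] .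
    then show ?thesis using subspace_pair.between_zero[OF pair[OF B] hom_betweenD[OF f]] by simp
  qed
  \<comment> \<open>No arrow ends at \<open>Vb\<close>, so nothing is prescribed.\<close>
  obtain hb where hb: "linear_between ?p (rep_space P Vb) ?a (rep_space A Vb) hb"
    "\<And>x. x \<in> rep_space P Vb \<Longrightarrow> g Vb (hb x) = f Vb x"
    by (rule lift[OF null null lin0[OF fd] lin0[OF fd] _ lin0[OF A] lin0[OF A]]) (auto simp: g0)
  \<comment> \<open>Exactly one arrow ends at a middle vertex: one image carries a prescription, and
    the second subspace is zero.\<close>
  have mid: "\<exists>h. linear_between ?p (rep_space P (tgt a)) ?a (rep_space A (tgt a)) h \<and>
      (\<forall>x\<in>rep_space P (tgt a). g (tgt a) (h x) = f (tgt a) x) \<and>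
      (\<forall>x\<in>rep_space P Vb. h (rep_map P a x) = rep_map A a (hb x))"
    if a: "src a = Vb" and inj: "\<And>x. x \<in> rep_space P Vb \<Longrightarrow> rep_map P a x = 0 \<Longrightarrow> x = 0" for a
  proof (rule lift[OF fd_rep_subspace[OF fd, of Vb] null fd_rep_map[OF fd, of a, unfolded a] lin0[OF fd] _
        between_comp[OF hb(1) fd_rep_map[OF A, of a, unfolded a]] lin0[OF A]])
    fix x assume "x \<in> rep_space P Vb"
    then show "g (tgt a) (rep_map A a (hb x)) = f (tgt a) (rep_map P a x)"
      using hom_commD[OF g(1), of "hb x" a] hom_commD[OF f, of x a] hb(2) linear_betweenD(1)[OF hb(1)] a
      by simp
  qed (use inj g0 in auto)
  obtain hp where hp: "linear_between ?p (rep_space P Vplus) ?a (rep_space A Vplus) hp"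
    "\<And>x. x \<in> rep_space P Vplus \<Longrightarrow> g Vplus (hp x) = f Vplus x"
    "\<And>x. x \<in> rep_space P Vb \<Longrightarrow> hp (rep_map P b_plus x) = rep_map A b_plus (hb x)"
    using mid[of b_plus] inj(1) by auto
  obtain hm where hm: "linear_between ?p (rep_space P Vminus) ?a (rep_space A Vminus) hm"
    "\<And>x. x \<in> rep_space P Vminus \<Longrightarrow> g Vminus (hm x) = f Vminus x"
    "\<And>x. x \<in> rep_space P Vb \<Longrightarrow> hm (rep_map P b_minus x) = rep_map A b_minus (hb x)"
    using mid[of b_minus] inj(2) by auto
  \<comment> \<open>Two arrows end at \<open>Ve\<close>, so the lift is prescribed on both
    images.\<close>
  obtain he where he: "linear_between ?p (rep_space P Ve) ?a (rep_space A Ve) he"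
    "\<And>x. x \<in> rep_space P Vplus \<Longrightarrow> he (rep_map P plus_e x) = rep_map A plus_e (hp x)"
    "\<And>y. y \<in> rep_space P Vminus \<Longrightarrow> he (rep_map P minus_e y) = rep_map A minus_e (hm y)"
    "\<And>x. x \<in> rep_space P Ve \<Longrightarrow> g Ve (he x) = f Ve x"
  proof (rule lift[OF fd_rep_subspace[OF fd] fd_rep_subspace[OF fd]
        fd_rep_map[OF fd, of plus_e, simplified] fd_rep_map[OF fd, of minus_e, simplified] inj(3)
        between_comp[OF hp(1) fd_rep_map[OF A, of plus_e, simplified]]
        between_comp[OF hm(1) fd_rep_map[OF A, of minus_e, simplified]]])
    show "g Ve (rep_map A plus_e (hp x)) = f Ve (rep_map P plus_e x)" if "x \<in> rep_space P Vplus" for x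
      using that hom_commD[OF g(1), of "hp x" plus_e] hom_commD[OF f, of x plus_e] hp(2)
        linear_betweenD(1)[OF hp(1)] by simp
    show "g Ve (rep_map A minus_e (hm x)) = f Ve (rep_map P minus_e x)" if "x \<in> rep_space P Vminus" for x
      using that hom_commD[OF g(1), of "hm x" minus_e] hom_commD[OF f, of x minus_e] hm(2)
        linear_betweenD(1)[OF hm(1)] by simp
  qed auto
  let ?h = "\<lambda>v. case v of Vb \<Rightarrow> hb | Vplus \<Rightarrow> hp | Vminus \<Rightarrow> hm | Ve \<Rightarrow> he"
  have "?h \<in> hom P A"
    unfolding hom_def
  proof (intro CollectI conjI allI ballI)
    fix v show "linear_between ?p (rep_space P v) ?a (rep_space A v) (?h v)"
      using hb(1) hp(1) hm(1) he(1) by (cases v) simp_all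
  next
    fix a x assume "x \<in> rep_space P (src a)"
    then show "?h (tgt a) (rep_map P a x) = rep_map A a (?h (src a) x)"
      using hp(3) hm(3) he(2,3) by (cases a) simp_all
  qed
  moreover have "g v (?h v x) = f v x" if "x \<in> rep_space P v" for v x
    using that hb(2) hp(2) hm(2) he(4) by (cases v) simp_all
  ultimately show "\<exists>h\<in>hom P A. \<forall>v. \<forall>x\<in>rep_space P v. g v (h v x) = f v x" by blast
qed (fact fd)

section \<open>Standard projective representations\<close>

text \<open>\<open>\<Oplus>\<^sub>v P\<^sub>v\<^bsup>d v\<^esup>\<close>: a sequence is split into five interleaved sequences by the residue
  modulo 5 of the index, one for each of the generators \<open>b\<close> (along \<open>+\<close>), \<open>b\<close> (along \<open>-\<close>),
  \<open>+\<close>, \<open>-\<close>, \<open>e\<close>. At the vertex \<open>b\<close> there is only one copy of \<open>b\<close>, in residue 0.\<close>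

fun summands :: "vertex \<Rightarrow> nat set" where
  "summands Vb = {0}"
| "summands Vplus = {0, 2}"
| "summands Vminus = {1, 3}"
| "summands Ve = {0, 1, 2, 3, 4}"

text \<open>Residues 0 and 1 both belong to \<open>Vb\<close>: the two paths from \<open>Vb\<close>
  to \<open>Ve\<close> are different elements because no relation is imposed, so a generator at
  \<open>Vb\<close> contributes two dimensions at \<open>Ve\<close>.\<close>

definition generator :: "nat \<Rightarrow> vertex" where
  "generator i = (if i \<le> 1 then Vb else if i = 2 then Vplus else if i = 3 then Vminus else Ve)"

definition std_index :: "(vertex \<Rightarrow> nat) \<Rightarrow> vertex \<Rightarrow> nat set" where
  "std_index d v = {k. k mod 5 \<in> summands v \<and> k div 5 < d (generator (k mod 5))}"

text \<open>Every arrow is an inclusion of sequences except \<open>b_minus\<close>: the single copy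
  of the generator at \<open>Vb\<close> sits in residue 0 and must arrive in residue 1, one index
  further.\<close>

definition std_map :: "arrow \<Rightarrow> (nat \<Rightarrow> 'k::field) \<Rightarrow> nat \<Rightarrow> 'k" where
  "std_map a x = (if a = b_minus then (\<lambda>k. if k mod 5 = 1 then x (k - 1) else 0) else x)"

definition std_rep :: "(vertex \<Rightarrow> (nat \<Rightarrow> 'k) set) \<Rightarrow> 'k::field seq_rep" where
  "std_rep U = \<lparr>rep_scale = fscale, rep_space = U, rep_map = std_map\<rparr>"

lemma std_rep_simps [simp]:
  "rep_scale (std_rep U) = fscale" "rep_space (std_rep U) v = U v" "rep_map (std_rep U) a = std_map a"
  by (simp_all add: std_rep_def)

lemma finite_std_index: "finite (std_index d v)"
proof (rule finite_subset)
  let ?N = "\<Sum>i<5. d (generator i)"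
  show "std_index d v \<subseteq> {..<5 * Suc ?N}"
  proof
    fix k assume k: "k \<in> std_index d v"
    have "d (generator (k mod 5)) \<le> ?N" by (rule member_le_sum) auto
    with k have "k div 5 < ?N" by (simp add: std_index_def)
    then show "k \<in> {..<5 * Suc ?N}" by simp
  qed
qed simp

lemma std_map_linear:
  "std_map a (x + y) = std_map a x + std_map a y" "std_map a (fscale c x) = fscale c (std_map a x)"
  by (auto simp: std_map_def fun_eq_iff)

text \<open>\<open>U\<close> is an arbitrary subrepresentation of the cover. The images at
  \<open>Ve\<close> are independent because \<open>Vplus\<close> uses the residues 0 and 2,
  \<open>Vminus\<close> the residues 1 and 3.\<close>

lemma std_rep_projective:
  assumes U: "\<And>v. fs.subspace (U v)" "\<And>v. U v \<subseteq> supported (std_index d v)"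
    and maps: "\<And>a x. x \<in> U (src a) \<Longrightarrow> std_map a x \<in> U (tgt a)"
  shows "projective (std_rep U :: 'k::field seq_rep)"
proof (rule projectiveI)
  show "fd_rep (std_rep U)"
    unfolding std_rep_def using assms finite_std_index
    by (intro fd_rep_supported[of _ "std_index d"] linear_betweenI) (auto simp: std_map_linear)
next
  fix x :: "nat \<Rightarrow> 'k"
  assume x: "x \<in> rep_space (std_rep U) Vb" and 0: "rep_map (std_rep U) b_minus x = 0"
  show "x = 0"
  proof
    fix k
    show "x k = 0 k"
    proof (cases "k mod 5 = 0")
      case True
      \<comment> \<open>The entry of \<open>x\<close> at \<open>k\<close> reappears in its image
        under \<open>b_minus\<close> at \<open>Suc k\<close>.\<close>
      then have "Suc k mod 5 = 1" by presburger
      then show ?thesis using fun_cong[OF 0, of "Suc k"] by (simp add: std_map_def)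
    next
      case False
      then show ?thesis using x U(2)[of Vb] by (auto simp: supported_def std_index_def)
    qed
  qed
next
  fix x y :: "nat \<Rightarrow> 'k"
  assume x: "x \<in> rep_space (std_rep U) Vplus" and y: "y \<in> rep_space (std_rep U) Vminus"
    and 0: "rep_map (std_rep U) plus_e x + rep_map (std_rep U) minus_e y = 0"
  have "x k = 0 \<and> y k = 0" for k
  proof -
    have "x k + y k = 0" using fun_cong[OF 0, of k] by (simp add: std_map_def)
    moreover have "x k = 0 \<or> y k = 0"
    proof (cases "k mod 5 \<in> {0, 2}")
      case True
      then show ?thesis using y U(2)[of Vminus] by (auto simp: supported_def std_index_def)
    next
      case False
      then show ?thesis using x U(2)[of Vplus] by (auto simp: supported_def std_index_def)
    qed
    ultimately show ?thesis by auto
  qed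
  then show "x = 0 \<and> y = 0" by (auto simp: fun_eq_iff)
qed (auto simp: std_map_def)

definition part :: "nat \<Rightarrow> (nat \<Rightarrow> 'k) \<Rightarrow> nat \<Rightarrow> 'k" where
  "part i x = (\<lambda>n. x (5 * n + i))"

lemma part_linear: "part i (x + y) = part i x + part i y" "part i (fscale c x) = fscale c (part i x)"
  by (auto simp: part_def fun_eq_iff)

lemma part_in_kpow:
  "x \<in> supported (std_index d v) \<Longrightarrow> i < 5 \<Longrightarrow> part i x \<in> kpow (d (generator i))"
  by (auto simp: part_def kpow_def supported_def std_index_def)

lemma part_0: "x \<in> supported (std_index d v) \<Longrightarrow> i < 5 \<Longrightarrow> i \<notin> summands v \<Longrightarrow> part i x = 0"
  by (auto simp: part_def fun_eq_iff supported_def std_index_def)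

lemma part_std_map:
  "a \<noteq> b_minus \<Longrightarrow> part i (std_map a x) = part i x"
  "part 1 (std_map b_minus x) = part 0 x"
  "i < 5 \<Longrightarrow> i \<noteq> 1 \<Longrightarrow> part i (std_map b_minus x) = 0"
  by (auto simp: part_def std_map_def fun_eq_iff)

lemma std_map_supported:
  assumes "x \<in> supported (std_index d (src a))"
  shows "std_map a x \<in> supported (std_index d (tgt a))"
proof (cases "a = b_minus")
  case True
  have "x (k - 1) = 0" if "k mod 5 = 1" "k \<notin> std_index d Vminus" for k
  proof -
    have k: "k - 1 = 5 * (k div 5)" using mult_div_mod_eq[of 5 k] that(1) by linarith
    have "(k - 1) mod 5 = 0" "(k - 1) div 5 = k div 5" unfolding k by simp_all
    then show ?thesis using assms that True
      by (auto simp: supported_def std_index_def generator_def)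
  qed
  then show ?thesis using True by (auto simp: supported_def std_map_def)
next
  case False
  then have "std_index d (src a) \<subseteq> std_index d (tgt a)"
    by (cases a) (auto simp: std_index_def)
  then show ?thesis using assms False by (auto simp: supported_def std_map_def)
qed

text \<open>The canonical map from the sum of the \<open>P_v\<close> tensor \<open>M_v\<close> onto
  \<open>M\<close>: a path applied to a generator goes to the same path applied in \<open>M\<close>.
  The value at \<open>Ve\<close> is written through the formulas at \<open>Vplus\<close> and
  \<open>Vminus\<close>, which makes compatibility with the arrows a matter of unfolding.\<close>

fun augmentation :: "(arrow \<Rightarrow> 'k::field mat) \<Rightarrow> vertex \<Rightarrow> (nat \<Rightarrow> 'k) \<Rightarrow> nat \<Rightarrow> 'k" where
  "augmentation M Vb x = part 0 x"
| "augmentation M Vplus x = mat_fun (M b_plus) (part 0 x) + part 2 x"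
| "augmentation M Vminus x = mat_fun (M b_minus) (part 1 x) + part 3 x"
| "augmentation M Ve x =
     mat_fun (M plus_e) (mat_fun (M b_plus) (part 0 x) + part 2 x) +
     mat_fun (M minus_e) (mat_fun (M b_minus) (part 1 x) + part 3 x) + part 4 x"

definition cover :: "(vertex \<Rightarrow> nat) \<Rightarrow> 'k::field seq_rep" where
  "cover d = std_rep (\<lambda>v. supported (std_index d v))"

lemma kpow_plus: "x \<in> kpow n \<Longrightarrow> y \<in> kpow n \<Longrightarrow> x + y \<in> kpow n" for x y :: "nat \<Rightarrow> 'k::field"
  by (auto simp: kpow_def)

lemma augmentation_surj_hom:
  assumes M: "mats d M"
  shows "surj_hom (cover d) (mrep d M) (augmentation M)"
proof -
  note car = matsD[OF M, of b_plus, simplified] matsD[OF M, of b_minus, simplified]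
    matsD[OF M, of plus_e, simplified] matsD[OF M, of minus_e, simplified]
  have g: "generator 0 = Vb" "generator 1 = Vb" "generator (Suc 0) = Vb" "generator 2 = Vplus"
    "generator 3 = Vminus" "generator 4 = Ve"
    by (auto simp: generator_def)
  have mem: "augmentation M v x \<in> kpow (d v)" if "x \<in> supported (std_index d v)" for v x
    using part_in_kpow[OF that, of 0] part_in_kpow[OF that, of 2] part_in_kpow[OF that, of 3]
      part_in_kpow[OF that, of 4] mat_fun_in_kpow car
    by (cases v) (auto intro!: kpow_plus simp: g)
  have plus: "augmentation M v (x + y) = augmentation M v x + augmentation M v y" for v x y
    by (cases v) (auto simp: part_linear mat_fun_plus algebra_simps)
  have scale: "augmentation M v (fscale c x) = fscale c (augmentation M v x)" for v x c
    by (cases v) (auto simp: part_linear mat_fun_scale mat_fun_plus fs.scale_right_distrib)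
  have "augmentation M (tgt a) (std_map a x) = mat_fun (M a) (augmentation M (src a) x)"
    if "x \<in> supported (std_index d (src a))" for a x
    using that part_0[OF that]
    by (cases a) (auto simp: part_std_map part_std_map(2)[unfolded One_nat_def])
  then have hom: "augmentation M \<in> hom (cover d) (mrep d M)"
    using mem plus scale by (auto simp: hom_def cover_def intro!: linear_betweenI)
  have "kpow (d v) \<subseteq> augmentation M v ` supported (std_index d v)" for v
  proof
    fix y :: "nat \<Rightarrow> 'a" assume y: "y \<in> kpow (d v)"
    \<comment> \<open>Put \<open>y\<close> into one block and 0 into the others. The block used
      below is that of the vertex's own generator, on which the augmentation is the
      identity.\<close>
    have surj: "\<exists>x\<in>supported (std_index d v). part i x = y \<and> (\<forall>j<5. j \<noteq> i \<longrightarrow> part j x = 0)"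
      if i: "i < 5" "i \<in> summands v" "generator i = v" for i
    proof (intro bexI conjI)
      let ?x = "\<lambda>k. if k mod 5 = i then y (k div 5) else 0"
      show "?x \<in> supported (std_index d v)"
        using y i by (auto simp: supported_def std_index_def kpow_def)
    qed (use i in \<open>auto simp: part_def fun_eq_iff\<close>)
    show "y \<in> augmentation M v ` supported (std_index d v)"
    proof (cases v)
      case Vb
      then obtain x where "x \<in> supported (std_index d v)" "part 0 x = y" using surj[of 0] by (auto simp: g)
      then show ?thesis using Vb by (intro image_eqI[of _ _ x]) auto
    next
      case Vplus
      then obtain x where "x \<in> supported (std_index d v)" "part 2 x = y" "part 0 x = 0"
        using surj[of 2] by (auto simp: g)
      then show ?thesis using Vplus by (intro image_eqI[of _ _ x]) auto
    next
      case Vminus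
      then obtain x where "x \<in> supported (std_index d v)" "part 3 x = y" "part 1 x = 0"
        using surj[of 3] by (auto simp: g)
      then show ?thesis using Vminus by (intro image_eqI[of _ _ x]) auto
    next
      case Ve
      then obtain x where "x \<in> supported (std_index d v)" "part 4 x = y"
        "part 0 x = 0" "part 1 x = 0" "part 2 x = 0" "part 3 x = 0"
        using surj[of 4] by (auto simp: g)
      then show ?thesis using Ve by (intro image_eqI[of _ _ x]) auto
    qed
  qed
  then have "augmentation M v ` supported (std_index d v) = kpow (d v)" for v using mem by blast
  then show ?thesis using hom by (simp add: surj_hom_def cover_def)
qed

lemma
  assumes M: "mats d M"
  shows augmentation_between:
    "linear_between fscale (supported (std_index d v)) fscale (kpow (d v)) (augmentation M v)"
    and augmentation_comm: "x \<in> supported (std_index d (src a)) \<Longrightarrow>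
      augmentation M (tgt a) (std_map a x) = mat_fun (M a) (augmentation M (src a) x)"
    and augmentation_image: "augmentation M v ` supported (std_index d v) = kpow (d v)"
proof -
  have hom: "augmentation M \<in> hom (cover d) (mrep d M)"
    using augmentation_surj_hom[OF M] by (simp add: surj_hom_def)
  show "linear_between fscale (supported (std_index d v)) fscale (kpow (d v)) (augmentation M v)"
    using hom_betweenD[OF hom, of v] by (simp add: cover_def)
  show "augmentation M (tgt a) (std_map a x) = mat_fun (M a) (augmentation M (src a) x)"
    if "x \<in> supported (std_index d (src a))"
    using hom_commD[OF hom] that by (simp add: cover_def)
  show "augmentation M v ` supported (std_index d v) = kpow (d v)"
    using augmentation_surj_hom[OF M] by (simp add: surj_hom_def cover_def)
qed

definition syzygy :: "(vertex \<Rightarrow> nat) \<Rightarrow> (arrow \<Rightarrow> 'k::field mat) \<Rightarrow> vertex \<Rightarrow> (nat \<Rightarrow> 'k) set" where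
  "syzygy d M v = {x \<in> supported (std_index d v). augmentation M v x = 0}"

lemma subspace_syzygy:
  assumes M: "mats d M" shows "fs.subspace (syzygy d M v)"
proof -
  note lin = augmentation_between[OF M, of v]
  have "augmentation M v 0 = 0"
    using linear_between_zero[OF lin fs.subspace_0[OF subspace_supported]] .
  then show ?thesis
    unfolding fs.subspace_def syzygy_def
    using linear_betweenD(2,3)[OF lin] subspace_supported[of "std_index d v", unfolded fs.subspace_def] by auto
qed

text \<open>The complex stops in degree 1 because the syzygy is a subrepresentation of the cover and
  hence already projective. Keeping it as a subspace lets the differential be the inclusion.\<close>

definition std_complex :: "(vertex \<Rightarrow> nat) \<Rightarrow> (arrow \<Rightarrow> 'k::field mat) \<Rightarrow> nat \<Rightarrow> 'k seq_rep" where
  "std_complex d M n = (if n = 0 then cover d else if n = 1 then std_rep (syzygy d M) else std_rep (\<lambda>_. {0}))"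

definition std_diff :: "nat \<Rightarrow> vertex \<Rightarrow> (nat \<Rightarrow> 'k::field) \<Rightarrow> nat \<Rightarrow> 'k" where
  "std_diff n v x = (if n = 0 then x else 0)"

lemma standard_resolution:
  fixes M :: "arrow \<Rightarrow> 'k::field mat"
  assumes M: "mats d M"
  shows "projective_resolution (mrep d M) (std_complex d M) std_diff (augmentation M)"
proof -
  have zero: "std_map a 0 = (0 :: nat \<Rightarrow> 'k)" for a
    using std_map_linear(2)[of a 0 0] by simp
  have K0: "0 \<in> syzygy d M v" for v using fs.subspace_0[OF subspace_syzygy[OF M]] .
  have mapK: "std_map a x \<in> syzygy d M (tgt a)" if "x \<in> syzygy d M (src a)" for a x
    using that augmentation_comm[OF M] std_map_supported by (auto simp: syzygy_def)
  have "projective (cover d :: 'k seq_rep)"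
    unfolding cover_def by (rule std_rep_projective) (auto simp: subspace_supported std_map_supported)
  moreover have "projective (std_rep (syzygy d M))"
    by (rule std_rep_projective[OF subspace_syzygy[OF M] _ mapK]) (auto simp: syzygy_def)
  moreover have "projective (std_rep (\<lambda>_. {0}) :: 'k seq_rep)"
    by (rule std_rep_projective) (auto simp: zero supported_def)
  ultimately have proj: "projective (std_complex d M n)" for n
    by (simp add: std_complex_def)
  have "(\<lambda>v x. x) \<in> hom (std_rep (syzygy d M)) (cover d)"
    by (auto simp: hom_def linear_between_def cover_def syzygy_def)
  moreover have "(\<lambda>v x. 0) \<in> hom (std_rep (\<lambda>_. {0})) (std_rep U)" if "\<And>v. (0 :: nat \<Rightarrow> 'k) \<in> U v" for U
    using that zero by (auto simp: hom_def linear_between_def)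
  ultimately have homs: "std_diff n \<in> hom (std_complex d M (Suc n)) (std_complex d M n)" for n
    using K0 by (simp add: std_complex_def std_diff_def[abs_def])
  show ?thesis
    unfolding projective_resolution_def
  proof (intro conjI allI)
    show "surj_hom (std_complex d M 0) (mrep d M) (augmentation M)"
      using augmentation_surj_hom[OF M] by (simp add: std_complex_def)
  qed (use proj homs K0 in \<open>auto simp: std_complex_def std_diff_def cover_def syzygy_def\<close>)
qed

section \<open>Rigidity and the vanishing of Ext\<close>

lemma seq_pair: "fs.subspace V \<Longrightarrow> fs.subspace W \<Longrightarrow> subspace_pair fscale fscale V W"
  by (simp add: subspace_pair_def subspace_pair_axioms_def vector_space_pair_def fs.vector_space_axioms)

text \<open>A degree-1 cocycle is a morphism from the syzygy. It is extended to the cover vertex by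
  vertex, without regard to the arrows; rigidity then supplies the correction that makes the
  extension a morphism without changing it on the syzygy.\<close>

lemma rigid_imp_Ext_zero:
  fixes M :: "arrow \<Rightarrow> 'k::field mat"
  assumes M: "mats d M" and R: "rigid d M"
  shows "Ext_zero (Suc i) (mrep d M) (mrep d M)"
proof -
  let ?Y = "mrep d M" and ?S = "\<lambda>v. supported (std_index d v) :: (nat \<Rightarrow> 'k) set"
  let ?p = "augmentation M" and ?K = "syzygy d M"
  note lin = augmentation_between[OF M] and comm = augmentation_comm[OF M] and surj = augmentation_image[OF M]
  have smap: "std_map a x \<in> ?S (tgt a)" if "x \<in> ?S (src a)" for a x
    using std_map_supported that .
  have sdiff: "x - y \<in> kpow n" if "x \<in> kpow n" "y \<in> kpow n" for n and x y :: "nat \<Rightarrow> 'k"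
    using fs.subspace_diff[OF subspace_kpow that] .
  have Mk: "mat_fun (M a) x \<in> kpow (d (tgt a))" for a x using mat_fun_in_kpow[OF matsD[OF M]] .
  note SY = seq_pair[OF subspace_supported subspace_kpow]
  note subK = subspace_syzygy[OF M]
  have one: "coboundary (std_complex d M) std_diff ?Y (Suc 0) f" if f: "cocycle (std_complex d M) std_diff ?Y (Suc 0) f" for f
  proof -
    have fhom: "f \<in> hom (std_rep ?K) ?Y" using f by (simp add: cocycle_def std_complex_def)
    have "\<exists>g. linear_between fscale (?S v) fscale (kpow (d v)) g \<and> (\<forall>x\<in>?K v. g x = f v x)" for v
    proof -
      have "linear_between fscale (?K v) fscale (kpow (d v)) (f v)"
        using hom_betweenD[OF fhom, of v] by simp
      then obtain g where g: "Vector_Spaces.linear fscale fscale g" "\<And>x. x \<in> ?K v \<Longrightarrow> g x = f v x"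
        "\<And>x. g x \<in> kpow (d v)"
        using subspace_pair.between_extend[OF seq_pair[OF subK subspace_kpow]] by metis
      interpret g: Vector_Spaces.linear fscale fscale g by fact
      show ?thesis using g(2,3)
        by (intro exI[of _ g] conjI linear_betweenI) (auto simp: g.add g.scale)
    qed
    then obtain f' where f': "\<And>v. linear_between fscale (?S v) fscale (kpow (d v)) (f' v)"
      "\<And>v x. x \<in> ?K v \<Longrightarrow> f' v x = f v x" by metis
    \<comment> \<open>The failure of \<open>f'\<close> to commute with \<open>a\<close> vanishes on
      the syzygy, where \<open>f'\<close> is the morphism \<open>f\<close>. As the syzygy is the
      kernel of the augmentation, the failure factors through it as a matrix.\<close>
    have "\<exists>G\<in>carrier_mat (d (tgt a)) (d (src a)). \<forall>x\<in>?S (src a).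
        mat_fun G (?p (src a) x) = f' (tgt a) (std_map a x) - mat_fun (M a) (f' (src a) x)" for a
    proof -
      let ?u = "\<lambda>x. f' (tgt a) (std_map a x) - mat_fun (M a) (f' (src a) x)"
      have "linear_between fscale (?S (src a)) fscale (kpow (d (tgt a))) ?u"
        using linear_betweenD[OF f'(1)] smap Mk sdiff
        by (intro linear_betweenI)
          (auto simp: std_map_linear mat_fun_plus mat_fun_scale fs.scale_right_diff_distrib)
      moreover have "?u x = 0" if "x \<in> ?S (src a)" "?p (src a) x = 0" for x
      proof -
        have x: "x \<in> ?K (src a)" and "std_map a x \<in> ?K (tgt a)"
          using that comm[OF that(1)] std_map_supported[OF that(1)] by (auto simp: syzygy_def)
        then show ?thesis using f'(2) hom_commD[OF fhom, of x a] by simp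
      qed
      ultimately obtain g where g: "linear_between fscale (kpow (d (src a))) fscale (kpow (d (tgt a))) g"
        "\<And>x. x \<in> ?S (src a) \<Longrightarrow> g (?p (src a) x) = ?u x"
        using between_factor[OF SY SY lin surj] by (metis (no_types, lifting) seq_pair subspace_kpow subspace_supported)
      obtain G where G: "G \<in> carrier_mat (d (tgt a)) (d (src a))"
        "\<And>x. x \<in> kpow (d (src a)) \<Longrightarrow> g x = mat_fun G x"
        using between_kpow_mat[OF g(1)] by metis
      show ?thesis using G g(2) linear_betweenD(1)[OF lin] by (metis (no_types, lifting))
    qed
    then obtain G where G: "\<And>a. G a \<in> carrier_mat (d (tgt a)) (d (src a))"
      "\<And>a x. x \<in> ?S (src a) \<Longrightarrow>
        mat_fun (G a) (?p (src a) x) = f' (tgt a) (std_map a x) - mat_fun (M a) (f' (src a) x)"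
      by metis
    obtain H where H: "\<And>v. H v \<in> carrier_mat (d v) (d v)"
      "\<And>a. H (tgt a) * M a = M a * H (src a) + G a"
      using R G(1) unfolding rigid_def mats_def by metis
    \<comment> \<open>The correction passes through the augmentation and so vanishes on the syzygy;
      the equation for \<open>H\<close> is precisely what cancels \<open>G\<close>.\<close>
    define h where "h v x = f' v x - mat_fun (H v) (?p v x)" for v x
    have "h \<in> hom (cover d) ?Y"
      unfolding hom_def
    proof (intro CollectI conjI allI ballI)
      show "linear_between (rep_scale (cover d)) (rep_space (cover d) v) (rep_scale ?Y) (rep_space ?Y v) (h v)" for v
        using linear_betweenD[OF f'(1)] linear_betweenD[OF lin] mat_fun_in_kpow[OF H(1)] sdiff
        by (intro linear_betweenI)
          (auto simp: cover_def h_def mat_fun_plus mat_fun_scale fs.scale_right_diff_distrib)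
    next
      fix a and x :: "nat \<Rightarrow> 'k" assume "x \<in> rep_space (cover d) (src a)"
      then have x: "x \<in> ?S (src a)" by (simp add: cover_def)
      have y: "mat_fun (H (tgt a)) (mat_fun (M a) y) = mat_fun (M a) (mat_fun (H (src a)) y) + mat_fun (G a) y" for y
        using arg_cong[OF H(2), of "\<lambda>A. mat_fun A y"] mat_fun_mult[OF H(1) matsD[OF M]]
          mat_fun_mult[OF matsD[OF M] H(1)]
          mat_fun_add[OF mult_carrier_mat[OF matsD[OF M] H(1)] G(1)] by metis
      show "h (tgt a) (rep_map (cover d) a x) = rep_map ?Y a (h (src a) x)"
        using G(2)[OF x] y[of "?p (src a) x"] comm[OF x] by (simp add: h_def cover_def mat_fun_minus algebra_simps)
    qed
    moreover have "f v x = h v x" if "x \<in> ?K v" for v x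
      using that f'(2) by (simp add: h_def syzygy_def)
    ultimately show ?thesis by (auto simp: std_complex_def std_diff_def)
  qed
  have "coboundary (std_complex d M) std_diff ?Y (Suc i) f" if f: "cocycle (std_complex d M) std_diff ?Y (Suc i) f" for f
  proof (cases i)
    case 0 then show ?thesis using one f by simp
  next
    case (Suc j)
    then have fhom: "f \<in> hom (std_rep (\<lambda>_. {0})) ?Y" using f by (simp add: cocycle_def std_complex_def)
    have "f v 0 = 0" for v
      using linear_betweenD(3)[OF hom_betweenD[OF fhom], of 0 v 0] by simp
    \<comment> \<open>From degree 2 on the source is the zero representation, so the zero morphism
      bounds every cocycle.\<close>
    moreover have "(\<lambda>_ _. 0) \<in> hom (std_complex d M i) ?Y"
      by (auto simp: hom_def linear_between_def kpow_def)
    ultimately show ?thesis using Suc by (auto simp: std_complex_def intro!: bexI[of _ "\<lambda>_ _. 0"])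
  qed
  then show ?thesis using standard_resolution[OF M] unfolding Ext_zero_def by blast
qed

text \<open>Lifting the cover to the extension of \<open>M\<close> by itself given by \<open>G\<close> yields a
  1-cocycle; writing it as a coboundary splits the extension, which is what solving for \<open>H\<close> means.\<close>

lemma Ext_zero_imp_rigid:
  fixes M :: "arrow \<Rightarrow> 'k::field mat"
  assumes M: "mats d M" and E: "Ext_zero 1 (mrep d M) (mrep d M)"
  shows "rigid d M"
  unfolding rigid_def
proof (intro allI impI)
  fix G :: "arrow \<Rightarrow> 'k mat" assume G: "mats d G"
  let ?Y = "mrep d M"
  obtain P D p where res: "projective_resolution ?Y P D p"
    and ex: "\<And>f. cocycle P D ?Y 1 f \<Longrightarrow> coboundary P D ?Y 1 f"
    using E by (auto simp: Ext_zero_def)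
  have proj: "projective (P n)" and Dhom: "D n \<in> hom (P (Suc n)) (P n)" for n
    using res by (simp_all add: projective_resolution_def)
  have p: "p \<in> hom (P 0) ?Y" "\<And>v. p v ` rep_space (P 0) v = kpow (d v)"
    using res by (auto simp: projective_resolution_def surj_hom_def)
  have D0: "D 0 v ` rep_space (P 1) v = {x \<in> rep_space (P 0) v. p v x = 0}"
    and D1: "D 1 v ` rep_space (P 2) v = {x \<in> rep_space (P 1) v. D 0 v x = 0}" for v
    using res by (simp_all add: projective_resolution_def numeral_2_eq_2)
  \<comment> \<open>Diagonal blocks \<open>M a\<close> and corner \<open>G a\<close>: the first half
    of the coordinates, read by \<open>q\<close>, is the subrepresentation, the second half, read by
    \<open>r\<close>, the quotient. Here \<open>r\<close> is a morphism, while \<open>q\<close>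
    fails to be one by the term with \<open>G\<close>.\<close>
  define N where "N a = four_block_mat (M a) (G a) (0\<^sub>m (d (tgt a)) (d (src a))) (M a)" for a
  define q where "q v x = (\<lambda>i. if i < d v then x i else 0)" for v and x :: "nat \<Rightarrow> 'k"
  define r where "r v x = (\<lambda>i. if i < d v then x (i + d v) else 0)" for v and x :: "nat \<Rightarrow> 'k"
  let ?Z = "mrep (\<lambda>v. d v + d v) N"
  have N: "mats (\<lambda>v. d v + d v) N"
    using matsD[OF M] by (auto simp: mats_def N_def)
  have qlin: "q v (x + y) = q v x + q v y" "q v (fscale c x) = fscale c (q v x)" "q v x \<in> kpow (d v)" for v x y c
    by (auto simp: q_def fun_eq_iff kpow_def)
  have rlin: "r v (x + y) = r v x + r v y" "r v (fscale c x) = fscale c (r v x)" "r v x \<in> kpow (d v)" for v x y c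
    by (auto simp: r_def fun_eq_iff kpow_def)
  have split: "(\<Sum>j<m + n. f j) = (\<Sum>j<m. f j) + (\<Sum>j<n. f (j + m))" for f :: "nat \<Rightarrow> 'k" and m n
    by (induction n) (auto simp: algebra_simps)
  have Nq: "q (tgt a) (mat_fun (N a) x) = mat_fun (M a) (q (src a) x) + mat_fun (G a) (r (src a) x)" for a x
    using carrier_matD[OF matsD[OF M, of a]] carrier_matD[OF matsD[OF G, of a]]
    by (auto simp: fun_eq_iff q_def r_def mat_fun_def N_def split intro!: arg_cong2[of _ _ _ _ "(+)"] sum.cong)
  have Nr: "r (tgt a) (mat_fun (N a) x) = mat_fun (M a) (r (src a) x)" for a x
    using carrier_matD[OF matsD[OF M, of a]] carrier_matD[OF matsD[OF G, of a]]
    by (auto simp: fun_eq_iff q_def r_def mat_fun_def N_def split intro!: sum.cong)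
  have "r \<in> hom ?Z ?Y" using Nr rlin by (auto simp: hom_def intro!: linear_betweenI)
  moreover have "r v ` kpow (d v + d v) = kpow (d v)" for v
  proof
    show "kpow (d v) \<subseteq> r v ` kpow (d v + d v)"
    proof
      fix y :: "nat \<Rightarrow> 'k" assume y: "y \<in> kpow (d v)"
      let ?x = "\<lambda>i. if i < d v then 0 else y (i - d v)"
      have x: "?x \<in> kpow (d v + d v)" and "r v ?x = y" using y by (auto simp: kpow_def r_def fun_eq_iff)
      then show "y \<in> r v ` kpow (d v + d v)" using imageI[OF x, of "r v"] by (simp only:)
    qed
  qed (use rlin in auto)
  ultimately have "surj_hom ?Z ?Y r" by (simp add: surj_hom_def)
  then obtain h where h: "h \<in> hom (P 0) ?Z" "\<And>v x. x \<in> rep_space (P 0) v \<Longrightarrow> r v (h v x) = p v x"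
    using proj[of 0] fd_mrep[OF N] fd_mrep[OF M] p(1) unfolding projective_def by blast
  have fdP: "fd_rep (P n)" for n using proj[of n] by (simp add: projective_def)
  have map0: "rep_map (P 0) a x \<in> rep_space (P 0) (tgt a)" if "x \<in> rep_space (P 0) (src a)" for a x
    using fd_rep_map_mem[OF fdP that] .
  have D0P: "D 0 v x \<in> rep_space (P 0) v" "p v (D 0 v x) = 0" if "x \<in> rep_space (P 1) v" for v x
    using D0[of v] that by auto
  \<comment> \<open>On the image of \<open>D 0\<close> the augmentation vanishes, so
    \<open>r\<close> after \<open>h\<close> is 0 there and the term with \<open>G\<close> drops out:
    \<open>q\<close> after \<open>h\<close> does commute with the arrows.\<close>
  define f where "f v x = q v (h v (D 0 v x))" for v x
  note hl = linear_betweenD[OF hom_betweenD[OF h(1)], simplified]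
  note Dl = linear_betweenD[OF hom_betweenD[OF Dhom]]
  have hz: "h v 0 = 0" for v
  proof -
    interpret vector_space "rep_scale (P 0)" by (fact fd_rep_vector_space[OF fdP])
    have 0: "0 \<in> rep_space (P 0) v" using subspace_0[OF fd_rep_subspace[OF fdP]] .
    show ?thesis using hl(2)[OF 0 0] by simp
  qed
  have "f \<in> hom (P 1) ?Y"
    unfolding hom_def
  proof (intro CollectI conjI allI ballI)
    show "linear_between (rep_scale (P 1)) (rep_space (P 1) v) (rep_scale ?Y) (rep_space ?Y v) (f v)" for v
      using Dl[of _ 0] hl by (intro linear_betweenI) (simp_all add: f_def qlin)
  next
    fix a x assume x: "x \<in> rep_space (P 1) (src a)"
    have "f (tgt a) (rep_map (P 1) a x) = q (tgt a) (h (tgt a) (rep_map (P 0) a (D 0 (src a) x)))"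
      using hom_commD[OF Dhom[of 0], of x a] x by (simp add: f_def)
    also have "\<dots> = q (tgt a) (mat_fun (N a) (h (src a) (D 0 (src a) x)))"
      using hom_commD[OF h(1) D0P(1)[OF x]] by simp
    also have "\<dots> = mat_fun (M a) (f (src a) x)"
      using h(2)[OF D0P(1)[OF x]] D0P(2)[OF x] by (simp add: Nq f_def)
    finally show "f (tgt a) (rep_map (P 1) a x) = rep_map ?Y a (f (src a) x)" by simp
  qed
  moreover have "f v (D 1 v x) = 0" if "x \<in> rep_space (P 2) v" for v x
  proof -
    have "D 0 v (D 1 v x) = 0" using D1[of v] that by auto
    then show ?thesis by (simp add: f_def hz) (auto simp: q_def fun_eq_iff)
  qed
  ultimately have "cocycle P D ?Y 1 f" by (simp add: cocycle_def numeral_2_eq_2)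
  from ex[OF this] obtain g where g: "g \<in> hom (P 0) ?Y"
    "\<And>v x. x \<in> rep_space (P 1) v \<Longrightarrow> f v x = g v (D 0 v x)" by auto
  note gl = linear_betweenD[OF hom_betweenD[OF g(1)], simplified]
  \<comment> \<open>On the kernel of \<open>p\<close> the morphism \<open>g\<close> agrees with
    \<open>q\<close> after \<open>h\<close>, so \<open>u\<close> factors through \<open>p\<close>.
    Its failure to commute with \<open>a\<close> is \<open>G a\<close> applied to \<open>r\<close>
    after \<open>h\<close>, that is, to \<open>p\<close>; hence the factor \<open>H\<close> solves
    the equation.\<close>
  define u where "u v x = q v (h v x) - g v x" for v x
  have SPair: "subspace_pair (rep_scale (P 0)) fscale (rep_space (P 0) v) (kpow (d v))" for v
    using fd_rep_vector_space[OF fdP] fd_rep_subspace[OF fdP]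
    by (simp add: subspace_pair_def subspace_pair_axioms_def vector_space_pair_def
        fs.vector_space_axioms subspace_kpow)
  have sdiff: "x - y \<in> kpow n" if "x \<in> kpow n" "y \<in> kpow n" for n and x y :: "nat \<Rightarrow> 'k"
    using fs.subspace_diff[OF subspace_kpow that] .
  have "\<exists>H\<in>carrier_mat (d v) (d v). \<forall>x\<in>rep_space (P 0) v. mat_fun H (p v x) = u v x" for v
  proof -
    have "linear_between (rep_scale (P 0)) (rep_space (P 0) v) fscale (kpow (d v)) (p v)"
      using hom_betweenD[OF p(1), of v] by simp
    moreover have "linear_between (rep_scale (P 0)) (rep_space (P 0) v) fscale (kpow (d v)) (u v)"
      using hl gl sdiff qlin
      by (intro linear_betweenI) (simp_all add: u_def fs.scale_right_diff_distrib)
    moreover have "u v x = 0" if x: "x \<in> rep_space (P 0) v" "p v x = 0" for x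
    proof -
      obtain y where y: "y \<in> rep_space (P 1) v" "x = D 0 v y" using D0[of v] x by auto
      then show ?thesis using g(2)[OF y(1)] by (simp add: u_def f_def)
    qed
    ultimately obtain k where k: "linear_between fscale (kpow (d v)) fscale (kpow (d v)) k"
      "\<And>x. x \<in> rep_space (P 0) v \<Longrightarrow> k (p v x) = u v x"
      using between_factor[OF SPair SPair _ p(2)] by metis
    obtain H where "H \<in> carrier_mat (d v) (d v)" "\<And>x. x \<in> kpow (d v) \<Longrightarrow> k x = mat_fun H x"
      using between_kpow_mat[OF k(1)] by metis
    then show ?thesis using k(2) p(2) by (metis imageI)
  qed
  then obtain H where H: "\<And>v. H v \<in> carrier_mat (d v) (d v)"
    "\<And>v x. x \<in> rep_space (P 0) v \<Longrightarrow> mat_fun (H v) (p v x) = u v x" by metis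
  have "H (tgt a) * M a = M a * H (src a) + G a" for a
  proof (rule mat_fun_eqI)
    show HM: "H (tgt a) * M a \<in> carrier_mat (d (tgt a)) (d (src a))"
      by (rule mult_carrier_mat[OF H(1) matsD[OF M]])
    show "M a * H (src a) + G a \<in> carrier_mat (d (tgt a)) (d (src a))"
      using mult_carrier_mat[OF matsD[OF M] H(1)] matsD[OF G, of a] by simp
    fix y :: "nat \<Rightarrow> 'k" assume "y \<in> kpow (d (src a))"
    then obtain x where x: "x \<in> rep_space (P 0) (src a)" "y = p (src a) x" using p(2) by blast
    have "mat_fun (H (tgt a)) (mat_fun (M a) y) = mat_fun (H (tgt a)) (p (tgt a) (rep_map (P 0) a x))"
      using hom_commD[OF p(1) x(1)] x(2) by simp
    also have "\<dots> = u (tgt a) (rep_map (P 0) a x)" using H(2) map0[OF x(1)] .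
    also have "\<dots> = mat_fun (M a) (u (src a) x) + mat_fun (G a) y"
      using hom_commD[OF h(1) x(1)] hom_commD[OF g(1) x(1)] h(2)[OF x(1)] x(2)
      by (simp add: u_def Nq mat_fun_minus)
    also have "u (src a) x = mat_fun (H (src a)) y" using H(2)[OF x(1)] x(2) by simp
    finally show "mat_fun (H (tgt a) * M a) y = mat_fun (M a * H (src a) + G a) y"
      using mat_fun_mult[OF H(1) matsD[OF M]] mat_fun_mult[OF matsD[OF M] H(1)]
        mat_fun_add[OF mult_carrier_mat[OF matsD[OF M] H(1)] matsD[OF G]] by (simp only:)
  qed
  then show "\<exists>H. (\<forall>v. H v \<in> carrier_mat (d v) (d v)) \<and>
      (\<forall>a. H (tgt a) * M a = M a * H (src a) + G a)" using H(1) by blast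
qed

lemma exceptional_mrep_iff:
  assumes M: "mats d M" shows "exceptional (mrep d M) \<longleftrightarrow> brick d M \<and> rigid d M"
proof -
  have "(\<forall>i. i \<noteq> 0 \<longrightarrow> Ext_zero i (mrep d M) (mrep d M)) \<longleftrightarrow> rigid d M"
    using Ext_zero_imp_rigid[OF M] rigid_imp_Ext_zero[OF M] by (metis not0_implies_Suc zero_neq_one)
  then show ?thesis
    using endo_mrep_iff_brick[OF M] fd_mrep[OF M] unfolding exceptional_def by blast
qed

section \<open>Dimension counting\<close>

text \<open>Rank-nullity is used in two forms: more unknowns than equations yield a kernel vector,
  and if the kernel is a line, surjectivity is an equation between cardinalities.\<close>

locale coordinate_map =
  fixes I :: "'i set" and J :: "'j set" and T :: "('i \<Rightarrow> 'k::field) \<Rightarrow> ('j \<Rightarrow> 'k)"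
  assumes finI: "finite I" and finJ: "finite J"
    and T_add: "\<And>x y. T (x + y) = T x + T y" and T_scale: "\<And>c x. T (fscale c x) = fscale c (T x)"
    and T_mem: "\<And>x. x \<in> supported I \<Longrightarrow> T x \<in> supported J"
begin

lemma T_0: "T 0 = 0"
  using T_scale[of 0 0] by simp

lemma T_diff: "T (x - y) = T x - T y"
  using T_add[of "x - y" y] by (simp add: algebra_simps)

lemma T_sum: "T (\<Sum>a\<in>A. f a) = (\<Sum>a\<in>A. T (f a))"
proof (cases "finite A")
  case True
  then show ?thesis
  proof (induction A rule: finite_induct)
    case (insert x F)
    have "T (\<Sum>a\<in>insert x F. f a) = T (f x) + T (\<Sum>a\<in>F. f a)"
      using insert.hyps by (simp add: T_add)
    also have "\<dots> = (\<Sum>a\<in>insert x F. T (f a))"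
      unfolding insert.IH using insert.hyps by simp
    finally show ?case .
  qed (simp only: sum.empty T_0)
qed (simp add: T_0)

lemma image_independent:
  assumes B: "finite B" "fs.independent B"
    and ker: "\<And>x. x \<in> fs.span B \<Longrightarrow> T x = 0 \<Longrightarrow> x = 0"
  shows "fs.independent (T ` B)" "inj_on T B"
proof -
  show inj: "inj_on T B"
  proof (rule inj_onI)
    fix x y assume "x \<in> B" "y \<in> B" "T x = T y"
    then have "x - y = 0" by (intro ker) (auto simp: T_diff intro: fs.span_diff fs.span_base)
    then show "x = y" by simp
  qed
  show "fs.independent (T ` B)"
  proof
    assume "fs.dependent (T ` B)"
    then obtain u where u: "\<exists>v\<in>T ` B. u v \<noteq> 0" "(\<Sum>v\<in>T ` B. fscale (u v) v) = 0"
      using fs.dependent_finite[of "T ` B"] B(1) by auto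
    have "T (\<Sum>b\<in>B. fscale (u (T b)) b) = (\<Sum>v\<in>T ` B. fscale (u v) v)"
      using inj by (simp add: T_sum T_scale sum.reindex)
    moreover have "(\<Sum>b\<in>B. fscale (u (T b)) b) \<in> fs.span B"
      by (intro fs.span_sum fs.span_scale fs.span_base)
    ultimately have z: "(\<Sum>b\<in>B. fscale (u (T b)) b) = 0" using u(2) ker by metis
    have "u (T b) = 0" if "b \<in> B" for b
      by (rule fs.independentD[OF B(2,1) subset_refl z that])
    then show False using u(1) by blast
  qed
qed

lemma kernel_nonzero:
  assumes "card J < card I"
  obtains x where "x \<in> supported I" "x \<noteq> 0" "T x = 0"
proof (rule ccontr)
  let ?B = "unit_at ` I :: ('i \<Rightarrow> 'k) set"
  assume "\<not> thesis"
  then have ker: "x = 0" if "x \<in> fs.span ?B" "T x = 0" for x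
    using that \<open>\<And>x. \<lbrakk>x \<in> supported I; x \<noteq> 0; T x = 0\<rbrakk> \<Longrightarrow> thesis\<close> span_unit_at[OF finI] by auto
  have fin: "finite ?B" using finI by simp
  note ind = image_independent[OF fin independent_unit_at ker]
  have "T ` ?B \<subseteq> fs.span (unit_at ` J)"
    using T_mem span_unit_at[OF finJ] span_unit_at[OF finI] fs.span_base by blast
  then have "card (T ` ?B) \<le> card (unit_at ` J :: ('j \<Rightarrow> 'k) set)"
    using fs.independent_span_bound[OF _ ind(1)] finJ by simp
  moreover have "card ?B = card I" "card (unit_at ` J :: ('j \<Rightarrow> 'k) set) = card J"
    by (rule card_image[OF inj_on_subset[OF inj_unit_at subset_UNIV]])+
  ultimately show False using assms card_image[OF ind(2)] by linarith
qed

text \<open>Extend \<open>u\<close> to a basis. A kernel vector in the span of the other basis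
  vectors is a multiple of \<open>u\<close>, hence 0; so these \<open>card I - 1\<close> vectors
  have independent images, and the images span the range.\<close>

lemma kernel_line_surj_iff:
  assumes u: "u \<in> supported I" "u \<noteq> 0" "T u = 0"
    and ker: "\<And>x. x \<in> supported I \<Longrightarrow> T x = 0 \<Longrightarrow> \<exists>c. x = fscale c u"
  shows "T ` supported I = supported J \<longleftrightarrow> card I = Suc (card J)"
proof -
  let ?V = "supported I :: ('i \<Rightarrow> 'k) set" and ?W = "supported J :: ('j \<Rightarrow> 'k) set"
  have "fs.independent {u}" using u(2) by simp
  then obtain B where B: "{u} \<subseteq> B" "B \<subseteq> ?V" "fs.independent B" "?V \<subseteq> fs.span B"
    using fs.maximal_independent_subset_extend[of "{u}" ?V] u(1) by auto
  have finB: "finite B"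
    using fs.independent_span_bound[of "unit_at ` I" B] B(2,3) finI span_unit_at[OF finI] by auto
  have spanB: "fs.span B = ?V" using B(2,4) fs.span_minimal[OF _ subspace_supported] by blast
  have cardB: "card B = card I"
    using dim_supported[OF finI] fs.dim_span_eq_card_independent[OF B(3)] spanB by metis
  let ?C = "B - {u}"
  have finC: "finite ?C" and indC: "fs.independent ?C"
    using finB fs.independent_mono[OF B(3), of ?C] by auto
  have "x = 0" if x: "x \<in> fs.span ?C" "T x = 0" for x
  proof -
    have "x \<in> ?V" using x(1) spanB fs.span_mono[of ?C B] by blast
    then obtain c where c: "x = fscale c u" using ker x(2) by blast
    have "c = 0"
    proof (rule ccontr)
      assume "c \<noteq> 0"
      then have "u = fscale (inverse c) x" using c by simp
      then have "u \<in> fs.span ?C" using x(1) fs.span_scale by blast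
      then show False using B(1,3) fs.dependent_def by blast
    qed
    then show ?thesis using c by simp
  qed
  note ind = image_independent[OF finC indC this]
  have cardTC: "card (T ` ?C) = card I - 1" and pos: "card I \<ge> 1"
    using card_image[OF ind(2)] B(1) finB cardB finI by (auto simp: card_gt_0_iff Suc_le_eq)
  have TV: "T ` ?V = fs.span (T ` ?C)"
  proof
    show "T ` ?V \<subseteq> fs.span (T ` ?C)"
    proof
      fix y assume "y \<in> T ` ?V"
      then obtain x where x: "x \<in> fs.span B" "y = T x" using spanB by blast
      obtain c where "x - fscale c u \<in> fs.span ?C"
        using fs.span_breakdown[OF _ x(1), of u] B(1) by blast
      then obtain a where "x - fscale c u = (\<Sum>v\<in>?C. fscale (a v) v)"
        using fs.span_finite[OF finC] by auto
      then have "T (x - fscale c u) = (\<Sum>v\<in>?C. fscale (a v) (T v))" by (simp add: T_sum T_scale)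
      then have "y = (\<Sum>v\<in>?C. fscale (a v) (T v))" using x(2) u(3) by (simp add: T_diff T_scale)
      moreover have "(\<Sum>v\<in>?C. fscale (a v) (T v)) \<in> fs.span (T ` ?C)"
        by (intro fs.span_sum fs.span_scale fs.span_base imageI)
      ultimately show "y \<in> fs.span (T ` ?C)" by simp
    qed
    have "fs.subspace (T ` ?V)"
      by (rule image_subspace[where s = fscale and W = UNIV])
        (auto simp: fs.vector_space_axioms subspace_supported linear_between_def T_add T_scale)
    then show "fs.span (T ` ?C) \<subseteq> T ` ?V"
      using B(2) by (intro fs.span_minimal) auto
  qed
  have sub: "T ` ?C \<subseteq> ?W" using B(2) T_mem by blast
  have fin: "finite (T ` ?C)" using finC by simp
  show ?thesis
  proof
    assume "T ` ?V = ?W"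
    then have "card (T ` ?C) = card J"
      using TV dim_supported[OF finJ] fs.dim_span_eq_card_independent[OF ind(1)] by metis
    then show "card I = Suc (card J)" using cardTC pos by simp
  next
    assume "card I = Suc (card J)"
    then have c: "card (T ` ?C) = card J" using cardTC by simp
    \<comment> \<open>An independent set that already has the size of a basis cannot be
      enlarged.\<close>
    obtain E where E: "T ` ?C \<subseteq> E" "E \<subseteq> ?W" "fs.independent E" "?W \<subseteq> fs.span E"
      using fs.maximal_independent_subset_extend[OF sub ind(1)] by auto
    have finE: "finite E"
      using fs.independent_span_bound[of "unit_at ` J" E] E(2,3) finJ span_unit_at[OF finJ] by auto
    have "fs.span E = ?W" using E(2,4) fs.span_minimal[OF _ subspace_supported] by blast
    then have "card E = card J"
      using dim_supported[OF finJ] fs.dim_span_eq_card_independent[OF E(3)] by metis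
    then have "E = T ` ?C" using c E(1) finE by (metis card_subset_eq)
    then show "T ` ?V = ?W" using TV \<open>fs.span E = ?W\<close> by simp
  qed
qed

end

text \<open>The Euler form is the dimension of the source minus that of the target of the map
  \<open>F \<mapsto> F\<^sub>t\<^sub>(\<^sub>a\<^sub>) M\<^sub>a - M'\<^sub>a F\<^sub>s\<^sub>(\<^sub>a\<^sub>)\<close>, whose kernel is \<open>Hom(M, M')\<close>.\<close>

definition hom_dim :: "(vertex \<Rightarrow> nat) \<Rightarrow> (vertex \<Rightarrow> nat) \<Rightarrow> nat" where
  "hom_dim d d' = d' Vb * d Vb + d' Vplus * d Vplus + d' Vminus * d Vminus + d' Ve * d Ve"

definition arrow_dim :: "(vertex \<Rightarrow> nat) \<Rightarrow> (vertex \<Rightarrow> nat) \<Rightarrow> nat" where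
  "arrow_dim d d' = d' Vplus * d Vb + d' Ve * d Vplus + d' Vminus * d Vb + d' Ve * d Vminus"

text \<open>A tuple of matrices is stored as one function on triples (vertex, row, column), so that
  the linear system for all vertices becomes a single \<open>coordinate_map\<close>.\<close>

definition mat_of_fun :: "(vertex \<Rightarrow> nat) \<Rightarrow> (vertex \<Rightarrow> nat) \<Rightarrow> (vertex \<times> nat \<times> nat \<Rightarrow> 'k) \<Rightarrow> vertex \<Rightarrow> 'k mat" where
  "mat_of_fun d d' x v = mat (d' v) (d v) (\<lambda>(i, j). x (v, i, j))"

definition hom_index :: "(vertex \<Rightarrow> nat) \<Rightarrow> (vertex \<Rightarrow> nat) \<Rightarrow> (vertex \<times> nat \<times> nat) set" where
  "hom_index d d' = (SIGMA v:UNIV. {..<d' v} \<times> {..<d v})"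

definition arrow_index :: "(vertex \<Rightarrow> nat) \<Rightarrow> (vertex \<Rightarrow> nat) \<Rightarrow> (arrow \<times> nat \<times> nat) set" where
  "arrow_index d d' = (SIGMA a:UNIV. {..<d' (tgt a)} \<times> {..<d (src a)})"

definition defect ::
  "(vertex \<Rightarrow> nat) \<Rightarrow> (arrow \<Rightarrow> 'k::field mat) \<Rightarrow> (vertex \<Rightarrow> nat) \<Rightarrow> (arrow \<Rightarrow> 'k mat) \<Rightarrow>
   (vertex \<times> nat \<times> nat \<Rightarrow> 'k) \<Rightarrow> arrow \<times> nat \<times> nat \<Rightarrow> 'k" where
  "defect d M d' M' x = (\<lambda>(a, i, j). if (a, i, j) \<in> arrow_index d d'
     then (mat_of_fun d d' x (tgt a) * M a - M' a * mat_of_fun d d' x (src a)) $$ (i, j) else 0)"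

lemma UNIV_vertex: "(UNIV :: vertex set) = {Vb, Vminus, Vplus, Ve}"
  using vertex.exhaust by auto

lemma UNIV_arrow: "(UNIV :: arrow set) = {b_plus, plus_e, b_minus, minus_e}"
  using arrow.exhaust by auto

lemma finite_hom_index: "finite (hom_index d d')" and card_hom_index: "card (hom_index d d') = hom_dim d d'"
  by (simp_all add: hom_index_def hom_dim_def UNIV_vertex card_SigmaI)

lemma finite_arrow_index: "finite (arrow_index d d')"
  and card_arrow_index: "card (arrow_index d d') = arrow_dim d d'"
  by (simp_all add: arrow_index_def arrow_dim_def UNIV_arrow card_SigmaI)

lemma coordinate_map_defect:
  assumes M: "mats d M" "mats d' M'"
  shows "coordinate_map (hom_index d d') (arrow_index d d') (defect d M d' M')"
proof
  have ent: "defect d M d' M' x (a, i, j) = (if i < d' (tgt a) \<and> j < d (src a) then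
      (\<Sum>l<d (tgt a). x (tgt a, i, l) * M a $$ (l, j)) - (\<Sum>l<d' (src a). M' a $$ (i, l) * x (src a, l, j))
      else 0)" for x a i j
    using matsD[OF M(1), of a] matsD[OF M(2), of a]
    by (auto simp: defect_def arrow_index_def mat_of_fun_def scalar_prod_def atLeast0LessThan)
  show "defect d M d' M' (x + y) = defect d M d' M' x + defect d M d' M' y" for x y
    by (auto simp: fun_eq_iff ent algebra_simps sum.distrib)
  show "defect d M d' M' (fscale c x) = fscale c (defect d M d' M' x)" for c x
    by (auto simp: fun_eq_iff ent algebra_simps sum_distrib_left)
  show "defect d M d' M' x \<in> supported (arrow_index d d')" for x
    by (auto simp: supported_def defect_def)
qed (simp_all add: finite_hom_index finite_arrow_index)

lemma mat_of_fun_carrier: "mat_of_fun d d' x v \<in> carrier_mat (d' v) (d v)"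
  by (simp add: mat_of_fun_def)

lemma mat_of_fun_surj:
  fixes F :: "vertex \<Rightarrow> 'k::field mat"
  assumes "\<And>v. F v \<in> carrier_mat (d' v) (d v)"
  obtains x where "x \<in> supported (hom_index d d')" "mat_of_fun d d' x = F"
proof (rule that)
  let ?x = "\<lambda>(v, i, j). if (v, i, j) \<in> hom_index d d' then F v $$ (i, j) else 0"
  show "?x \<in> supported (hom_index d d')" by (auto simp: supported_def)
  show "mat_of_fun d d' ?x = F"
    using carrier_matD[OF assms] by (auto simp: fun_eq_iff mat_of_fun_def hom_index_def)
qed

lemma mat_of_fun_inj:
  assumes "x \<in> supported (hom_index d d')" "y \<in> supported (hom_index d d')"
    and "mat_of_fun d d' x = mat_of_fun d d' y"
  shows "x = y"
proof (rule ext, clarify)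
  fix v i j
  show "x (v, i, j) = y (v, i, j)"
  proof (cases "(v, i, j) \<in> hom_index d d'")
    case True
    then have "i < d' v" "j < d v" by (auto simp: hom_index_def)
    then show ?thesis
      using arg_cong[OF fun_cong[OF assms(3), of v], of "\<lambda>A. A $$ (i, j)"] by (simp add: mat_of_fun_def)
  qed (use assms in \<open>auto simp: supported_def\<close>)
qed

text \<open>The inhomogeneous form serves twice: \<open>G = 0\<close> describes morphisms, and
  arbitrary \<open>G\<close> describes rigidity.\<close>

lemma defect_eq_iff:
  assumes M: "mats d M" "mats d' M'" and G: "\<And>a. G a \<in> carrier_mat (d' (tgt a)) (d (src a))"
  shows "(\<forall>a. mat_of_fun d d' x (tgt a) * M a = M' a * mat_of_fun d d' x (src a) + G a) \<longleftrightarrow>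
    defect d M d' M' x = (\<lambda>(a, i, j). if (a, i, j) \<in> arrow_index d d' then G a $$ (i, j) else 0)"
proof -
  let ?F = "mat_of_fun d d' x"
  have car: "?F (tgt a) * M a \<in> carrier_mat (d' (tgt a)) (d (src a))"
    "M' a * ?F (src a) \<in> carrier_mat (d' (tgt a)) (d (src a))" for a
    by (rule mult_carrier_mat[OF mat_of_fun_carrier[of d d' x "tgt a"] matsD[OF M(1), of a]],
        rule mult_carrier_mat[OF matsD[OF M(2), of a] mat_of_fun_carrier[of d d' x "src a"]])
  have "?F (tgt a) * M a = M' a * ?F (src a) + G a \<longleftrightarrow>
      (\<forall>i<d' (tgt a). \<forall>j<d (src a). defect d M d' M' x (a, i, j) = G a $$ (i, j))" for a
  proof -
    have "defect d M d' M' x (a, i, j) = (?F (tgt a) * M a) $$ (i, j) - (M' a * ?F (src a)) $$ (i, j)"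
      if "i < d' (tgt a)" "j < d (src a)" for i j
      using that carrier_matD[OF car(1)[of a]] carrier_matD[OF car(2)[of a]]
      by (simp add: defect_def arrow_index_def del: index_mult_mat)
    moreover have "(M' a * ?F (src a) + G a) $$ (i, j) = (M' a * ?F (src a)) $$ (i, j) + G a $$ (i, j)"
      if "i < d' (tgt a)" "j < d (src a)" for i j
      using that carrier_matD[OF G[of a]] by simp
    ultimately show ?thesis
      using car[of a] G[of a] by (auto simp: mat_eq_iff diff_eq_eq add.commute)
  qed
  then show ?thesis by (auto simp: fun_eq_iff arrow_index_def defect_def)
qed

lemma mat_hom_iff_defect:
  assumes M: "mats d M" "mats d' M'"
  shows "mat_hom d M d' M' (mat_of_fun d d' x) \<longleftrightarrow> defect d M d' M' x = 0"
proof -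
  have car: "M' a * mat_of_fun d d' x (src a) \<in> carrier_mat (d' (tgt a)) (d (src a))" for a
    by (rule mult_carrier_mat[OF matsD[OF M(2), of a] mat_of_fun_carrier[of d d' x "src a"]])
  have "(\<lambda>(a, i, j). if (a, i, j) \<in> arrow_index d d'
      then 0\<^sub>m (d' (tgt a)) (d (src a)) $$ (i, j) else 0) = (0 :: arrow \<times> nat \<times> nat \<Rightarrow> 'a)"
    by (auto simp: fun_eq_iff arrow_index_def)
  then show ?thesis
    using defect_eq_iff[OF M, of "\<lambda>a. 0\<^sub>m (d' (tgt a)) (d (src a))" x] right_add_zero_mat[OF car]
    by (simp add: mat_hom_def mat_of_fun_carrier)
qed

lemma mat_hom_nonzero:
  fixes M M' :: "arrow \<Rightarrow> 'k::field mat"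
  assumes M: "mats d M" "mats d' M'" and less: "arrow_dim d d' < hom_dim d d'"
  obtains F v where "mat_hom d M d' M' F" "F v \<noteq> 0\<^sub>m (d' v) (d v)"
proof -
  interpret coordinate_map "hom_index d d'" "arrow_index d d'" "defect d M d' M'"
    by (rule coordinate_map_defect[OF M])
  obtain x where x: "x \<in> supported (hom_index d d')" "x \<noteq> 0" "defect d M d' M' x = 0"
    using kernel_nonzero less by (metis card_hom_index card_arrow_index)
  have "mat_of_fun d d' x v \<noteq> 0\<^sub>m (d' v) (d v)" if "x (v, i, j) \<noteq> 0" for v i j
  proof
    assume "mat_of_fun d d' x v = 0\<^sub>m (d' v) (d v)"
    moreover have "i < d' v" "j < d v" using that x(1) by (auto simp: supported_def hom_index_def)
    ultimately have "mat_of_fun d d' x v $$ (i, j) = 0" by simp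
    then show False using that \<open>i < d' v\<close> \<open>j < d v\<close> by (simp add: mat_of_fun_def)
  qed
  moreover obtain v i j where "x (v, i, j) \<noteq> 0" using x(2) by (auto simp: fun_eq_iff)
  ultimately show thesis using that mat_hom_iff_defect[OF M] x(3) by blast
qed

text \<open>Rigidity is surjectivity of \<open>defect\<close>, whose kernel consists of the
  endomorphisms. For a brick this kernel is the line through the identity, encoded by
  \<open>u\<close>, so dimensions decide.\<close>

lemma brick_rigid_iff:
  fixes M :: "arrow \<Rightarrow> 'k::field mat"
  assumes M: "mats d M" and B: "brick d M"
  shows "rigid d M \<longleftrightarrow> hom_dim d d = Suc (arrow_dim d d)"
proof -
  let ?I = "hom_index d d" and ?J = "arrow_index d d" and ?T = "defect d M d M"
  interpret coordinate_map ?I ?J ?T by (rule coordinate_map_defect[OF M M])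
  obtain u where u: "u \<in> supported ?I" "mat_of_fun d d u = (\<lambda>v. 1\<^sub>m (d v) :: 'k mat)"
    by (rule mat_of_fun_surj[of "\<lambda>v. 1\<^sub>m (d v) :: 'k mat" d d]) auto
  have "mat_hom d M d M (\<lambda>v. 1\<^sub>m (d v))"
    using left_mult_one_mat[OF matsD[OF M]] right_mult_one_mat[OF matsD[OF M]] by (simp add: mat_hom_def)
  then have Tu: "?T u = 0" using mat_hom_iff_defect[OF M M, of u] u(2) by simp
  have u0: "u \<noteq> 0"
  proof
    assume "u = 0"
    obtain v where v: "d v > 0" using B by (auto simp: brick_def)
    have "mat_of_fun d d u v $$ (0, 0) = (1 :: 'k)" using u(2) v by simp
    then show False using v \<open>u = 0\<close> by (simp add: mat_of_fun_def)
  qed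
  have ker: "\<exists>c. x = fscale c u" if x: "x \<in> supported ?I" "?T x = 0" for x
  proof -
    have "mat_hom d M d M (mat_of_fun d d x)" using mat_hom_iff_defect[OF M M] x(2) by simp
    then obtain c where c: "\<And>v. mat_of_fun d d x v = c \<cdot>\<^sub>m 1\<^sub>m (d v)" using B unfolding brick_def by blast
    have "mat_of_fun d d (fscale c u) v = c \<cdot>\<^sub>m mat_of_fun d d u v" for v
      by (rule eq_matI) (auto simp: mat_of_fun_def)
    then have "mat_of_fun d d x = mat_of_fun d d (fscale c u)" using c u(2) by auto
    moreover have "fscale c u \<in> supported ?I" using u(1) by (auto simp: supported_def)
    ultimately show ?thesis using mat_of_fun_inj[OF x(1)] by blast
  qed
  have "rigid d M \<longleftrightarrow> ?T ` supported ?I = supported ?J"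
  proof
    assume R: "rigid d M"
    have "g \<in> ?T ` supported ?I" if g: "g \<in> supported ?J" for g
    proof -
      define G where "G a = mat (d (tgt a)) (d (src a)) (\<lambda>(i, j). g (a, i, j))" for a
      have "mats d G" by (simp add: mats_def G_def)
      then obtain H where H: "\<And>v. H v \<in> carrier_mat (d v) (d v)"
        "\<And>a. H (tgt a) * M a = M a * H (src a) + G a" using R unfolding rigid_def by blast
      obtain x where x: "x \<in> supported ?I" "mat_of_fun d d x = H"
        by (rule mat_of_fun_surj[of H d d]) (rule H(1))
      have "?T x = (\<lambda>(a, i, j). if (a, i, j) \<in> ?J then G a $$ (i, j) else 0)"
        using defect_eq_iff[OF M M, of G x] H(2) x(2) by (simp add: G_def)
      also have "\<dots> = g" using g by (auto simp: G_def fun_eq_iff arrow_index_def supported_def)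
      finally show ?thesis using x(1) by blast
    qed
    then show "?T ` supported ?I = supported ?J" using T_mem by blast
  next
    assume S: "?T ` supported ?I = supported ?J"
    show "rigid d M"
      unfolding rigid_def
    proof (intro allI impI)
      fix G :: "arrow \<Rightarrow> 'k mat" assume G: "mats d G"
      let ?g = "\<lambda>(a, i, j). if (a, i, j) \<in> ?J then G a $$ (i, j) else 0"
      have "?g \<in> ?T ` supported ?I" unfolding S by (auto simp: supported_def)
      then obtain x where "?g = ?T x" by (rule imageE)
      then have "\<forall>a. mat_of_fun d d x (tgt a) * M a = M a * mat_of_fun d d x (src a) + G a"
        by (subst defect_eq_iff[OF M M matsD[OF G]]) (rule sym)
      then show "\<exists>H. (\<forall>v. H v \<in> carrier_mat (d v) (d v)) \<and> (\<forall>a. H (tgt a) * M a = M a * H (src a) + G a)"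
        using mat_of_fun_carrier by (intro exI[of _ "mat_of_fun d d x"]) auto
    qed
  qed
  then show ?thesis
    using kernel_line_surj_iff[OF u(1) u0 Tu ker] by (simp add: card_hom_index card_arrow_index)
qed

section \<open>One-sided inverses and maximal rank\<close>

definition left_invertible :: "'k::field mat \<Rightarrow> bool" where
  "left_invertible A \<longleftrightarrow> (\<exists>L\<in>carrier_mat (dim_col A) (dim_row A). L * A = 1\<^sub>m (dim_col A))"

definition right_invertible :: "'k::field mat \<Rightarrow> bool" where
  "right_invertible A \<longleftrightarrow> (\<exists>R\<in>carrier_mat (dim_col A) (dim_row A). A * R = 1\<^sub>m (dim_row A))"

definition bijective_mat :: "nat \<Rightarrow> 'k::field mat \<Rightarrow> bool" where
  "bijective_mat n A \<longleftrightarrow> A \<in> carrier_mat n n \<and> (\<exists>B\<in>carrier_mat n n. A * B = 1\<^sub>m n \<and> B * A = 1\<^sub>m n)"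

lemma left_invertible_transpose: "left_invertible A\<^sup>T \<longleftrightarrow> right_invertible A"
proof
  assume "left_invertible A\<^sup>T"
  then obtain L where L: "L \<in> carrier_mat (dim_row A) (dim_col A)" "L * A\<^sup>T = 1\<^sub>m (dim_row A)"
    by (auto simp: left_invertible_def)
  then have "A * L\<^sup>T = 1\<^sub>m (dim_row A)"
    using transpose_mult[of A "dim_row A" "dim_col A" "L\<^sup>T" "dim_row A"] arg_cong[OF L(2), of transpose_mat]
      transpose_mult[of L "dim_row A" "dim_col A" "A\<^sup>T" "dim_row A"] by (simp add: transpose_carrier_mat)
  then show "right_invertible A" using L(1) by (auto simp: right_invertible_def intro!: bexI[of _ "L\<^sup>T"])
next
  assume "right_invertible A"
  then obtain R where R: "R \<in> carrier_mat (dim_col A) (dim_row A)" "A * R = 1\<^sub>m (dim_row A)"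
    by (auto simp: right_invertible_def)
  then have "R\<^sup>T * A\<^sup>T = 1\<^sub>m (dim_row A)"
    using arg_cong[OF R(2), of transpose_mat] transpose_mult[of A "dim_row A" "dim_col A" R "dim_row A"]
    by simp
  then show "left_invertible A\<^sup>T" using R(1) by (auto simp: left_invertible_def intro!: bexI[of _ "R\<^sup>T"])
qed

lemma bijective_matI:
  assumes "A \<in> carrier_mat n n" and "left_invertible A \<or> right_invertible A"
  shows "bijective_mat n A"
  using assms mat_mult_left_right_inverse[of _ n]
  unfolding bijective_mat_def left_invertible_def right_invertible_def by (auto dest: carrier_matD)

lemma smult_0_mat: "(0 :: 'k::field) \<cdot>\<^sub>m A = 0\<^sub>m (dim_row A) (dim_col A)"
  by (rule eq_matI) auto

lemma one_mat_eq_zero: "1\<^sub>m n = (0\<^sub>m n n :: 'k::field mat) \<Longrightarrow> n = 0"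
proof (rule ccontr)
  assume eq: "1\<^sub>m n = (0\<^sub>m n n :: 'k mat)" and "n \<noteq> 0"
  have "(1\<^sub>m n :: 'k mat) $$ (0, 0) = 0\<^sub>m n n $$ (0, 0)" by (simp only: eq)
  with \<open>n \<noteq> 0\<close> show False by simp
qed

lemma coordinate_map_mat_fun:
  assumes "A \<in> carrier_mat m n" shows "coordinate_map {..<n} {..<m} (mat_fun A)"
  using assms by unfold_locales
    (auto simp: mat_fun_plus mat_fun_scale kpow_eq_supported[symmetric] mat_fun_in_kpow)

text \<open>Invert \<open>mat_fun A\<close> on its image, by the joint inverse with second summand
  \<open>{0}\<close>, and extend the result linearly to \<open>kpow m\<close>.\<close>

lemma left_invertible_if_injective:
  fixes A :: "'k::field mat"
  assumes A: "A \<in> carrier_mat m n" and inj: "\<And>x. x \<in> kpow n \<Longrightarrow> mat_fun A x = 0 \<Longrightarrow> x = 0"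
  shows "left_invertible A"
proof -
  have zero: "fs.subspace {0 :: nat \<Rightarrow> 'k}" by simp
  have lin0: "linear_between fscale {0 :: nat \<Rightarrow> 'k} fscale (kpow m) (\<lambda>_. 0 :: nat \<Rightarrow> 'k)"
    by (auto simp: linear_between_def kpow_def)
  obtain U p q where U: "fs.subspace U" "linear_between fscale U fscale (kpow n) p"
    "U = {mat_fun A x + 0 | x y. x \<in> kpow n \<and> y \<in> {0 :: nat \<Rightarrow> 'k}}"
    "\<And>x y. x \<in> kpow n \<Longrightarrow> y \<in> {0} \<Longrightarrow> p (mat_fun A x + 0) = x \<and> q (mat_fun A x + 0) = y"
    by (rule between_joint_inverse[OF fs.vector_space_axioms fs.vector_space_axioms
          subspace_kpow zero mat_fun_between[OF A] lin0])
      (use inj in auto)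
  obtain g where g': "Vector_Spaces.linear fscale fscale g" "\<And>x. x \<in> U \<Longrightarrow> g x = p x" "\<And>x. g x \<in> kpow n"
    using subspace_pair.between_extend[OF seq_pair[OF U(1) subspace_kpow] U(2)] by metis
  have g: "range g \<subseteq> kpow n" "\<And>x. x \<in> kpow n \<Longrightarrow> g (mat_fun A x) = x"
  proof -
    show "range g \<subseteq> kpow n" using g'(3) by blast
    fix x :: "nat \<Rightarrow> 'k" assume x: "x \<in> kpow n"
    then have "mat_fun A x \<in> U" unfolding U(3) by (intro CollectI exI[of _ x] exI[of _ 0]) simp
    then show "g (mat_fun A x) = x" using g'(2) U(4)[OF x, of 0] by simp
  qed
  interpret g: Vector_Spaces.linear fscale fscale g by (fact g'(1))
  have "linear_between fscale (kpow m) fscale (kpow n) g"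
    using g(1) by (intro linear_betweenI) (auto simp: g.add g.scale)
  then obtain L where L: "L \<in> carrier_mat n m" "\<And>x. x \<in> kpow m \<Longrightarrow> g x = mat_fun L x"
    using between_kpow_mat by metis
  have "L * A = 1\<^sub>m n"
  proof (rule mat_fun_eqI)
    fix x :: "nat \<Rightarrow> 'k" assume x: "x \<in> kpow n"
    have "mat_fun L (mat_fun A x) = x" using L(2)[OF mat_fun_in_kpow[OF A, of x]] g(2)[OF x] by simp
    then show "mat_fun (L * A) x = mat_fun (1\<^sub>m n) x"
      using x by (simp only: mat_fun_mult[OF L(1) A] mat_fun_one)
  qed (use L(1) A in auto)
  then show ?thesis using L(1) A by (auto simp: left_invertible_def)
qed

text \<open>Kernel vectors are turned into one-column matrices with a marked nonzero entry, so that
  later arguments run on associativity of matrix products.\<close>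

lemma column_kernel:
  fixes A :: "'k::field mat"
  assumes A: "A \<in> carrier_mat m n" and x: "x \<in> kpow n" "x \<noteq> 0" "mat_fun A x = 0"
  obtains X j where "X \<in> carrier_mat n 1" "A * X = 0\<^sub>m m 1" "j < n" "X $$ (j, 0) \<noteq> 0"
proof -
  define X where "X = mat n 1 (\<lambda>(i, _). x i)"
  obtain j where j: "x j \<noteq> 0" using x(2) by (auto simp: fun_eq_iff)
  have "A * X = 0\<^sub>m m 1"
  proof (rule eq_matI)
    fix i k assume "i < dim_row (0\<^sub>m m 1 :: 'k mat)" "k < dim_col (0\<^sub>m m 1 :: 'k mat)"
    then show "(A * X) $$ (i, k) = 0\<^sub>m m 1 $$ (i, k)"
      using A fun_cong[OF x(3), of i] by (simp add: X_def scalar_prod_def mat_fun_def atLeast0LessThan)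
  qed (use A in \<open>auto simp: X_def\<close>)
  moreover have "j < n" using j x(1) by (auto simp: kpow_def not_le[symmetric])
  ultimately show thesis using that[of X j] j by (simp add: X_def)
qed

lemma wide_kernel:
  fixes A :: "'k::field mat"
  assumes A: "A \<in> carrier_mat m n" and "m < n"
  obtains X j where "X \<in> carrier_mat n 1" "A * X = 0\<^sub>m m 1" "j < n" "X $$ (j, 0) \<noteq> 0"
proof -
  interpret coordinate_map "{..<n}" "{..<m}" "mat_fun A" by (rule coordinate_map_mat_fun[OF A])
  obtain x where "x \<in> supported {..<n}" "x \<noteq> 0" "mat_fun A x = 0"
    using kernel_nonzero assms(2) by auto
  then show thesis using column_kernel[OF A] that by (metis kpow_eq_supported)
qed

lemma left_invertible_dim:
  assumes A: "A \<in> carrier_mat m n" and L: "left_invertible A" shows "n \<le> m"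
proof (rule ccontr)
  assume "\<not> n \<le> m"
  then have "m < n" by simp
  then obtain X j where X: "X \<in> carrier_mat n 1" "A * X = 0\<^sub>m m 1" "j < n" "X $$ (j, 0) \<noteq> 0"
    using wide_kernel[OF A] by metis
  obtain L where L: "L \<in> carrier_mat n m" "L * A = 1\<^sub>m n" using L A by (auto simp: left_invertible_def)
  have "X = L * A * X" using L(2) X(1) by simp
  also have "\<dots> = 0\<^sub>m n 1" using assoc_mult_mat[OF L(1) A X(1)] X(2) L(1) by simp
  finally show False using X(3,4) by simp
qed

lemma right_invertible_dim:
  assumes A: "A \<in> carrier_mat m n" and R: "right_invertible A" shows "m \<le> n"
  using left_invertible_dim[of "A\<^sup>T" n m] A R by (simp add: left_invertible_transpose)

text \<open>If \<open>A x = 0\<close> and \<open>y A = 0\<close>, then \<open>y (H A - A H') x = 0\<close> whatever \<open>H\<close> and \<open>H'\<close> are.\<close>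

lemma rigid_max_rank:
  fixes M :: "arrow \<Rightarrow> 'k::field mat"
  assumes M: "mats d M" and R: "rigid d M"
  shows "left_invertible (M a) \<or> right_invertible (M a)"
proof (rule ccontr)
  let ?m = "d (tgt a)" and ?n = "d (src a)"
  note A = matsD[OF M, of a]
  assume "\<not> (left_invertible (M a) \<or> right_invertible (M a))"
  then have no: "\<not> left_invertible (M a)" "\<not> left_invertible (M a)\<^sup>T"
    by (auto simp: left_invertible_transpose)
  have AT: "(M a)\<^sup>T \<in> carrier_mat ?n ?m" using A by simp
  obtain X j where X: "X \<in> carrier_mat ?n 1" "M a * X = 0\<^sub>m ?m 1" "j < ?n" "X $$ (j, 0) \<noteq> 0"
    using no(1) left_invertible_if_injective[OF A] column_kernel[OF A] by metis
  obtain Y i where Y: "Y \<in> carrier_mat ?m 1" "(M a)\<^sup>T * Y = 0\<^sub>m ?n 1" "i < ?m" "Y $$ (i, 0) \<noteq> 0"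
    using no(2) left_invertible_if_injective[OF AT] column_kernel[OF AT] by metis
  have YT: "Y\<^sup>T \<in> carrier_mat 1 ?m" using Y(1) by simp
  have YA: "Y\<^sup>T * M a = 0\<^sub>m 1 ?n"
    using transpose_mult[OF AT Y(1)] arg_cong[OF Y(2), of transpose_mat] by simp
  \<comment> \<open>A single entry 1 at a position where the left and the right kernel vector are
    both nonzero: then \<open>Y\<close> times \<open>G a\<close> times \<open>X\<close> equals the
    product of these two entries.\<close>
  define G where "G b = (if b = a then mat ?m ?n (\<lambda>(k, l). if k = i \<and> l = j then 1 else (0 :: 'k))
      else 0\<^sub>m (d (tgt b)) (d (src b)))" for b
  have "mats d G" by (simp add: mats_def G_def)
  then obtain H where H: "\<And>v. H v \<in> carrier_mat (d v) (d v)"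
    "\<And>b. H (tgt b) * M b = M b * H (src b) + G b" using R unfolding rigid_def by blast
  have Ga: "G a \<in> carrier_mat ?m ?n" by (simp add: G_def)
  note Ht = H(1)[of "tgt a"] and Hs = H(1)[of "src a"]
  have "H (tgt a) * M a * X = (M a * H (src a) + G a) * X" by (simp only: H(2))
  then have 1: "0\<^sub>m ?m 1 = M a * H (src a) * X + G a * X"
    using assoc_mult_mat[OF Ht A X(1)] X(2) add_mult_distrib_mat[OF mult_carrier_mat[OF A Hs] Ga X(1)] Ht
    by simp
  have "Y\<^sup>T * (M a * H (src a) * X) = 0\<^sub>m 1 1"
    using assoc_mult_mat[OF YT mult_carrier_mat[OF A Hs] X(1)] assoc_mult_mat[OF YT A Hs] YA
      left_mult_zero_mat[OF Hs, of 1] left_mult_zero_mat[OF X(1), of 1] by metis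
  moreover have "Y\<^sup>T * 0\<^sub>m ?m 1 = 0\<^sub>m 1 1" using YT by simp
  ultimately have "0\<^sub>m 1 1 = 0\<^sub>m 1 1 + Y\<^sup>T * (G a * X)"
    using 1 mult_add_distrib_mat[OF YT mult_carrier_mat[OF mult_carrier_mat[OF A Hs] X(1)]
        mult_carrier_mat[OF Ga X(1)]] by metis
  then have "(0\<^sub>m 1 1 :: 'k mat) $$ (0, 0) = (0\<^sub>m 1 1 + Y\<^sup>T * (G a * X)) $$ (0, 0)" by (rule arg_cong)
  then have 2: "(Y\<^sup>T * (G a * X)) $$ (0, 0) = 0" using YT X(1) by simp
  have "(G a * X) $$ (k, 0) = (if k = i then X $$ (j, 0) else 0)" if "k < ?m" for k
    using that X(1,3) by (auto simp: G_def scalar_prod_def if_distrib[of "\<lambda>x. x * _"] cong: if_cong)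
  then have "(Y\<^sup>T * (G a * X)) $$ (0, 0) = Y $$ (i, 0) * X $$ (j, 0)"
    using Y(1,3) X(1) Ga by (simp add: scalar_prod_def if_distrib[of "\<lambda>x. _ * x"] del: index_mult_mat(1)[of _ "G a"] cong: if_cong)
  then show False using 2 X(4) Y(4) by simp
qed

text \<open>The branch that is not an isomorphism, seen as a loop \<open>\<alpha>, \<beta>\<close> through the inverse \<open>\<theta>'\<close> of the other one.\<close>

lemma loop_dims:
  fixes \<alpha> \<beta> \<theta>' :: "'k::field mat"
  assumes \<alpha>: "\<alpha> \<in> carrier_mat p n" and \<beta>: "\<beta> \<in> carrier_mat n p" and \<theta>': "bijective_mat n \<theta>'"
    and rank: "left_invertible \<alpha> \<or> right_invertible \<alpha>" "left_invertible \<beta> \<or> right_invertible \<beta>"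
    and c: "\<theta>' * (\<beta> * \<alpha>) = c \<cdot>\<^sub>m 1\<^sub>m n" "\<alpha> * (\<theta>' * \<beta>) = c \<cdot>\<^sub>m 1\<^sub>m p"
  shows "p = Suc n \<Longrightarrow> n = 0" "n = Suc p \<Longrightarrow> p = 0"
proof -
  obtain \<theta> where \<theta>: "\<theta>' \<in> carrier_mat n n" "\<theta> \<in> carrier_mat n n" "\<theta> * \<theta>' = 1\<^sub>m n"
    using \<theta>' by (auto simp: bijective_mat_def)
  note car = \<alpha> \<beta> \<theta>(1,2) mult_carrier_mat[OF \<beta> \<alpha>] mult_carrier_mat[OF \<theta>(1) \<beta>]
  {
    assume p: "p = Suc n"
    obtain L where L: "L \<in> carrier_mat n p" "L * \<alpha> = 1\<^sub>m n"
      using rank(1) right_invertible_dim[OF \<alpha>] p \<alpha> by (auto simp: left_invertible_def)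
    obtain R where R: "R \<in> carrier_mat p n" "\<beta> * R = 1\<^sub>m n"
      using rank(2) left_invertible_dim[OF \<beta>] p \<beta> by (auto simp: right_invertible_def)
    have \<alpha>T: "\<alpha>\<^sup>T \<in> carrier_mat n p" using \<alpha> by simp
    \<comment> \<open>The matrix \<open>\<alpha>\<close> is tall, so some nonzero row vector kills
      it; it kills the scalar endomorphism as well and forces \<open>c = 0\<close>.\<close>
    obtain Y i where Y: "Y \<in> carrier_mat p 1" "\<alpha>\<^sup>T * Y = 0\<^sub>m n 1" "i < p" "Y $$ (i, 0) \<noteq> 0"
      using wide_kernel[OF \<alpha>T] p by auto
    have YT: "Y\<^sup>T \<in> carrier_mat 1 p" using Y(1) by simp
    have Y\<alpha>: "Y\<^sup>T * \<alpha> = 0\<^sub>m 1 n"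
      using transpose_mult[OF \<alpha>T Y(1)] arg_cong[OF Y(2), of transpose_mat] by simp
    have "Y\<^sup>T * (\<alpha> * (\<theta>' * \<beta>)) = 0\<^sub>m 1 p"
      using assoc_mult_mat[OF YT \<alpha> car(6)] Y\<alpha> left_mult_zero_mat[OF car(6), of 1] by metis
    then have "c \<cdot>\<^sub>m Y\<^sup>T = 0\<^sub>m 1 p" using c(2) YT by (simp add: mult_smult_distrib[OF YT, of _ p])
    then have "(c \<cdot>\<^sub>m Y\<^sup>T) $$ (0, i) = 0\<^sub>m 1 p $$ (0, i)" by (rule arg_cong)
    then have "c = 0" using Y by simp
    then have "\<alpha> * (\<theta>' * \<beta>) = 0\<^sub>m p p" using c(2) by (simp add: smult_0_mat)
    \<comment> \<open>Cancelling \<open>\<alpha>\<close> on the left and \<open>\<beta>\<close> on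
      the right leaves \<open>\<theta>'\<close>, which is thus both zero and invertible.\<close>
    then have "L * (\<alpha> * (\<theta>' * \<beta>)) * R = 0\<^sub>m n n" using L(1) R(1) by simp
    moreover have "L * (\<alpha> * (\<theta>' * \<beta>)) * R = \<theta>'"
      using assoc_mult_mat[OF L(1) \<alpha> car(6)] L(2) car(6) assoc_mult_mat[OF \<theta>(1) \<beta> R(1)] R(2) \<theta>(1) by simp
    ultimately have "1\<^sub>m n = (0\<^sub>m n n :: 'k mat)" using \<theta>(2,3) by simp
    then show "n = 0" by (rule one_mat_eq_zero)
  next
    assume n: "n = Suc p"
    obtain L where L: "L \<in> carrier_mat p n" "L * \<beta> = 1\<^sub>m p"
      using rank(2) right_invertible_dim[OF \<beta>] n \<beta> by (auto simp: left_invertible_def)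
    obtain R where R: "R \<in> carrier_mat n p" "\<alpha> * R = 1\<^sub>m p"
      using rank(1) left_invertible_dim[OF \<alpha>] n \<alpha> by (auto simp: right_invertible_def)
    \<comment> \<open>Now \<open>\<alpha>\<close> is wide and a kernel vector forces
      \<open>c = 0\<close>. Then \<open>\<beta> * \<alpha> = 0\<close>, and cancelling both factors
      leaves an identity of size \<open>p\<close> equal to zero.\<close>
    obtain X j where X: "X \<in> carrier_mat n 1" "\<alpha> * X = 0\<^sub>m p 1" "j < n" "X $$ (j, 0) \<noteq> 0"
      using wide_kernel[OF \<alpha>] n by auto
    have "\<theta>' * (\<beta> * \<alpha>) * X = 0\<^sub>m n 1"
      using assoc_mult_mat[OF \<theta>(1) car(5) X(1)] assoc_mult_mat[OF \<beta> \<alpha> X(1)] X(2) \<beta> \<theta>(1) by simp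
    then have "c \<cdot>\<^sub>m X = 0\<^sub>m n 1" using c(1) X(1) by (simp add: mult_smult_assoc_mat[of _ n n _ 1])
    then have "(c \<cdot>\<^sub>m X) $$ (j, 0) = 0\<^sub>m n 1 $$ (j, 0)" by (rule arg_cong)
    then have "c = 0" using X by simp
    then have "\<theta>' * (\<beta> * \<alpha>) = 0\<^sub>m n n" using c(1) by (simp add: smult_0_mat)
    then have "\<theta> * (\<theta>' * (\<beta> * \<alpha>)) = 0\<^sub>m n n" using \<theta>(2) by simp
    then have "\<beta> * \<alpha> = 0\<^sub>m n n"
      using assoc_mult_mat[OF \<theta>(2,1) car(5)] \<theta>(3) left_mult_one_mat[OF car(5)] by metis
    then have "L * (\<beta> * \<alpha>) * R = 0\<^sub>m p p" using L(1) R(1) by simp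
    moreover have "L * (\<beta> * \<alpha>) * R = 1\<^sub>m p"
      using assoc_mult_mat[OF L(1) \<beta> \<alpha>] L(2) \<alpha> R(2) by simp
    ultimately have "1\<^sub>m p = (0\<^sub>m p p :: 'k mat)" by simp
    then show "p = 0" by (rule one_mat_eq_zero)
  }
qed

section \<open>Pairs of matrices\<close>

definition pi_plus_mat :: "nat \<Rightarrow> 'k::field mat" where
  "pi_plus_mat n = mat n (Suc n) (\<lambda>(i, j). if i = j then 1 else 0)"

definition pi_minus_mat :: "nat \<Rightarrow> 'k::field mat" where
  "pi_minus_mat n = mat n (Suc n) (\<lambda>(i, j). if Suc i = j then 1 else 0)"

lemma pi_mat_carrier [simp]:
  "pi_plus_mat n \<in> carrier_mat n (Suc n)" "pi_minus_mat n \<in> carrier_mat n (Suc n)"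
  by (simp_all add: pi_plus_mat_def pi_minus_mat_def)

lemma mult_pi_mat:
  assumes W: "W \<in> carrier_mat m n"
  shows "W * pi_plus_mat n = mat m (Suc n) (\<lambda>(i, j). if j < n then W $$ (i, j) else 0)"
    "W * pi_minus_mat n = mat m (Suc n) (\<lambda>(i, j). if 0 < j then W $$ (i, j - 1) else 0)"
proof -
  show "W * pi_plus_mat n = mat m (Suc n) (\<lambda>(i, j). if j < n then W $$ (i, j) else 0)"
    using W by (intro eq_matI)
      (auto simp: pi_plus_mat_def scalar_prod_def if_distrib[of "\<lambda>x. _ * x"] cong: if_cong)
  have "(\<Sum>l = 0..<n. W $$ (i, l) * (if Suc l = j then 1 else 0)) = (if 0 < j then W $$ (i, j - 1) else 0)"
    if "j \<le> n" for i j
    using that by (cases j) (auto simp: if_distrib[of "\<lambda>x. _ * x"] cong: if_cong)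
  then show "W * pi_minus_mat n = mat m (Suc n) (\<lambda>(i, j). if 0 < j then W $$ (i, j - 1) else 0)"
    using W by (intro eq_matI) (simp_all add: pi_minus_mat_def scalar_prod_def)
qed

lemma pi_mat_mult:
  assumes W: "W \<in> carrier_mat (Suc n) m"
  shows "pi_plus_mat n * W = mat n m (\<lambda>(i, j). W $$ (i, j))"
    "pi_minus_mat n * W = mat n m (\<lambda>(i, j). W $$ (Suc i, j))"
  using W by (auto intro!: eq_matI simp: pi_plus_mat_def pi_minus_mat_def scalar_prod_def
      if_distrib[of "\<lambda>x. x * _"] cong: if_cong)

text \<open>A pair of parallel matrices is a Kronecker module, and \<open>(F, G)\<close> is an
  endomorphism of it. Sizes may be 0 here; nonvanishing is stated separately in
  \<open>brick_shape_iff\<close>.\<close>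

definition pair_brick :: "nat \<Rightarrow> nat \<Rightarrow> 'k::field mat \<Rightarrow> 'k mat \<Rightarrow> bool" where
  "pair_brick n m A C \<longleftrightarrow>
     (\<forall>F\<in>carrier_mat n n. \<forall>G\<in>carrier_mat m m. G * A = A * F \<and> G * C = C * F \<longrightarrow>
        (\<exists>c. F = c \<cdot>\<^sub>m 1\<^sub>m n \<and> G = c \<cdot>\<^sub>m 1\<^sub>m m))"

text \<open>Duality of Kronecker modules: transposing exchanges the two spaces and reverses the
  endomorphisms. It reduces pairs of tall matrices to pairs of wide ones.\<close>

lemma pair_brick_transpose:
  fixes A C :: "'k::field mat"
  assumes A: "A \<in> carrier_mat m n" and C: "C \<in> carrier_mat m n" and B: "pair_brick n m A C"
  shows "pair_brick m n A\<^sup>T C\<^sup>T"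
  unfolding pair_brick_def
proof (intro ballI impI)
  fix F G :: "'k mat"
  assume F: "F \<in> carrier_mat m m" and G: "G \<in> carrier_mat n n"
    and eq: "G * A\<^sup>T = A\<^sup>T * F \<and> G * C\<^sup>T = C\<^sup>T * F"
  have AT: "A\<^sup>T \<in> carrier_mat n m" and CT: "C\<^sup>T \<in> carrier_mat n m" using A C by auto
  have "F\<^sup>T * A = A * G\<^sup>T" "F\<^sup>T * C = C * G\<^sup>T"
    using eq transpose_mult[OF G AT] transpose_mult[OF AT F] transpose_mult[OF G CT] transpose_mult[OF CT F]
    by auto
  moreover have "F\<^sup>T \<in> carrier_mat m m" "G\<^sup>T \<in> carrier_mat n n" using F G by auto
  ultimately obtain c where "G\<^sup>T = c \<cdot>\<^sub>m 1\<^sub>m n" "F\<^sup>T = c \<cdot>\<^sub>m 1\<^sub>m m" using B unfolding pair_brick_def by blast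
  moreover have "(c \<cdot>\<^sub>m 1\<^sub>m k)\<^sup>T = c \<cdot>\<^sub>m 1\<^sub>m k" for k by (rule eq_matI) auto
  ultimately show "\<exists>c. F = c \<cdot>\<^sub>m 1\<^sub>m m \<and> G = c \<cdot>\<^sub>m 1\<^sub>m n"
    by (intro exI[of _ c]) (metis transpose_transpose)
qed

text \<open>\<open>G\<close> is the common upper left and lower right block of \<open>F\<close>, so \<open>F\<close> is constant along
  diagonals; its last column and its first column vanish off the diagonal.\<close>

lemma pair_brick_pi: "pair_brick (Suc n) n (pi_plus_mat n :: 'k::field mat) (pi_minus_mat n)"
  unfolding pair_brick_def
proof (intro ballI impI)
  fix F G :: "'k mat"
  assume F: "F \<in> carrier_mat (Suc n) (Suc n)" and G: "G \<in> carrier_mat n n"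
    and eq: "G * pi_plus_mat n = pi_plus_mat n * F \<and> G * pi_minus_mat n = pi_minus_mat n * F"
  have p: "mat n (Suc n) (\<lambda>(i, j). if j < n then G $$ (i, j) else 0) = mat n (Suc n) (\<lambda>(i, j). F $$ (i, j))"
    and m: "mat n (Suc n) (\<lambda>(i, j). if 0 < j then G $$ (i, j - 1) else 0) = mat n (Suc n) (\<lambda>(i, j). F $$ (Suc i, j))"
    using eq by (simp_all add: mult_pi_mat[OF G] pi_mat_mult[OF F])
  have P: "F $$ (i, j) = (if j < n then G $$ (i, j) else 0)" if "i < n" "j \<le> n" for i j
    using arg_cong[OF p, of "\<lambda>A. A $$ (i, j)"] that by simp
  have M: "F $$ (Suc i, j) = (if 0 < j then G $$ (i, j - 1) else 0)" if "i < n" "j \<le> n" for i j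
    using arg_cong[OF m, of "\<lambda>A. A $$ (i, j)"] that by simp
  have diag: "F $$ (Suc i, Suc j) = F $$ (i, j)" if "i < n" "j < n" for i j
    using P[of i j] M[of i "Suc j"] that by simp
  have shift: "F $$ (i + k, j + k) = F $$ (i, j)" if "i + k \<le> n" "j + k \<le> n" for i j k
    using that by (induction k) (auto simp: diag)
  have upper: "F $$ (i, j) = 0" if "i < j" "j \<le> n" for i j
    using shift[of i "n - j" j] P[of "i + (n - j)" n] that by simp
  have lower: "F $$ (i, j) = 0" if "j < i" "i \<le> n" for i j
  proof -
    have "Suc (i - j - 1) = i - j" "i - j - 1 < n" using that by auto
    then show ?thesis using shift[of "i - j" j 0] M[of "i - j - 1" 0] that by simp
  qed
  have main: "F $$ (i, i) = F $$ (0, 0)" if "i \<le> n" for i using shift[of 0 i 0] that by simp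
  define c where "c = F $$ (0, 0)"
  have ent: "F $$ (i, j) = (if i = j then c else 0)" if "i \<le> n" "j \<le> n" for i j
    using that upper[of i j] lower[of j i] main[of i] unfolding c_def
    by (cases i j rule: linorder_cases) auto
  have "F = c \<cdot>\<^sub>m 1\<^sub>m (Suc n)"
    using F by (intro eq_matI) (auto simp: ent)
  moreover have "G = c \<cdot>\<^sub>m 1\<^sub>m n"
  proof (rule eq_matI)
    fix i j assume "i < dim_row (c \<cdot>\<^sub>m 1\<^sub>m n)" "j < dim_col (c \<cdot>\<^sub>m 1\<^sub>m n)"
    then have ij: "i < n" "j < n" by auto
    then show "G $$ (i, j) = (c \<cdot>\<^sub>m 1\<^sub>m n) $$ (i, j)" using P[of i j] ent[of i j] by (simp split: if_splits)
  qed (use G in auto)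
  ultimately show "\<exists>c. F = c \<cdot>\<^sub>m 1\<^sub>m (Suc n) \<and> G = c \<cdot>\<^sub>m 1\<^sub>m n" by blast
qed

fun shape_dim :: "bool \<Rightarrow> bool \<Rightarrow> nat \<Rightarrow> nat \<Rightarrow> vertex \<Rightarrow> nat" where
  "shape_dim s t n m Vb = n"
| "shape_dim s t n m Vplus = (if s then n else m)"
| "shape_dim s t n m Vminus = (if t then n else m)"
| "shape_dim s t n m Ve = m"

text \<open>The flags \<open>s\<close> and \<open>t\<close> say whether the first map of the branch through \<open>+\<close>, respectively
  \<open>-\<close>, is the identity; otherwise the second one is.\<close>

fun shape_mat :: "bool \<Rightarrow> bool \<Rightarrow> nat \<Rightarrow> nat \<Rightarrow> 'k mat \<Rightarrow> 'k mat \<Rightarrow> arrow \<Rightarrow> 'k::field mat" where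
  "shape_mat s t n m A C b_plus = (if s then 1\<^sub>m n else A)"
| "shape_mat s t n m A C plus_e = (if s then A else 1\<^sub>m m)"
| "shape_mat s t n m A C b_minus = (if t then 1\<^sub>m n else C)"
| "shape_mat s t n m A C minus_e = (if t then C else 1\<^sub>m m)"

lemma all_vertex: "(\<forall>v. P v) \<longleftrightarrow> P Vb \<and> P Vplus \<and> P Vminus \<and> P Ve"
  by (metis vertex.exhaust)

lemma all_arrow: "(\<forall>a. P a) \<longleftrightarrow> P b_plus \<and> P plus_e \<and> P b_minus \<and> P minus_e"
  by (metis arrow.exhaust)

lemma mats_shape:
  "A \<in> carrier_mat m n \<Longrightarrow> C \<in> carrier_mat m n \<Longrightarrow> mats (shape_dim s t n m) (shape_mat s t n m A C)"
  by (simp add: mats_def all_arrow)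

text \<open>The pair is read as a representation whose arrows into \<open>Ve\<close> are identities,
  so the count for the quiver applies. The contributions of the identities cancel, and the
  hypothesis is positivity of the Euler form of Kronecker modules.\<close>

lemma pair_hom_nonzero:
  fixes A C A' C' :: "'k::field mat"
  assumes A: "A \<in> carrier_mat m n" "C \<in> carrier_mat m n" and A': "A' \<in> carrier_mat m' n'" "C' \<in> carrier_mat m' n'"
    and less: "2 * m' * n < n' * n + m' * m"
  obtains F G where "F \<in> carrier_mat n' n" "G \<in> carrier_mat m' m" "G * A = A' * F" "G * C = C' * F"
    "F \<noteq> 0\<^sub>m n' n \<or> G \<noteq> 0\<^sub>m m' m"
proof -
  let ?d = "shape_dim False False n m" and ?d' = "shape_dim False False n' m'"
  let ?M = "shape_mat False False n m A C" and ?M' = "shape_mat False False n' m' A' C'"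
  have "arrow_dim ?d ?d' < hom_dim ?d ?d'"
    using less by (simp add: arrow_dim_def hom_dim_def)
  then obtain F v where F: "mat_hom ?d ?M ?d' ?M' F"
    and v: "F v \<noteq> 0\<^sub>m (?d' v) (?d v)"
    using mat_hom_nonzero[OF mats_shape[OF A] mats_shape[OF A']] by metis
  have c: "F v \<in> carrier_mat (?d' v) (?d v)"
    and e: "F (tgt a) * ?M a = ?M' a * F (src a)" for v a
    using F by (auto simp: mat_hom_def)
  have c': "F Vb \<in> carrier_mat n' n" "F Vplus \<in> carrier_mat m' m" "F Vminus \<in> carrier_mat m' m" "F Ve \<in> carrier_mat m' m"
    using c[of Vb] c[of Vplus] c[of Vminus] c[of Ve] by simp_all
  have eq: "F Vplus = F Ve" "F Vminus = F Ve"
    using e[of plus_e] e[of minus_e] c' by simp_all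
  show thesis
    using that[OF c'(1,4)] e[of b_plus] e[of b_minus] eq v by (cases v) auto
qed

section \<open>Kernel chains and the normal form of a pair\<close>

text \<open>The coefficients are indexed by \<open>I\<close> and not by the set of vectors, so that
  they can be shifted along a chain.\<close>

lemma span_image_sum:
  assumes "x \<in> fs.span (v ` I)" "finite I"
  obtains c where "x = (\<Sum>i\<in>I. fscale (c i) (v i))"
proof -
  let ?R = "{\<Sum>i\<in>I. fscale (c i) (v i) | c. True}"
  have "fs.subspace ?R"
    unfolding fs.subspace_def
  proof (intro conjI ballI allI)
    show "0 \<in> ?R" by (intro CollectI exI[of _ "\<lambda>_. 0"]) simp
    fix x y assume "x \<in> ?R" "y \<in> ?R"
    then obtain c c' where "x = (\<Sum>i\<in>I. fscale (c i) (v i))" "y = (\<Sum>i\<in>I. fscale (c' i) (v i))" by blast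
    then show "x + y \<in> ?R"
      by (intro CollectI exI[of _ "\<lambda>i. c i + c' i"]) (simp only: fs.scale_left_distrib sum.distrib simp_thms)
  next
    fix a x assume "x \<in> ?R"
    then obtain c where "x = (\<Sum>i\<in>I. fscale (c i) (v i))" by blast
    then show "fscale a x \<in> ?R"
      by (intro CollectI exI[of _ "\<lambda>i. a * c i"]) (simp only: fs.scale_sum_right fs.scale_scale simp_thms)
  qed
  moreover have "v ` I \<subseteq> ?R"
  proof
    fix y assume "y \<in> v ` I"
    then obtain i where i: "i \<in> I" "y = v i" by blast
    have "y = (\<Sum>j\<in>I. if j = i then v j else 0)" using i assms(2) by (simp only: sum.delta if_True)
    also have "\<dots> = (\<Sum>j\<in>I. fscale (if j = i then 1 else 0) (v j))"
      by (rule sum.cong) auto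
    finally show "y \<in> ?R"
      by (intro CollectI exI[of _ "\<lambda>j. if j = i then 1 else 0"] conjI TrueI)
  qed
  ultimately have "x \<in> ?R" using fs.span_minimal assms(1) by blast
  then show thesis using that by blast
qed

text \<open>The last coefficient must vanish, since otherwise the last vector would lie in the span
  of its predecessors; the rest follows by induction.\<close>

lemma sum_zero_if_not_in_span:
  fixes v :: "nat \<Rightarrow> 'i \<Rightarrow> 'k::field" and m :: nat
  assumes "\<And>i. i < m \<Longrightarrow> v i \<notin> fs.span (v ` {..<i})" and "(\<Sum>i<m. fscale (a i) (v i)) = 0"
  shows "\<forall>i<m. a i = 0"
  using assms
proof (induction m)
  case (Suc m)
  have s: "(\<Sum>i<m. fscale (a i) (v i)) \<in> fs.span (v ` {..<m})"
    by (intro fs.span_sum fs.span_scale fs.span_base) auto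
  have eq: "(\<Sum>i<m. fscale (a i) (v i)) + fscale (a m) (v m) = 0"
    using Suc.prems(2) by (simp only: sum.lessThan_Suc)
  have "a m = 0"
  proof (rule ccontr)
    assume am: "a m \<noteq> 0"
    have "fscale (a m) (v m) = - (\<Sum>i<m. fscale (a i) (v i))" using eq by (metis add_eq_0_iff)
    then have "fscale (inverse (a m)) (fscale (a m) (v m)) \<in> fs.span (v ` {..<m})"
      using s fs.span_neg fs.span_scale by metis
    then show False using am Suc.prems(1)[of m] by (simp add: fs.scale_scale)
  qed
  moreover have "\<forall>i<m. a i = 0"
    using Suc.IH Suc.prems(1) eq calculation by (metis add.right_neutral fs.scale_zero_left less_Suc_eq)
  ultimately show ?case by (simp add: less_Suc_eq)
qed simp

lemma mat_fun_sum: "finite I \<Longrightarrow> mat_fun A (\<Sum>i\<in>I. fscale (c i) (v i)) = (\<Sum>i\<in>I. fscale (c i) (mat_fun A (v i)))"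
proof (induction I rule: finite_induct)
  case (insert x F)
  have "mat_fun A (\<Sum>i\<in>insert x F. fscale (c i) (v i))
      = mat_fun A (fscale (c x) (v x)) + mat_fun A (\<Sum>i\<in>F. fscale (c i) (v i))"
    using insert.hyps by (simp only: sum.insert mat_fun_plus not_False_eq_True)
  then show ?case using insert by (simp only: mat_fun_scale sum.insert not_False_eq_True)
qed (simp only: sum.empty mat_fun_0)

text \<open>The chain \<open>v 0 \<in> ker C\<close>, \<open>C (v (i + 1)) = A (v i)\<close> is independent up to some \<open>v d\<close>, and
  \<open>v (d + 1)\<close> depends on it. Subtracting from every \<open>v i\<close> the same linear combination, shifted, makes
  the chain end with \<open>A (v d) = 0\<close>.\<close>

lemma kernel_chain:
  fixes A C :: "'k::field mat"
  assumes A: "A \<in> carrier_mat n (Suc n)" and C: "C \<in> carrier_mat n (Suc n)" and R: "right_invertible C"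
  obtains d v where "d \<le> n" "\<And>i. v i \<in> kpow (Suc n)" "\<And>i. i \<le> d \<Longrightarrow> v i \<notin> fs.span (v ` {..<i})"
    "mat_fun C (v 0) = 0" "\<And>i. i < d \<Longrightarrow> mat_fun C (v (Suc i)) = mat_fun A (v i)" "mat_fun A (v d) = 0"
proof -
  obtain S where S: "S \<in> carrier_mat (Suc n) n" "C * S = 1\<^sub>m n"
    using R C by (auto simp: right_invertible_def)
  interpret C: coordinate_map "{..<Suc n}" "{..<n}" "mat_fun C" by (rule coordinate_map_mat_fun[OF C])
  obtain v0 where v0: "v0 \<in> kpow (Suc n)" "v0 \<noteq> 0" "mat_fun C v0 = 0"
    using C.kernel_nonzero by (auto simp: kpow_eq_supported)
  \<comment> \<open>Applying the right inverse \<open>S\<close> of \<open>C\<close> to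
    \<open>A (v i)\<close> yields a solution of \<open>C (v (i + 1)) = A (v i)\<close>, so the chain
    continues indefinitely.\<close>
  define v where "v i = ((\<lambda>x. mat_fun S (mat_fun A x)) ^^ i) v0" for i
  have v_0: "v 0 = v0" and v_Suc: "v (Suc i) = mat_fun S (mat_fun A (v i))" for i by (simp_all add: v_def)
  have vk: "v i \<in> kpow (Suc n)" for i
    using v0(1) mat_fun_in_kpow[OF S(1)] by (cases i) (auto simp: v_0 v_Suc)
  have C0: "mat_fun C (v 0) = 0" using v0(3) by (simp only: v_0)
  have CA: "mat_fun C (v (Suc i)) = mat_fun A (v i)" for i
    using mat_fun_mult[OF C S(1), of "mat_fun A (v i)"] S(2) mat_fun_one[OF mat_fun_in_kpow[OF A]]
    by (simp only: v_Suc)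
  \<comment> \<open>The \<open>n + 2\<close> vectors \<open>v 0\<close>, ...,
    \<open>v (n + 1)\<close> lie in a space of dimension \<open>n + 1\<close>, so one depends on its
    predecessors; it is not \<open>v 0\<close>, which is nonzero.\<close>
  have "\<exists>d\<le>n. v (Suc d) \<in> fs.span (v ` {..<Suc d})"
  proof (rule ccontr)
    assume "\<not> ?thesis"
    then have no: "v i \<notin> fs.span (v ` {..<i})" if "i < Suc (Suc n)" for i
      using that v0(2) v_0 by (cases i) auto
    interpret T: coordinate_map "{..<Suc (Suc n)}" "{..<Suc n}" "\<lambda>y. \<Sum>j<Suc (Suc n). fscale (y j) (v j)"
    proof
      fix x y :: "nat \<Rightarrow> 'k" and c :: 'k
      show "(\<Sum>j<Suc (Suc n). fscale ((x + y) j) (v j)) = (\<Sum>j<Suc (Suc n). fscale (x j) (v j)) + (\<Sum>j<Suc (Suc n). fscale (y j) (v j))"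
        by (simp only: plus_fun_apply fs.scale_left_distrib sum.distrib)
      show "(\<Sum>j<Suc (Suc n). fscale (fscale c x j) (v j)) = fscale c (\<Sum>j<Suc (Suc n). fscale (x j) (v j))"
        by (simp only: fs.scale_sum_right fs.scale_scale fscale_apply)
      show "(\<Sum>j<Suc (Suc n). fscale (x j) (v j)) \<in> supported {..<Suc n}"
        using vk unfolding kpow_eq_supported[symmetric]
        by (intro fs.subspace_sum[OF subspace_kpow] fs.subspace_scale[OF subspace_kpow])
    qed auto
    obtain y where y: "y \<in> supported {..<Suc (Suc n)}" "y \<noteq> 0" "(\<Sum>j<Suc (Suc n). fscale (y j) (v j)) = 0"
      using T.kernel_nonzero by auto
    have "\<forall>i<Suc (Suc n). y i = 0" by (rule sum_zero_if_not_in_span[OF no y(3)])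
    then show False using y(1,2) by (auto simp: supported_def fun_eq_iff)
  qed
  then obtain d0 where d0: "d0 \<le> n" "v (Suc d0) \<in> fs.span (v ` {..<Suc d0})" by blast
  define d where "d = (LEAST d. v (Suc d) \<in> fs.span (v ` {..<Suc d}))"
  have dn: "d \<le> n" using d0 Least_le[of "\<lambda>d. v (Suc d) \<in> fs.span (v ` {..<Suc d})" d0] by (simp add: d_def)
  have "v (Suc d) \<in> fs.span (v ` {..<Suc d})" unfolding d_def by (rule LeastI[of _ d0]) (rule d0(2))
  then obtain c where c: "v (Suc d) = (\<Sum>j<Suc d. fscale (c j) (v j))" by (rule span_image_sum) auto
  have ind: "v i \<notin> fs.span (v ` {..<i})" if "i \<le> d" for i
  proof (cases i)
    case 0 then show ?thesis using v0(2) by (simp add: v_0)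
  next
    case (Suc j)
    then show ?thesis using not_less_Least[of j "\<lambda>d. v (Suc d) \<in> fs.span (v ` {..<Suc d})"] that
      by (simp add: d_def)
  qed
  \<comment> \<open>The coefficients are aligned at \<open>i = d\<close>, where \<open>v l\<close>
    is subtracted with factor \<open>c (l + 1)\<close>. Going down one step shifts them by one,
    matching the chain relation; \<open>c 0\<close> never occurs because
    \<open>C (v 0) = 0\<close>.\<close>
  define u where "u i = v i - (\<Sum>l<i. fscale (c (Suc (l + (d - i)))) (v l))" for i
  have shift: "(\<Sum>l<Suc i. fscale (e l) (mat_fun C (v l))) = (\<Sum>l<i. fscale (e (Suc l)) (mat_fun A (v l)))" for e i
    unfolding sum.lessThan_Suc_shift by (simp only: C0 CA fs.scale_zero_right add_0_left)
  have uA: "mat_fun A (u i) = mat_fun A (v i) - (\<Sum>l<i. fscale (c (Suc (l + (d - i)))) (mat_fun A (v l)))" for i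
    unfolding u_def mat_fun_minus by (simp only: mat_fun_sum[OF finite_lessThan])
  have uC: "mat_fun C (u i) = mat_fun C (v i) - (\<Sum>l<i. fscale (c (Suc (l + (d - i)))) (mat_fun C (v l)))" for i
    unfolding u_def mat_fun_minus by (simp only: mat_fun_sum[OF finite_lessThan])
  have sums: "(\<Sum>l<i. fscale (a l) (v l)) \<in> fs.span (v ` {..<i})" for a i
    by (intro fs.span_sum fs.span_scale fs.span_base) auto
  have uspan: "u l \<in> fs.span (v ` {..<i})" if "l < i" for l i
  proof -
    have "fs.span (v ` {..<l}) \<subseteq> fs.span (v ` {..<i})" using that by (intro fs.span_mono) auto
    then have "(\<Sum>k<l. fscale (a k) (v k)) \<in> fs.span (v ` {..<i})" for a using sums by blast
    moreover have "v l \<in> fs.span (v ` {..<i})" using that by (intro fs.span_base) auto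
    ultimately show ?thesis unfolding u_def by (intro fs.span_diff)
  qed
  show thesis
  proof (rule that[of d u])
    show "u i \<in> kpow (Suc n)" for i
      unfolding u_def using vk
      by (intro fs.subspace_diff[OF subspace_kpow] fs.subspace_sum[OF subspace_kpow] fs.subspace_scale[OF subspace_kpow])
    show "u i \<notin> fs.span (u ` {..<i})" if i: "i \<le> d" for i
    proof
      assume "u i \<in> fs.span (u ` {..<i})"
      moreover have "fs.span (u ` {..<i}) \<subseteq> fs.span (v ` {..<i})"
        using uspan by (intro fs.span_minimal) auto
      ultimately have "u i + (\<Sum>l<i. fscale (c (Suc (l + (d - i)))) (v l)) \<in> fs.span (v ` {..<i})"
        using sums by (intro fs.span_add) auto
      then have "v i \<in> fs.span (v ` {..<i})" unfolding u_def by (simp only: diff_add_cancel)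
      then show False using ind[OF i] by blast
    qed
    show "mat_fun C (u 0) = 0" unfolding u_def using C0 by simp
    show "mat_fun C (u (Suc i)) = mat_fun A (u i)" if i: "i < d" for i
    proof -
      have "Suc (Suc l + (d - Suc i)) = Suc (l + (d - i))" for l using i by simp
      then show ?thesis unfolding uC uA shift CA by (simp only:)
    qed
    have "mat_fun A (v d) = (\<Sum>l<Suc d. fscale (c l) (mat_fun C (v l)))"
      unfolding CA[symmetric] c by (rule mat_fun_sum) simp
    then show "mat_fun A (u d) = 0"
      unfolding uA shift by (simp only: diff_self_eq_0 add_0_right diff_self)
  qed (fact dn)
qed

lemma mult_columns:
  assumes A: "A \<in> carrier_mat m n" and v: "\<And>j. j < k \<Longrightarrow> v j \<in> kpow n"
  shows "A * mat n k (\<lambda>(i, j). v j i) = mat m k (\<lambda>(i, j). mat_fun A (v j) i)"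
  using A by (intro eq_matI) (auto simp: scalar_prod_def mat_fun_def atLeast0LessThan)

text \<open>The chain embeds the standard pair of size \<open>d\<close>; by dimension count there is also a nonzero
  morphism back, and the composite is an invertible scalar.\<close>

lemma pair_normal_form:
  fixes A C :: "'k::field mat"
  assumes A: "A \<in> carrier_mat n (Suc n)" and C: "C \<in> carrier_mat n (Suc n)"
    and R: "right_invertible C" and B: "pair_brick (Suc n) n A C"
  obtains Q P where "bijective_mat (Suc n) Q" "bijective_mat n P"
    "A * Q = P * pi_plus_mat n" "C * Q = P * pi_minus_mat n"
proof -
  obtain d v where d: "d \<le> n" and vk: "\<And>i. v i \<in> kpow (Suc n)"
    and ind: "\<And>i. i \<le> d \<Longrightarrow> v i \<notin> fs.span (v ` {..<i})"
    and C0: "mat_fun C (v 0) = 0" and CA: "\<And>i. i < d \<Longrightarrow> mat_fun C (v (Suc i)) = mat_fun A (v i)"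
    and Ad: "mat_fun A (v d) = 0"
    using kernel_chain[OF A C R] by metis
  \<comment> \<open>The columns of \<open>Q\<close> are the chain, those of \<open>P\<close> its
    images under \<open>A\<close> without the last, which is 0. So \<open>A\<close> acts by dropping
    the last coordinate and \<open>C\<close>, since \<open>C (v 0) = 0\<close>, by dropping the
    first.\<close>
  define Q where "Q = mat (Suc n) (Suc d) (\<lambda>(i, j). v j i)"
  define P where "P = mat n d (\<lambda>(i, j). mat_fun A (v j) i)"
  have Q: "Q \<in> carrier_mat (Suc n) (Suc d)" and P: "P \<in> carrier_mat n d" by (simp_all add: Q_def P_def)
  have AQ: "A * Q = P * pi_plus_mat d"
    unfolding Q_def mult_columns[OF A vk] mult_pi_mat(1)[OF P]
    using Ad by (intro eq_matI) (auto simp: P_def less_Suc_eq)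
  have CQ: "C * Q = P * pi_minus_mat d"
    unfolding Q_def mult_columns[OF C vk] mult_pi_mat(2)[OF P]
  proof (rule eq_matI, goal_cases)
    case (1 i j)
    then show ?case using C0 CA by (cases j) (auto simp: P_def)
  qed auto
  have Qinj: "left_invertible Q"
  proof (rule left_invertible_if_injective[OF Q])
    fix x :: "nat \<Rightarrow> 'k" assume x: "x \<in> kpow (Suc d)" "mat_fun Q x = 0"
    have "mat_fun Q x = (\<Sum>j<Suc d. fscale (x j) (v j))"
    proof
      fix i
      have "(\<Sum>j<Suc d. v j i * x j) = 0" if "\<not> i < Suc n"
        using vk that by (intro sum.neutral) (auto simp: kpow_def)
      then show "mat_fun Q x i = (\<Sum>j<Suc d. fscale (x j) (v j)) i"
        by (auto simp: mat_fun_def Q_def sum_fun_apply mult.commute simp del: sum.lessThan_Suc)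
    qed
    then have "(\<Sum>j<Suc d. fscale (x j) (v j)) = 0" using x(2) by simp
    then have "\<forall>i<Suc d. x i = 0" by (rule sum_zero_if_not_in_span[rotated]) (simp add: ind)
    then show "x = 0" using x(1) by (auto simp: kpow_def fun_eq_iff not_le[symmetric])
  qed
  \<comment> \<open>The Euler form from the given pair to the standard one is
    \<open>(d + 1) * (n + 1) + d * n - 2 * d * (n + 1) = n + 1 - d\<close>, positive because
    \<open>d \<le> n\<close>.\<close>
  obtain F G where F: "F \<in> carrier_mat (Suc d) (Suc n)" and G: "G \<in> carrier_mat d n"
    and FG: "G * A = pi_plus_mat d * F" "G * C = pi_minus_mat d * F"
    and nz: "F \<noteq> 0\<^sub>m (Suc d) (Suc n) \<or> G \<noteq> 0\<^sub>m d n"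
  proof (rule pair_hom_nonzero[OF A C pi_mat_carrier(1)[of d] pi_mat_carrier(2)[of d]])
    show "2 * d * Suc n < Suc d * Suc n + d * n" using d by simp
  qed blast
  have comm: "P * G * A = A * (Q * F)" "P * G * C = C * (Q * F)"
    using assoc_mult_mat[OF P G A] assoc_mult_mat[OF P G C] assoc_mult_mat[OF A Q F] assoc_mult_mat[OF C Q F]
      assoc_mult_mat[OF P pi_mat_carrier(1) F] assoc_mult_mat[OF P pi_mat_carrier(2) F] FG AQ CQ by simp_all
  have QF: "Q * F \<in> carrier_mat (Suc n) (Suc n)" and PG: "P * G \<in> carrier_mat n n"
    using Q F P G by auto
  obtain c where c: "Q * F = c \<cdot>\<^sub>m 1\<^sub>m (Suc n)" "P * G = c \<cdot>\<^sub>m 1\<^sub>m n"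
    using B QF PG comm unfolding pair_brick_def by blast
  \<comment> \<open>Otherwise injectivity of \<open>Q\<close> gives \<open>F = 0\<close>, then
    \<open>G * C = 0\<close>, and surjectivity of \<open>C\<close> gives
    \<open>G = 0\<close>.\<close>
  have "c \<noteq> 0"
  proof
    assume "c = 0"
    then have QF0: "Q * F = 0\<^sub>m (Suc n) (Suc n)" using c(1) by (simp add: smult_0_mat)
    obtain L where L: "L \<in> carrier_mat (Suc d) (Suc n)" "L * Q = 1\<^sub>m (Suc d)"
      using Qinj Q by (auto simp: left_invertible_def)
    have F0: "F = 0\<^sub>m (Suc d) (Suc n)"
      using assoc_mult_mat[OF L(1) Q F] L(2) QF0 left_mult_one_mat[OF F] right_mult_zero_mat[OF L(1)] by metis
    obtain S where S: "S \<in> carrier_mat (Suc n) n" "C * S = 1\<^sub>m n"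
      using R C by (auto simp: right_invertible_def)
    have "G * C = 0\<^sub>m d (Suc n)" using FG(2) F0 right_mult_zero_mat[OF pi_mat_carrier(2)] by metis
    then have "G = 0\<^sub>m d n"
      using assoc_mult_mat[OF G C S(1)] S(2) right_mult_one_mat[OF G] left_mult_zero_mat[OF S(1)] by metis
    then show False using nz F0 by blast
  qed
  then have inv: "Q * (inverse c \<cdot>\<^sub>m F) = 1\<^sub>m (Suc n)" "P * (inverse c \<cdot>\<^sub>m G) = 1\<^sub>m n"
    using c mult_smult_distrib[OF Q F] mult_smult_distrib[OF P G] by (auto intro!: eq_matI)
  have "right_invertible Q" "right_invertible P"
    using inv Q P F G unfolding right_invertible_def by (metis carrier_matD smult_carrier_mat)+
  \<comment> \<open>\<open>Q\<close> has \<open>n + 1\<close> rows and \<open>d + 1\<close> columns;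
    a right inverse forces \<open>n \<le> d\<close>, so the chain has full length.\<close>
  moreover from this(1) have "d = n" using right_invertible_dim[OF Q] d by simp
  ultimately show thesis
    using that[of Q P] AQ CQ bijective_matI[of Q "Suc n"] bijective_matI[of P n] Q P by simp
qed

section \<open>Models of the listed representations\<close>

lemma bijective_mat_carrier: "bijective_mat n A \<Longrightarrow> A \<in> carrier_mat n n"
  by (simp add: bijective_mat_def)

lemma bijective_mat_one: "bijective_mat n (1\<^sub>m n)"
  by (auto simp: bijective_mat_def intro!: bexI[of _ "1\<^sub>m n"])

lemma bijective_mat_transpose: "bijective_mat n A \<Longrightarrow> bijective_mat n A\<^sup>T"
proof -
  assume A: "bijective_mat n A"
  then obtain B where B: "A \<in> carrier_mat n n" "B \<in> carrier_mat n n" "A * B = 1\<^sub>m n" "B * A = 1\<^sub>m n"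
    by (auto simp: bijective_mat_def)
  then have "B\<^sup>T * A\<^sup>T = 1\<^sub>m n" "A\<^sup>T * B\<^sup>T = 1\<^sub>m n"
    using transpose_mult[OF B(1,2)] transpose_mult[OF B(2,1)] by (metis transpose_one)+
  then show ?thesis using B by (auto simp: bijective_mat_def intro!: bexI[of _ "B\<^sup>T"])
qed

lemma bijective_mat_mult:
  assumes "bijective_mat n A" "bijective_mat n B" shows "bijective_mat n (A * B)"
proof -
  obtain A' where A: "A \<in> carrier_mat n n" "A' \<in> carrier_mat n n" "A' * A = 1\<^sub>m n"
    using assms(1) by (auto simp: bijective_mat_def)
  obtain B' where B: "B \<in> carrier_mat n n" "B' \<in> carrier_mat n n" "B' * B = 1\<^sub>m n"
    using assms(2) by (auto simp: bijective_mat_def)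
  have "B' * A' * (A * B) = B' * (A' * (A * B))"
    by (rule assoc_mult_mat[OF B(2) A(2) mult_carrier_mat[OF A(1) B(1)]])
  also have "A' * (A * B) = A' * A * B" by (rule assoc_mult_mat[OF A(2,1) B(1), symmetric])
  finally have "B' * A' * (A * B) = 1\<^sub>m n" using A(3) B by simp
  then have "left_invertible (A * B)"
    using A B by (auto simp: left_invertible_def intro!: bexI[of _ "B' * A'"])
  then show ?thesis using A(1) B(1) by (intro bijective_matI) auto
qed

lemma rep_iso_mrepI:
  assumes M: "mats d M" "mats d M'" and P: "mat_hom d M d M' P" and bij: "\<And>v. bijective_mat (d v) (P v)"
  shows "rep_iso (mrep d M) (mrep d M')"
proof -
  have "bij_betw (mat_fun (P v)) (kpow (d v)) (kpow (d v))" for v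
  proof -
    obtain Q where Q: "P v \<in> carrier_mat (d v) (d v)" "Q \<in> carrier_mat (d v) (d v)"
      "P v * Q = 1\<^sub>m (d v)" "Q * P v = 1\<^sub>m (d v)"
      using bij[of v] by (auto simp: bijective_mat_def)
    show ?thesis
    proof (rule bij_betwI[of _ _ _ "mat_fun Q"])
      fix x :: "nat \<Rightarrow> 'a" assume x: "x \<in> kpow (d v)"
      show "mat_fun Q (mat_fun (P v) x) = x" "mat_fun (P v) (mat_fun Q x) = x"
        using mat_fun_mult[OF Q(2,1), of x] mat_fun_mult[OF Q(1,2), of x] mat_fun_one[OF x] Q(3,4)
        by simp_all
    qed (use mat_fun_in_kpow[OF Q(1)] mat_fun_in_kpow[OF Q(2)] in auto)
  qed
  then show ?thesis
    unfolding rep_iso_def by (intro bexI[OF _ hom_mrepI[OF M P]]) simp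
qed

text \<open>On each branch the identity arrow forces the endomorphism at the middle vertex to equal
  the one at \<open>Vb\<close> or at \<open>Ve\<close>, so only a pair of matrices remains
  free.\<close>

lemma brick_shape_iff:
  fixes A C :: "'k::field mat"
  assumes A: "A \<in> carrier_mat m n" and C: "C \<in> carrier_mat m n"
  shows "brick (shape_dim s t n m) (shape_mat s t n m A C) \<longleftrightarrow> 0 < n + m \<and> pair_brick n m A C"
proof -
  let ?d = "shape_dim s t n m" and ?M = "shape_mat s t n m A C"
  have "(\<exists>v. 0 < ?d v) \<longleftrightarrow> 0 < n + m"
    using shape_dim.simps by (metis add_gr_0 vertex.exhaust)
  moreover have "pair_brick n m A C" if B: "brick ?d ?M"
    unfolding pair_brick_def
  proof (intro ballI impI)
    fix F G assume FG: "F \<in> carrier_mat n n" "G \<in> carrier_mat m m" "G * A = A * F \<and> G * C = C * F"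
    define H where "H v = (case v of Vb \<Rightarrow> F | Vplus \<Rightarrow> if s then F else G | Vminus \<Rightarrow> if t then F else G | Ve \<Rightarrow> G)" for v
    have "mat_hom ?d ?M ?d ?M H"
      using FG A C by (simp add: mat_hom_def all_vertex all_arrow H_def)
    then obtain c where "\<And>v. H v = c \<cdot>\<^sub>m 1\<^sub>m (?d v)" using B unfolding brick_def by blast
    from this[of Vb] this[of Ve] show "\<exists>c. F = c \<cdot>\<^sub>m 1\<^sub>m n \<and> G = c \<cdot>\<^sub>m 1\<^sub>m m" by (auto simp: H_def)
  qed
  moreover have "\<exists>c. \<forall>v. F v = c \<cdot>\<^sub>m 1\<^sub>m (?d v)" if B: "pair_brick n m A C" and F: "mat_hom ?d ?M ?d ?M F" for F
  proof -
    have car: "F Vb \<in> carrier_mat n n" "F Ve \<in> carrier_mat m m"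
      "F Vplus \<in> carrier_mat (?d Vplus) (?d Vplus)" "F Vminus \<in> carrier_mat (?d Vminus) (?d Vminus)"
      and e: "F Vplus * ?M b_plus = ?M b_plus * F Vb" "F Ve * ?M plus_e = ?M plus_e * F Vplus"
      "F Vminus * ?M b_minus = ?M b_minus * F Vb" "F Ve * ?M minus_e = ?M minus_e * F Vminus"
      using F unfolding mat_hom_def all_vertex all_arrow by auto
    have eq: "F Vplus = (if s then F Vb else F Ve)" "F Vminus = (if t then F Vb else F Ve)"
      using car e by (auto split: if_splits)
    then have "F Ve * A = A * F Vb \<and> F Ve * C = C * F Vb" using e by (auto split: if_splits)
    then obtain c where "F Vb = c \<cdot>\<^sub>m 1\<^sub>m n" "F Ve = c \<cdot>\<^sub>m 1\<^sub>m m"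
      using B car(1,2) unfolding pair_brick_def by blast
    then show ?thesis using eq by (intro exI[of _ c]) (auto simp: all_vertex)
  qed
  ultimately show ?thesis unfolding brick_def by blast
qed

lemma shape_euler:
  assumes "n = Suc m \<or> m = Suc n"
  shows "hom_dim (shape_dim s t n m) (shape_dim s t n m) = Suc (arrow_dim (shape_dim s t n m) (shape_dim s t n m))"
  using assms by (auto simp: hom_dim_def arrow_dim_def)

text \<open>Maps such as \<open>id\<close> agree with their matrices on \<open>kpow\<close> but not
  outside, so the representations need not be equal; the identity is nevertheless an
  isomorphism.\<close>

lemma rep_iso_mrep_same:
  assumes M: "mats d M" and Y: "rep_scale Y = fscale" "\<And>v. rep_space Y v = kpow (d v)"
    and maps: "\<And>a x. x \<in> kpow (d (src a)) \<Longrightarrow> rep_map Y a x = mat_fun (M a) x"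
  shows "rep_iso (mrep d M) Y"
  using assms unfolding rep_iso_def
  by (intro bexI[of _ "\<lambda>_ x. x"]) (auto simp: hom_def linear_between_def bij_betw_def)

lemma mat_fun_pi:
  "mat_fun (pi_plus_mat n) a = pi_plus n a" "mat_fun (pi_minus_mat n) a = pi_minus n a"
  by (auto simp: mat_fun_def pi_plus_mat_def pi_minus_mat_def pi_plus_def pi_minus_def fun_eq_iff
      if_distrib[of "\<lambda>x. x * _"] cong: if_cong)

lemma mat_fun_pi_transpose:
  "mat_fun (pi_plus_mat n)\<^sup>T a = j_plus n a" "mat_fun (pi_minus_mat n)\<^sup>T a = j_minus n a"
proof -
  show "mat_fun (pi_plus_mat n)\<^sup>T a = j_plus n a"
    by (auto simp: mat_fun_def pi_plus_mat_def j_plus_def fun_eq_iff if_distrib[of "\<lambda>x. x * _"] cong: if_cong)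
  have "(\<Sum>j<n. (if Suc j = i then 1 else 0) * a j) = (if 1 \<le> i \<and> i \<le> n then a (i - 1) else 0)" for i
    by (cases i) (auto simp: if_distrib[of "\<lambda>x. x * _"] cong: if_cong)
  then show "mat_fun (pi_minus_mat n)\<^sup>T a = j_minus n a"
    by (auto simp: mat_fun_def pi_minus_mat_def j_minus_def fun_eq_iff)
qed

fun shape_label :: "bool \<Rightarrow> bool \<Rightarrow> bool \<Rightarrow> nat \<Rightarrow> label" where
  "shape_label False False True m = E1 m"
| "shape_label False False False m = E2 m"
| "shape_label True True False m = E3 m"
| "shape_label True True True m = E4 m"
| "shape_label True False False m = E5 m"
| "shape_label True False True m = E6 m"
| "shape_label False True True m = E7 m"
| "shape_label False True False m = E8 m"

text \<open>For dimensions 0 and 1 this is the 1 x 1 identity between nonzero spaces and an empty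
  matrix elsewhere, so one formula models all of \<open>F_plus\<close>, \<open>F_minus\<close>,
  \<open>G_plus\<close>, \<open>G_minus\<close>.\<close>

definition ones :: "(vertex \<Rightarrow> nat) \<Rightarrow> arrow \<Rightarrow> 'k::field mat" where
  "ones d a = mat (d (tgt a)) (d (src a)) (\<lambda>_. 1)"

lemma mats_ones: "mats d (ones d)"
  by (simp add: mats_def ones_def)

definition point_dim :: "vertex \<Rightarrow> vertex \<Rightarrow> nat" where
  "point_dim u v = (if v = u then 1 else 0)"

text \<open>The parameter is the vertex left out, so \<open>G_plus\<close> corresponds to
  \<open>Vminus\<close> and \<open>G_minus\<close> to \<open>Vplus\<close>.\<close>

definition arc_dim :: "vertex \<Rightarrow> vertex \<Rightarrow> nat" where
  "arc_dim u v = (if v = u then 0 else 1)"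

fun label_dim :: "label \<Rightarrow> vertex \<Rightarrow> nat" where
  "label_dim (E1 m) = shape_dim False False (Suc m) m"
| "label_dim (E2 m) = shape_dim False False m (Suc m)"
| "label_dim (E3 m) = shape_dim True True m (Suc m)"
| "label_dim (E4 m) = shape_dim True True (Suc m) m"
| "label_dim (E5 m) = shape_dim True False m (Suc m)"
| "label_dim (E6 m) = shape_dim True False (Suc m) m"
| "label_dim (E7 m) = shape_dim False True (Suc m) m"
| "label_dim (E8 m) = shape_dim False True m (Suc m)"
| "label_dim F_plus = point_dim Vplus"
| "label_dim F_minus = point_dim Vminus"
| "label_dim G_plus = arc_dim Vminus"
| "label_dim G_minus = arc_dim Vplus"

lemma listed_space: "rep_space (listed l :: 'k::field seq_rep) v = kpow (label_dim l v)"
  by (cases l; cases v) (simp_all add: point_dim_def arc_dim_def)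

lemma listed_scale: "rep_scale (listed l :: 'k::field seq_rep) = fscale"
  by (cases l) (simp_all add: fun_eq_iff)

lemma label_dim_shape:
  "label_dim (shape_label s t True m) = shape_dim s t (Suc m) m"
  "label_dim (shape_label s t False m) = shape_dim s t m (Suc m)"
  by (cases s; cases t; simp)+

lemma rep_iso_shape_listed:
  "rep_iso (mrep (shape_dim s t (Suc m) m) (shape_mat s t (Suc m) m (pi_plus_mat m) (pi_minus_mat m)))
    (listed (shape_label s t True m) :: 'k::field seq_rep)" (is ?pi)
  "rep_iso (mrep (shape_dim s t m (Suc m)) (shape_mat s t m (Suc m) (pi_plus_mat m)\<^sup>T (pi_minus_mat m)\<^sup>T))
    (listed (shape_label s t False m) :: 'k seq_rep)" (is ?j)
proof -
  show ?pi
  proof (rule rep_iso_mrep_same[OF _ listed_scale])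
    fix a and x :: "nat \<Rightarrow> 'k" assume "x \<in> kpow (shape_dim s t (Suc m) m (src a))"
    then show "rep_map (listed (shape_label s t True m)) a x
        = mat_fun (shape_mat s t (Suc m) m (pi_plus_mat m) (pi_minus_mat m) a) x"
      by (cases s; cases t; cases a) (simp_all add: mat_fun_pi mat_fun_one)
  qed (simp_all add: mats_shape listed_space label_dim_shape)
  show ?j
  proof (rule rep_iso_mrep_same[OF _ listed_scale])
    fix a and x :: "nat \<Rightarrow> 'k" assume "x \<in> kpow (shape_dim s t m (Suc m) (src a))"
    then show "rep_map (listed (shape_label s t False m)) a x
        = mat_fun (shape_mat s t m (Suc m) (pi_plus_mat m)\<^sup>T (pi_minus_mat m)\<^sup>T a) x"
      by (cases s; cases t; cases a) (simp_all add: mat_fun_pi_transpose mat_fun_one)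
  qed (simp_all add: mats_shape listed_space label_dim_shape)
qed

lemma rep_iso_thin_listed:
  assumes "l \<in> {F_plus, F_minus, G_plus, G_minus}"
  shows "rep_iso (mrep (label_dim l) (ones (label_dim l))) (listed l :: 'k::field seq_rep)"
proof (rule rep_iso_mrep_same[OF mats_ones listed_scale listed_space])
  fix a and x :: "nat \<Rightarrow> 'k" assume "x \<in> kpow (label_dim l (src a))"
  then show "rep_map (listed l) a x = mat_fun (ones (label_dim l) a) x"
    using assms
    by (cases a) (auto simp: ones_def point_dim_def arc_dim_def mat_fun_def fun_eq_iff kpow_def)
qed

lemma scalar_mat_small:
  "F \<in> carrier_mat 0 0 \<Longrightarrow> F = c \<cdot>\<^sub>m 1\<^sub>m 0" "F \<in> carrier_mat 1 1 \<Longrightarrow> F = F $$ (0, 0) \<cdot>\<^sub>m 1\<^sub>m 1"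
  for F :: "'k::field mat"
  by (auto intro!: eq_matI)

lemma brick_point: "brick (point_dim u) (ones (point_dim u) :: arrow \<Rightarrow> 'k::field mat)"
  unfolding brick_def
proof (intro conjI allI impI)
  show "\<exists>v. 0 < point_dim u v" by (intro exI[of _ u]) (simp add: point_dim_def)
  fix F :: "vertex \<Rightarrow> 'k mat"
  assume "mat_hom (point_dim u) (ones (point_dim u)) (point_dim u) (ones (point_dim u)) F"
  then have car: "F v \<in> carrier_mat (point_dim u v) (point_dim u v)" for v by (simp add: mat_hom_def)
  have "F v = F u $$ (0, 0) \<cdot>\<^sub>m 1\<^sub>m (point_dim u v)" for v
    using car[of v] scalar_mat_small by (cases "v = u") (auto simp: point_dim_def)
  then show "\<exists>c. \<forall>v. F v = c \<cdot>\<^sub>m 1\<^sub>m (point_dim u v)" by blast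
qed

text \<open>The support is a path of two arrows, both the 1 x 1 identity, along which the single
  entry of an endomorphism is constant.\<close>

lemma brick_arc:
  assumes "u = Vplus \<or> u = Vminus"
  shows "brick (arc_dim u) (ones (arc_dim u) :: arrow \<Rightarrow> 'k::field mat)"
  unfolding brick_def
proof (intro conjI allI impI)
  show "\<exists>v. 0 < arc_dim u v" using assms by (intro exI[of _ Vb]) (auto simp: arc_dim_def)
  fix F :: "vertex \<Rightarrow> 'k mat"
  assume F: "mat_hom (arc_dim u) (ones (arc_dim u)) (arc_dim u) (ones (arc_dim u)) F"
  then have car: "F v \<in> carrier_mat (arc_dim u v) (arc_dim u v)" for v by (simp add: mat_hom_def)
  have step: "F (tgt a) $$ (0, 0) = F (src a) $$ (0, 0)" if a: "src a \<noteq> u" "tgt a \<noteq> u" for a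
  proof -
    have "F (tgt a) * ones (arc_dim u) a = ones (arc_dim u) a * F (src a)" using F by (simp add: mat_hom_def)
    then have "(F (tgt a) * ones (arc_dim u) a) $$ (0, 0) = (ones (arc_dim u) a * F (src a)) $$ (0, 0)" by simp
    then show ?thesis using car[of "tgt a"] car[of "src a"] a
      by (simp add: ones_def arc_dim_def scalar_prod_def)
  qed
  have "F v $$ (0, 0) = F Vb $$ (0, 0)" if "v \<noteq> u" for v
    using assms that step[of b_plus] step[of plus_e] step[of b_minus] step[of minus_e] by (cases v) auto
  then have "F v = F Vb $$ (0, 0) \<cdot>\<^sub>m 1\<^sub>m (arc_dim u v)" for v
    using car[of v] scalar_mat_small(1)[of "F v"] scalar_mat_small(2)[of "F v"]
    by (cases "v = u") (auto simp: arc_dim_def)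
  then show "\<exists>c. \<forall>v. F v = c \<cdot>\<^sub>m 1\<^sub>m (arc_dim u v)" by blast
qed

lemma listed_model:
  obtains d M where "mats d M" "brick d M" "hom_dim d d = Suc (arrow_dim d d)"
    "rep_iso (mrep d M) (listed l :: 'k::field seq_rep)"
proof -
  have shape: "\<exists>d M. mats d M \<and> brick d M \<and> hom_dim d d = Suc (arrow_dim d d) \<and>
      rep_iso (mrep d M) (listed (shape_label s t dir m) :: 'k seq_rep)" for s t dir m
  proof (cases dir)
    case True
    let ?d = "shape_dim s t (Suc m) m"
    let ?M = "shape_mat s t (Suc m) m (pi_plus_mat m) (pi_minus_mat m) :: arrow \<Rightarrow> 'k mat"
    have "brick ?d ?M" by (simp add: brick_shape_iff pair_brick_pi)
    then show ?thesis
      using True rep_iso_shape_listed(1)[of s t m] shape_euler[of "Suc m" m s t]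
      by (intro exI[of _ ?d] exI[of _ ?M]) (simp add: mats_shape)
  next
    case False
    let ?d = "shape_dim s t m (Suc m)"
    let ?M = "shape_mat s t m (Suc m) (pi_plus_mat m)\<^sup>T (pi_minus_mat m)\<^sup>T :: arrow \<Rightarrow> 'k mat"
    have "brick ?d ?M"
      using pair_brick_transpose[OF pi_mat_carrier pair_brick_pi, of m] by (simp add: brick_shape_iff)
    then show ?thesis
      using False rep_iso_shape_listed(2)[of s t m] shape_euler[of m "Suc m" s t]
      by (intro exI[of _ ?d] exI[of _ ?M]) (simp add: mats_shape)
  qed
  have point: "hom_dim (point_dim u) (point_dim u) = Suc (arrow_dim (point_dim u) (point_dim u))" for u
    by (cases u) (simp_all add: hom_dim_def arrow_dim_def point_dim_def)
  have arc: "hom_dim (arc_dim u) (arc_dim u) = Suc (arrow_dim (arc_dim u) (arc_dim u))"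
    if "u = Vplus \<or> u = Vminus" for u
    using that by (auto simp: hom_dim_def arrow_dim_def arc_dim_def)
  have thin: "\<exists>d M. mats d M \<and> brick d M \<and> hom_dim d d = Suc (arrow_dim d d) \<and>
      rep_iso (mrep d M) (listed l :: 'k seq_rep)"
    if "l \<in> {F_plus, F_minus, G_plus, G_minus}" "brick (label_dim l) (ones (label_dim l) :: arrow \<Rightarrow> 'k mat)"
      "hom_dim (label_dim l) (label_dim l) = Suc (arrow_dim (label_dim l) (label_dim l))" for l
    using rep_iso_thin_listed[OF that(1)] that(2,3) mats_ones by blast
  have "(\<exists>s t dir m. l = shape_label s t dir m) \<or> l \<in> {F_plus, F_minus, G_plus, G_minus}"
    by (cases l) (simp_all add: ex_bool_eq)
  then consider s t dir m where "l = shape_label s t dir m" | "l = F_plus" | "l = F_minus" | "l = G_plus" | "l = G_minus"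
    by blast
  then have "\<exists>d M. mats d M \<and> brick d M \<and> hom_dim d d = Suc (arrow_dim d d) \<and>
      rep_iso (mrep d M) (listed l :: 'k seq_rep)"
  proof cases
    case 1 then show ?thesis using shape by blast
  next
    case 2 then show ?thesis using thin[of l] point[of Vplus] brick_point[of Vplus] by simp
  next
    case 3 then show ?thesis using thin[of l] point[of Vminus] brick_point[of Vminus] by simp
  next
    case 4 then show ?thesis using thin[of l] arc[of Vminus] brick_arc[of Vminus] by simp
  next
    case 5 then show ?thesis using thin[of l] arc[of Vplus] brick_arc[of Vplus] by simp
  qed
  then show thesis using that by blast
qed

section \<open>The classification\<close>

lemma euler_cases:
  fixes b p m e :: nat
  assumes "b * b + p * p + m * m + e * e = Suc (p * b + e * p + m * b + e * m)"
  shows "(m = b \<and> e = b \<and> (p = Suc b \<or> b = Suc p)) \<or> (p = b \<and> e = b \<and> (m = Suc b \<or> b = Suc m)) \<or>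
    ((b = Suc e \<or> e = Suc b) \<and> (p = b \<or> p = e) \<and> (m = b \<or> m = e))"
proof -
  define x y z w where "x = int b - int p" and "y = int p - int e" and "z = int b - int m" and "w = int m - int e"
  have "int (b * b + p * p + m * m + e * e) = int (Suc (p * b + e * p + m * b + e * m))"
    using assms by (rule arg_cong)
  then have sum: "x * x + y * y + z * z + w * w = 2"
    by (simp add: x_def y_def z_def w_def algebra_simps)
  have small: "r = -1 \<or> r = 0 \<or> r = 1" if "r * r \<le> 2" for r :: int
  proof (rule ccontr)
    assume "\<not> ?thesis"
    then have "2 \<le> \<bar>r\<bar>" by linarith
    then have "2 * 2 \<le> \<bar>r\<bar> * \<bar>r\<bar>" by (intro mult_mono) auto
    then show False using that by (simp add: abs_mult_self_eq)
  qed
  have nn: "0 \<le> x * x" "0 \<le> y * y" "0 \<le> z * z" "0 \<le> w * w" by simp_all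
  \<comment> \<open>Both branches have total difference \<open>b - e\<close>. Hence two nonzero
    differences on one branch have opposite signs, while one on each branch gives equal
    signs.\<close>
  have loop: "x + y = z + w" by (simp add: x_def y_def z_def w_def)
  have "x = -1 \<or> x = 0 \<or> x = 1" "y = -1 \<or> y = 0 \<or> y = 1" "z = -1 \<or> z = 0 \<or> z = 1" "w = -1 \<or> w = 0 \<or> w = 1"
    using sum nn by (intro small; linarith)+
  then have "(z = 0 \<and> w = 0 \<and> (x = 1 \<and> y = -1 \<or> x = -1 \<and> y = 1)) \<or>
      (x = 0 \<and> y = 0 \<and> (z = 1 \<and> w = -1 \<or> z = -1 \<and> w = 1)) \<or>
      ((x = 0 \<or> y = 0) \<and> (z = 0 \<or> w = 0) \<and> (x + y = 1 \<or> x + y = -1))"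
    using sum loop by (elim disjE) simp_all
  then show ?thesis unfolding x_def y_def z_def w_def by presburger
qed

lemma empty_mat_eq:
  "A \<in> carrier_mat n m \<Longrightarrow> B \<in> carrier_mat n m \<Longrightarrow> n = 0 \<or> m = 0 \<Longrightarrow> A = B"
  by (auto intro!: eq_matI)

text \<open>If the branch through \<open>w\<close> consists of isomorphisms with composite \<open>\<theta>\<close>, then
  \<open>\<theta>\<^sup>-\<^sup>1 \<beta> \<alpha>\<close> and its analogues at the other vertices form an endomorphism.\<close>

lemma loop_case:
  fixes M :: "arrow \<Rightarrow> 'k::field mat"
  assumes sel: "(a1, a2, c1, c2, u, w) = (b_plus, plus_e, b_minus, minus_e, Vplus, Vminus) \<or>
      (a1, a2, c1, c2, u, w) = (b_minus, minus_e, b_plus, plus_e, Vminus, Vplus)"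
    and M: "mats d M" and B: "brick d M" and R: "rigid d M"
    and dims: "d w = d Vb" "d Ve = d Vb" "d u = Suc (d Vb) \<or> d Vb = Suc (d u)"
  shows "(d = point_dim u \<or> d = arc_dim u) \<and> rep_iso (mrep d M) (mrep d (ones d))"
proof -
  define n p where "n = d Vb" and "p = d u"
  define \<alpha> \<beta> \<gamma> \<delta> where "\<alpha> = M a1" and "\<beta> = M a2" and "\<gamma> = M c1" and "\<delta> = M c2"
  have ends: "src a1 = Vb" "tgt a1 = u" "src a2 = u" "tgt a2 = Ve"
    "src c1 = Vb" "tgt c1 = w" "src c2 = w" "tgt c2 = Ve"
    and distinct: "u \<noteq> Vb" "u \<noteq> Ve" "w \<noteq> Vb" "w \<noteq> Ve" "u \<noteq> w"
    using sel by auto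
  \<comment> \<open>Quantifiers are rewritten in the renamed vertices and arrows, so that a single
    argument treats both choices of the branch.\<close>
  have allv: "\<And>P. (\<forall>v. P v) \<longleftrightarrow> P Vb \<and> P u \<and> P w \<and> P Ve"
    and alla: "\<And>P. (\<forall>a. P a) \<longleftrightarrow> P a1 \<and> P a2 \<and> P c1 \<and> P c2"
    using sel by (elim disjE; auto simp: all_vertex all_arrow)+
  have \<alpha>: "\<alpha> \<in> carrier_mat p n" and \<beta>: "\<beta> \<in> carrier_mat n p"
    and \<gamma>: "\<gamma> \<in> carrier_mat n n" and \<delta>: "\<delta> \<in> carrier_mat n n"
    using matsD[OF M, of a1] matsD[OF M, of a2] matsD[OF M, of c1] matsD[OF M, of c2] ends dims(1,2)
    by (auto simp: n_def p_def \<alpha>_def \<beta>_def \<gamma>_def \<delta>_def)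
  note rank = rigid_max_rank[OF M R]
  have bij: "bijective_mat n \<gamma>" "bijective_mat n \<delta>"
    using bijective_matI \<gamma> \<delta> rank unfolding \<gamma>_def \<delta>_def by blast+
  obtain \<gamma>' where \<gamma>': "\<gamma>' \<in> carrier_mat n n" "\<gamma> * \<gamma>' = 1\<^sub>m n" "\<gamma>' * \<gamma> = 1\<^sub>m n"
    using bij(1) by (auto simp: bijective_mat_def)
  obtain \<delta>' where \<delta>': "\<delta>' \<in> carrier_mat n n" "\<delta> * \<delta>' = 1\<^sub>m n" "\<delta>' * \<delta> = 1\<^sub>m n"
    using bij(2) by (auto simp: bijective_mat_def)
  \<comment> \<open>The inverse of the composite \<open>\<delta> * \<gamma>\<close> along the branch
    through \<open>w\<close>.\<close>
  define \<theta> where "\<theta> = \<gamma>' * \<delta>'"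
  have "bijective_mat n \<gamma>'" "bijective_mat n \<delta>'"
    using \<gamma> \<gamma>' \<delta> \<delta>' unfolding bijective_mat_def by blast+
  then have bij\<theta>: "bijective_mat n \<theta>" unfolding \<theta>_def by (rule bijective_mat_mult)
  have \<theta>: "\<theta> \<in> carrier_mat n n" using bijective_mat_carrier[OF bij\<theta>] .
  define X Y where "X = \<beta> * \<alpha>" and "Y = \<theta> * X"
  have X: "X \<in> carrier_mat n n" and Y: "Y \<in> carrier_mat n n" and \<theta>\<beta>: "\<theta> * \<beta> \<in> carrier_mat n p"
    and \<alpha>\<theta>: "\<alpha> * \<theta> \<in> carrier_mat p n" and \<gamma>Y: "\<gamma> * Y \<in> carrier_mat n n"
    using \<alpha> \<beta> \<gamma> \<theta> by (auto simp: X_def Y_def)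
  \<comment> \<open>At each vertex \<open>F\<close> goes once around the cycle starting there, with
    the branch through \<open>w\<close> traversed backwards; at \<open>w\<close> this is
    \<open>Y\<close> conjugated by \<open>\<gamma>\<close>.\<close>
  define F where "F v = (if v = Vb then Y else if v = u then \<alpha> * (\<theta> * \<beta>)
      else if v = w then \<gamma> * Y * \<gamma>' else \<beta> * (\<alpha> * \<theta>))" for v
  have F: "F Vb = Y" "F u = \<alpha> * (\<theta> * \<beta>)" "F w = \<gamma> * Y * \<gamma>'" "F Ve = \<beta> * (\<alpha> * \<theta>)"
    using distinct by (simp_all add: F_def)
  have 1: "\<alpha> * (\<theta> * \<beta>) * \<alpha> = \<alpha> * Y"
    unfolding X_def Y_def using assoc_mult_mat[OF \<alpha> \<theta>\<beta> \<alpha>] assoc_mult_mat[OF \<theta> \<beta> \<alpha>] by simp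
  have 2: "\<beta> * (\<alpha> * \<theta>) * \<beta> = \<beta> * (\<alpha> * (\<theta> * \<beta>))"
    using assoc_mult_mat[OF \<beta> \<alpha>\<theta> \<beta>] assoc_mult_mat[OF \<alpha> \<theta> \<beta>] by simp
  have 3: "\<gamma> * Y * \<gamma>' * \<gamma> = \<gamma> * Y"
    using assoc_mult_mat[OF \<gamma>Y \<gamma>'(1) \<gamma>] \<gamma>'(3) right_mult_one_mat[OF \<gamma>Y] by metis
  have "\<theta> * \<delta> = \<gamma>'"
    unfolding \<theta>_def using assoc_mult_mat[OF \<gamma>'(1) \<delta>'(1) \<delta>] \<delta>'(3) right_mult_one_mat[OF \<gamma>'(1)] by metis
  then have 4: "\<beta> * (\<alpha> * \<theta>) * \<delta> = \<beta> * (\<alpha> * \<gamma>')"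
    using assoc_mult_mat[OF \<beta> \<alpha>\<theta> \<delta>] assoc_mult_mat[OF \<alpha> \<theta> \<delta>] by simp
  have "\<gamma> * \<theta> = \<delta>'"
    unfolding \<theta>_def using assoc_mult_mat[OF \<gamma> \<gamma>'(1) \<delta>'(1)] \<gamma>'(2) left_mult_one_mat[OF \<delta>'(1)] by metis
  then have "\<gamma> * Y = \<delta>' * X" unfolding Y_def using assoc_mult_mat[OF \<gamma> \<theta> X] by simp
  then have "\<delta> * (\<gamma> * Y) = X"
    using assoc_mult_mat[OF \<delta> \<delta>'(1) X] \<delta>'(2) left_mult_one_mat[OF X] by metis
  then have 5: "\<delta> * (\<gamma> * Y * \<gamma>') = \<beta> * (\<alpha> * \<gamma>')"
    using assoc_mult_mat[OF \<delta> \<gamma>Y \<gamma>'(1)] assoc_mult_mat[OF \<beta> \<alpha> \<gamma>'(1)] unfolding X_def by metis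
  have car: "\<alpha> * (\<theta> * \<beta>) \<in> carrier_mat p p" "\<gamma> * Y * \<gamma>' \<in> carrier_mat n n" "\<beta> * (\<alpha> * \<theta>) \<in> carrier_mat n n"
    using mult_carrier_mat[OF \<alpha> \<theta>\<beta>] mult_carrier_mat[OF \<gamma>Y \<gamma>'(1)] mult_carrier_mat[OF \<beta> \<alpha>\<theta>] .
  have "mat_hom d M d M F"
    unfolding mat_hom_def allv alla
    using 1 2 3 4 5 Y car dims(1,2)
    by (simp only: F ends \<alpha>_def[symmetric] \<beta>_def[symmetric] \<gamma>_def[symmetric] \<delta>_def[symmetric]
        n_def[symmetric] p_def[symmetric] simp_thms)
  then obtain c where c: "\<And>v. F v = c \<cdot>\<^sub>m 1\<^sub>m (d v)" using B unfolding brick_def by blast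
  have c: "\<theta> * (\<beta> * \<alpha>) = c \<cdot>\<^sub>m 1\<^sub>m n" "\<alpha> * (\<theta> * \<beta>) = c \<cdot>\<^sub>m 1\<^sub>m p"
    using c[of Vb] c[of u] by (simp_all only: F Y_def X_def n_def p_def)
  note loop = loop_dims[OF \<alpha> \<beta> bij\<theta> rank[of a1, folded \<alpha>_def] rank[of a2, folded \<beta>_def] c]
  have np: "d Vb = n" "d u = p" "d w = n" "d Ve = n" using dims by (simp_all add: n_def p_def)
  from dims(3) show ?thesis
  proof
    assume "d u = Suc (d Vb)"
    then have 0: "n = 0" "p = 1" using loop(1) by (simp_all add: n_def p_def)
    have d: "d = point_dim u"
      using np 0 distinct by (simp add: fun_eq_iff allv point_dim_def)
    \<comment> \<open>Only the space at \<open>u\<close> is nonzero, so every arrow has an empty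
      matrix.\<close>
    have ones: "ones d a = M a" for a
    proof (rule empty_mat_eq)
      have "\<forall>a. d (tgt a) = 0 \<or> d (src a) = 0" using np 0 by (simp add: alla ends)
      then show "d (tgt a) = 0 \<or> d (src a) = 0" by (rule spec)
    qed (use matsD[OF M] matsD[OF mats_ones] in auto)
    have "mat_hom d M d (ones d) (\<lambda>v. 1\<^sub>m (d v))"
      using left_mult_one_mat[OF matsD[OF M]] right_mult_one_mat[OF matsD[OF M]]
      by (simp add: mat_hom_def ones)
    then show ?thesis
      using rep_iso_mrepI[OF M mats_ones _ bijective_mat_one] d by blast
  next
    assume "d Vb = Suc (d u)"
    then have 0: "n = 1" "p = 0" using loop(2) by (simp_all add: n_def p_def)
    have d: "d = arc_dim u"
      using np 0 distinct by (simp add: fun_eq_iff allv arc_dim_def)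
    \<comment> \<open>Each space on the branch through \<open>w\<close> is identified with the one
      at \<open>Ve\<close> by the path leading there, which turns both of its arrows into
      identities.\<close>
    define P where "P v = (if v = Vb then \<delta> * \<gamma> else if v = w then \<delta> else 1\<^sub>m (d v))" for v
    have P: "P Vb = \<delta> * \<gamma>" "P w = \<delta>" "P u = 1\<^sub>m p" "P Ve = 1\<^sub>m n"
      using distinct np by (simp_all add: P_def)
    have "\<forall>v. bijective_mat (d v) (P v)"
      unfolding allv P np using bij bijective_mat_mult bijective_mat_one by blast
    moreover have "mat_hom d M d (ones d) P"
      unfolding mat_hom_def alla
    proof (intro conjI)
      show "\<forall>v. P v \<in> carrier_mat (d v) (d v)" using calculation bijective_mat_carrier by blast
      have one: "ones d c1 = (1\<^sub>m n :: 'k mat)" "ones d c2 = (1\<^sub>m n :: 'k mat)"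
        using np 0 by (auto simp: ones_def ends intro!: eq_matI)
      have \<delta>\<gamma>: "\<delta> * \<gamma> \<in> carrier_mat n n" using \<delta> \<gamma> by simp
      have oa: "(ones d a1 :: 'k mat) \<in> carrier_mat p n" and ob: "(ones d a2 :: 'k mat) \<in> carrier_mat n p"
        using matsD[OF mats_ones, of d a1] matsD[OF mats_ones, of d a2] by (simp_all add: ends np)
      show "P (tgt c1) * M c1 = ones d c1 * P (src c1)"
        using left_mult_one_mat[OF \<delta>\<gamma>] by (simp only: ends P one \<gamma>_def)
      show "P (tgt c2) * M c2 = ones d c2 * P (src c2)"
        by (simp only: ends P one \<delta>_def)
      show "P (tgt a1) * M a1 = ones d a1 * P (src a1)"
        unfolding ends P \<alpha>_def[symmetric]
        by (rule empty_mat_eq[OF mult_carrier_mat[OF one_carrier_mat \<alpha>] mult_carrier_mat[OF oa \<delta>\<gamma>]])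
          (simp add: 0)
      show "P (tgt a2) * M a2 = ones d a2 * P (src a2)"
        unfolding ends P \<beta>_def[symmetric]
        by (rule empty_mat_eq[OF mult_carrier_mat[OF one_carrier_mat \<beta>] mult_carrier_mat[OF ob one_carrier_mat]])
          (simp add: 0)
    qed
    ultimately show ?thesis using rep_iso_mrepI[OF M mats_ones] d by blast
  qed
qed

text \<open>A base change at the middle vertex alone, by the inverse of \<open>\<alpha>\<close> or
  by \<open>\<beta>\<close>, absorbs the invertible arrow and leaves the composite of the branch
  unchanged.\<close>

lemma branch_normal_form:
  fixes \<alpha> \<beta> :: "'k::field mat"
  assumes \<alpha>: "\<alpha> \<in> carrier_mat p n" and \<beta>: "\<beta> \<in> carrier_mat m p"
    and rank: "left_invertible \<alpha> \<or> right_invertible \<alpha>" "left_invertible \<beta> \<or> right_invertible \<beta>"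
    and p: "p = n \<or> p = m"
  obtains P where "bijective_mat p P" "P * \<alpha> = (if p = n then 1\<^sub>m n else \<beta> * \<alpha>)"
    "\<beta> = (if p = n then \<beta> * \<alpha> else 1\<^sub>m m) * P"
proof (cases "p = n")
  case True
  then have "bijective_mat n \<alpha>" using bijective_matI \<alpha> rank(1) by blast
  then obtain \<alpha>' where \<alpha>': "\<alpha>' \<in> carrier_mat n n" "\<alpha> * \<alpha>' = 1\<^sub>m n" "\<alpha>' * \<alpha> = 1\<^sub>m n"
    by (auto simp: bijective_mat_def)
  then have "bijective_mat n \<alpha>'" using \<alpha> True by (auto simp: bijective_mat_def)
  moreover have "\<beta> = \<beta> * \<alpha> * \<alpha>'"
    using assoc_mult_mat[OF \<beta> \<alpha> \<alpha>'(1)] \<alpha>'(2) \<beta> True by simp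
  ultimately show thesis using that[of \<alpha>'] \<alpha>'(3) True by simp
next
  case False
  then have "p = m" using p by simp
  then have "bijective_mat p \<beta>" using bijective_matI \<beta> rank(2) by blast
  moreover have "\<beta> = 1\<^sub>m m * \<beta>" using \<beta> by simp
  ultimately show thesis using that[of \<beta>] False by simp
qed

lemma shape_mat_hom:
  assumes "A' * Q = P * A" "C' * Q = P * C"
    and "A \<in> carrier_mat m n" "C \<in> carrier_mat m n" "A' \<in> carrier_mat m n" "C' \<in> carrier_mat m n"
    and "Q \<in> carrier_mat n n" "P \<in> carrier_mat m m"
  shows "mat_hom (shape_dim s t n m) (shape_mat s t n m A C) (shape_dim s t n m) (shape_mat s t n m A' C')
    (\<lambda>v. case v of Vb \<Rightarrow> Q | Vplus \<Rightarrow> if s then Q else P | Vminus \<Rightarrow> if t then Q else P | Ve \<Rightarrow> P)"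
  using assms by (simp add: mat_hom_def all_vertex all_arrow)

lemma rep_iso_shape:
  fixes A C A' C' :: "'k::field mat"
  assumes "A' * Q = P * A" "C' * Q = P * C"
    and car: "A \<in> carrier_mat m n" "C \<in> carrier_mat m n" "A' \<in> carrier_mat m n" "C' \<in> carrier_mat m n"
    and Q: "bijective_mat n Q" and P: "bijective_mat m P"
  shows "rep_iso (mrep (shape_dim s t n m) (shape_mat s t n m A C))
    (mrep (shape_dim s t n m) (shape_mat s t n m A' C'))"
proof (rule rep_iso_mrepI[OF mats_shape mats_shape shape_mat_hom])
  fix v show "bijective_mat (shape_dim s t n m v)
      (case v of Vb \<Rightarrow> Q | Vplus \<Rightarrow> if s then Q else P | Vminus \<Rightarrow> if t then Q else P | Ve \<Rightarrow> P)"
    using P Q by (cases v) auto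
qed (use assms bijective_mat_carrier in auto)

lemma shape_case:
  fixes M :: "arrow \<Rightarrow> 'k::field mat"
  assumes M: "mats d M" and ex: "exceptional (mrep d M)"
    and dims: "d Vb = Suc (d Ve) \<or> d Ve = Suc (d Vb)" "d Vplus = d Vb \<or> d Vplus = d Ve"
      "d Vminus = d Vb \<or> d Vminus = d Ve"
  obtains l where "rep_iso (mrep d M) (listed l :: 'k seq_rep)"
proof -
  have R: "rigid d M" using ex exceptional_mrep_iff[OF M] by simp
  note rank = rigid_max_rank[OF M R]
  define n m s t where "n = d Vb" and "m = d Ve" and "s \<longleftrightarrow> d Vplus = d Vb" and "t \<longleftrightarrow> d Vminus = d Vb"
  let ?A = "M plus_e * M b_plus" and ?C = "M minus_e * M b_minus"
  have d: "d = shape_dim s t n m"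
    using dims by (auto simp: fun_eq_iff all_vertex n_def m_def s_def t_def)
  have car: "M b_plus \<in> carrier_mat (d Vplus) n" "M plus_e \<in> carrier_mat m (d Vplus)"
    "M b_minus \<in> carrier_mat (d Vminus) n" "M minus_e \<in> carrier_mat m (d Vminus)"
    using matsD[OF M, of b_plus] matsD[OF M, of plus_e] matsD[OF M, of b_minus] matsD[OF M, of minus_e]
    by (simp_all add: n_def m_def)
  have A: "?A \<in> carrier_mat m n" and C: "?C \<in> carrier_mat m n"
    using mult_carrier_mat[OF car(2,1)] mult_carrier_mat[OF car(4,3)] .
  let ?S = "shape_mat s t n m ?A ?C"
  have S: "mats d ?S" unfolding d by (rule mats_shape[OF A C])
  obtain P where P: "bijective_mat (d Vplus) P" "P * M b_plus = (if s then 1\<^sub>m n else ?A)"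
    "M plus_e = (if s then ?A else 1\<^sub>m m) * P"
    using branch_normal_form[OF car(1,2) rank rank] dims(2) unfolding s_def n_def m_def by metis
  obtain P' where P': "bijective_mat (d Vminus) P'" "P' * M b_minus = (if t then 1\<^sub>m n else ?C)"
    "M minus_e = (if t then ?C else 1\<^sub>m m) * P'"
    using branch_normal_form[OF car(3,4) rank rank] dims(3) unfolding t_def n_def m_def by metis
  let ?P = "\<lambda>v. case v of Vb \<Rightarrow> 1\<^sub>m n | Vplus \<Rightarrow> P | Vminus \<Rightarrow> P' | Ve \<Rightarrow> 1\<^sub>m m"
  have bij: "bijective_mat (d v) (?P v)" for v
    using P(1) P'(1) bijective_mat_one by (cases v) (simp_all add: n_def m_def)
  have "mat_hom d M d ?S ?P"
    unfolding mat_hom_def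
  proof (intro conjI)
    show "\<forall>v. ?P v \<in> carrier_mat (d v) (d v)" using bij bijective_mat_carrier by blast
    have "(if s then 1\<^sub>m n else ?A) * 1\<^sub>m n = (if s then 1\<^sub>m n else ?A)"
      "(if t then 1\<^sub>m n else ?C) * 1\<^sub>m n = (if t then 1\<^sub>m n else ?C)"
      using right_mult_one_mat[OF A] right_mult_one_mat[OF C] by auto
    moreover have "1\<^sub>m m * M plus_e = M plus_e" "1\<^sub>m m * M minus_e = M minus_e"
      using left_mult_one_mat[OF car(2)] left_mult_one_mat[OF car(4)] .
    ultimately show "\<forall>a. ?P (tgt a) * M a = ?S a * ?P (src a)"
      unfolding all_arrow using P(2,3) P'(2,3)
      by (simp only: tgt.simps src.simps vertex.case shape_mat.simps simp_thms)
  qed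
  then have isoS: "rep_iso (mrep d M) (mrep d ?S)" by (rule rep_iso_mrepI[OF M S _ bij])
  then have "exceptional (mrep d ?S)" using exceptional_iso[OF fd_mrep[OF M] fd_mrep[OF S] _ ex] by blast
  then have bS: "brick d ?S" and rS: "rigid d ?S" using exceptional_mrep_iff[OF S] by auto
  have B: "pair_brick n m ?A ?C" using bS brick_shape_iff[OF A C] unfolding d by blast
  \<comment> \<open>In the normal form the composite is itself the matrix of an arrow,
    \<open>plus_e\<close> or \<open>b_plus\<close> according to \<open>s\<close>, so
    \<open>rigid_max_rank\<close> applies to it directly.\<close>
  have rA: "left_invertible ?A \<or> right_invertible ?A"
    using rigid_max_rank[OF S rS, of b_plus] rigid_max_rank[OF S rS, of plus_e]
    by (cases s) (simp_all only: shape_mat.simps if_True if_False)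
  have rC: "left_invertible ?C \<or> right_invertible ?C"
    using rigid_max_rank[OF S rS, of b_minus] rigid_max_rank[OF S rS, of minus_e]
    by (cases t) (simp_all only: shape_mat.simps if_True if_False)
  have "\<exists>l. rep_iso (mrep d ?S) (listed l :: 'k seq_rep)"
  proof (cases "n = Suc m")
    case True
    have A': "?A \<in> carrier_mat m (Suc m)" and C': "?C \<in> carrier_mat m (Suc m)" using A C True by simp_all
    have "right_invertible ?C" using rC left_invertible_dim[OF C] True by auto
    then obtain Q P where QP: "bijective_mat (Suc m) Q" "bijective_mat m P"
      "?A * Q = P * pi_plus_mat m" "?C * Q = P * pi_minus_mat m"
      using pair_normal_form[OF A' C'] B True by metis
    have "rep_iso (mrep (shape_dim s t (Suc m) m) (shape_mat s t (Suc m) m (pi_plus_mat m) (pi_minus_mat m)))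
        (mrep (shape_dim s t (Suc m) m) (shape_mat s t (Suc m) m ?A ?C))"
      by (rule rep_iso_shape[OF QP(3,4) _ _ A' C' QP(1,2)]) simp_all
    then have "rep_iso (mrep d ?S) (mrep (shape_dim s t (Suc m) m) (shape_mat s t (Suc m) m (pi_plus_mat m) (pi_minus_mat m)))"
      unfolding d True by (rule rep_iso_sym[OF fd_mrep, rotated]) (simp add: mats_shape)
    then show ?thesis using rep_iso_trans rep_iso_shape_listed(1) by blast
  next
    case False
    then have m: "m = Suc n" using dims(1) by (auto simp: n_def m_def)
    have A': "?A\<^sup>T \<in> carrier_mat n (Suc n)" and C': "?C\<^sup>T \<in> carrier_mat n (Suc n)"
      using A C m by (simp_all add: transpose_carrier_mat)
    have "left_invertible ?C" using rC right_invertible_dim[OF C] m by auto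
    then have "right_invertible ?C\<^sup>T" using left_invertible_transpose[of "?C\<^sup>T"] by simp
    moreover have "pair_brick (Suc n) n ?A\<^sup>T ?C\<^sup>T" using pair_brick_transpose[OF A C B] m by simp
    ultimately obtain Q P where QP: "bijective_mat (Suc n) Q" "bijective_mat n P"
      "?A\<^sup>T * Q = P * pi_plus_mat n" "?C\<^sup>T * Q = P * pi_minus_mat n"
      using pair_normal_form[OF A' C'] by metis
    note Qc = bijective_mat_carrier[OF QP(1)] and Pc = bijective_mat_carrier[OF QP(2)]
    \<comment> \<open>Transposing back exchanges the roles: the transpose of \<open>P\<close> acts
      at \<open>Vb\<close> and that of \<open>Q\<close> at \<open>Ve\<close>.\<close>
    have "(pi_plus_mat n)\<^sup>T * P\<^sup>T = Q\<^sup>T * ?A" "(pi_minus_mat n)\<^sup>T * P\<^sup>T = Q\<^sup>T * ?C"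
      using transpose_mult[OF A' Qc] transpose_mult[OF C' Qc] transpose_mult[OF Pc pi_mat_carrier(1)]
        transpose_mult[OF Pc pi_mat_carrier(2)] QP(3,4) by (metis transpose_transpose)+
    then have "rep_iso (mrep (shape_dim s t n (Suc n)) (shape_mat s t n (Suc n) ?A ?C))
        (mrep (shape_dim s t n (Suc n)) (shape_mat s t n (Suc n) (pi_plus_mat n)\<^sup>T (pi_minus_mat n)\<^sup>T))"
      using A C m bijective_mat_transpose[OF QP(1)] bijective_mat_transpose[OF QP(2)]
      by (intro rep_iso_shape) simp_all
    then show ?thesis
      using rep_iso_trans rep_iso_shape_listed(2) unfolding d m by blast
  qed
  then show thesis using that rep_iso_trans[OF isoS] by blast
qed

lemma exceptional_mrep_listed:
  fixes M :: "arrow \<Rightarrow> 'k::field mat"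
  assumes M: "mats d M" and ex: "exceptional (mrep d M)"
  obtains l where "rep_iso (mrep d M) (listed l :: 'k seq_rep)"
proof -
  have B: "brick d M" and R: "rigid d M" using ex exceptional_mrep_iff[OF M] by auto
  have thin: "\<exists>l. rep_iso (mrep d (ones d)) (listed l :: 'k seq_rep)"
    if "d = point_dim u \<or> d = arc_dim u" "u = Vplus \<or> u = Vminus" for u
  proof -
    have "\<exists>l\<in>{F_plus, F_minus, G_plus, G_minus}. d = label_dim l" using that by auto
    then show ?thesis using rep_iso_thin_listed by blast
  qed
  have "d Vb * d Vb + d Vplus * d Vplus + d Vminus * d Vminus + d Ve * d Ve =
      Suc (d Vplus * d Vb + d Ve * d Vplus + d Vminus * d Vb + d Ve * d Vminus)"
    using brick_rigid_iff[OF M B] R by (simp add: hom_dim_def arrow_dim_def)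
  from euler_cases[OF this] consider
    (plus) "d Vminus = d Vb" "d Ve = d Vb" "d Vplus = Suc (d Vb) \<or> d Vb = Suc (d Vplus)" |
    (minus) "d Vplus = d Vb" "d Ve = d Vb" "d Vminus = Suc (d Vb) \<or> d Vb = Suc (d Vminus)" |
    (shape) "d Vb = Suc (d Ve) \<or> d Ve = Suc (d Vb)" "d Vplus = d Vb \<or> d Vplus = d Ve"
      "d Vminus = d Vb \<or> d Vminus = d Ve"
    by blast
  then have "\<exists>l. rep_iso (mrep d M) (listed l :: 'k seq_rep)"
  proof cases
    case plus
    then show ?thesis
      using loop_case[of b_plus plus_e b_minus minus_e Vplus Vminus, OF _ M B R plus] thin[of Vplus] rep_iso_trans
      by blast
  next
    case minus
    then show ?thesis
      using loop_case[of b_minus minus_e b_plus plus_e Vminus Vplus, OF _ M B R minus] thin[of Vminus] rep_iso_trans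
      by blast
  next
    case shape
    then show ?thesis using shape_case[OF M ex] by blast
  qed
  then show thesis using that by blast
qed

section \<open>Distinct labels, and the classification theorem\<close>

lemma kpow_bij_le:
  fixes f :: "(nat \<Rightarrow> 'k::field) \<Rightarrow> nat \<Rightarrow> 'k"
  assumes f: "linear_between fscale (kpow n) fscale (kpow m) f" and inj: "inj_on f (kpow n)"
  shows "n \<le> m"
proof -
  obtain A where A: "A \<in> carrier_mat m n" "\<And>x. x \<in> kpow n \<Longrightarrow> f x = mat_fun A x"
    using between_kpow_mat[OF f] by metis
  have zero: "(0 :: nat \<Rightarrow> 'k) \<in> kpow n" by (simp add: kpow_def)
  have "x = 0" if "x \<in> kpow n" "mat_fun A x = 0" for x
    using inj_onD[OF inj _ that(1) zero] A(2)[OF that(1)] A(2)[OF zero] that(2) by simp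
  then show ?thesis using left_invertible_dim[OF A(1)] left_invertible_if_injective[OF A(1)] by blast
qed

lemma kpow_bij_eq:
  fixes f :: "(nat \<Rightarrow> 'k::field) \<Rightarrow> nat \<Rightarrow> 'k"
  assumes f: "linear_between fscale (kpow n) fscale (kpow m) f" and bij: "bij_betw f (kpow n) (kpow m)"
  shows "n = m"
proof (rule antisym)
  show "n \<le> m" using kpow_bij_le[OF f] bij by (simp add: bij_betw_def)
  obtain r where r: "linear_between fscale (kpow m) fscale (kpow n) r" "\<And>w. w \<in> kpow m \<Longrightarrow> f (r w) = w"
    using subspace_pair.between_right_inverse[OF seq_pair[OF subspace_kpow subspace_kpow] f] bij
    unfolding bij_betw_def by metis
  then show "m \<le> n" by (intro kpow_bij_le[OF r(1)] inj_on_inverseI)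
qed

text \<open>Dimension vectors already separate the labels: in the eight families the dimensions at
  \<open>Vb\<close> and \<open>Ve\<close> differ by 1, its sign and the end that each middle vertex
  agrees with determine the family, and in the other four cases they are equal.\<close>

lemma label_dim_inj: "(\<forall>v. label_dim l v = label_dim l' v) \<Longrightarrow> l = l'"
  unfolding all_vertex by (cases l; cases l') (auto simp: point_dim_def arc_dim_def)

theorem proposition2p3:
  fixes X :: "('k::alg_closed_field, 'v::ab_group_add) rep"
  assumes "fd_rep X"
  shows "(exceptional X \<longleftrightarrow> (\<exists>l. rep_iso X (listed l :: ('k, nat \<Rightarrow> 'k) rep))) \<and>
         (\<forall>l l'. rep_iso (listed l :: ('k, nat \<Rightarrow> 'k) rep) (listed l' :: ('k, nat \<Rightarrow> 'k) rep) \<longrightarrow> l = l')"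
proof (intro conjI iffI allI impI)
  assume ex: "exceptional X"
  obtain d and M :: "arrow \<Rightarrow> 'k mat" where M: "mats d M" "rep_iso (mrep d M) X"
    using fd_rep_coordinates[OF assms] by metis
  note XM = rep_iso_sym[OF fd_mrep[OF M(1)] M(2)]
  have "exceptional (mrep d M)" using exceptional_iso[OF assms fd_mrep[OF M(1)] XM ex] .
  then obtain l where "rep_iso (mrep d M) (listed l :: 'k seq_rep)"
    using exceptional_mrep_listed[OF M(1)] by metis
  then show "\<exists>l. rep_iso X (listed l :: 'k seq_rep)" using rep_iso_trans[OF XM] by blast
next
  assume "\<exists>l. rep_iso X (listed l :: 'k seq_rep)"
  then obtain l where l: "rep_iso X (listed l :: 'k seq_rep)" by blast
  obtain d and M :: "arrow \<Rightarrow> 'k mat" where M: "mats d M" "brick d M" "hom_dim d d = Suc (arrow_dim d d)"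
    "rep_iso (mrep d M) (listed l)"
    using listed_model by metis
  have "rep_iso (mrep d M) X" using rep_iso_trans[OF M(4) rep_iso_sym[OF assms l]] .
  moreover have "exceptional (mrep d M)"
    using exceptional_mrep_iff[OF M(1)] brick_rigid_iff[OF M(1,2)] M(2,3) by blast
  ultimately show "exceptional X" using exceptional_iso[OF fd_mrep[OF M(1)] assms] by blast
next
  fix l l' assume "rep_iso (listed l :: 'k seq_rep) (listed l' :: 'k seq_rep)"
  then obtain f where f: "f \<in> hom (listed l :: 'k seq_rep) (listed l' :: 'k seq_rep)"
    "\<And>v. bij_betw (f v) (kpow (label_dim l v)) (kpow (label_dim l' v))"
    unfolding rep_iso_def listed_space by blast
  have "label_dim l v = label_dim l' v" for v
    using kpow_bij_eq[OF _ f(2)] hom_betweenD[OF f(1), of v] unfolding listed_space listed_scale by blast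
  then show "l = l'" using label_dim_inj by blast
qed

end
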